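(* Let $N\ge 1$, let $-\infty=x_0<x_1<\dots<x_N<x_{N+1}=+\infty$, and let $h_1,h_2:\mathbb{R}\to\mathbb{R}$ be continuous piecewise linear functions such that, for $i=1,2$ and $j=0,\dots,N$, $h_i'(x)=\kappa_i^j$ for all $x\in\,]x_j,x_{j+1}[$, where the $\kappa_i^j$ are real constants. Assume that for every $j=0,\dots,N$ the point $(\kappa_1^j,\kappa_2^j)$ belongs to $\mathcal{A}_1\cup\mathcal{A}_2$. Then the system $$u_1(x)=h_1(x)-u_1'u_2'-\tfrac{(u_1')^2}{2},\qquad u_2(x)=h_2(x)-u_1'u_2'-\tfrac{(u_2')^2}{2}$$ has a unique admissible solution $u=(u_1,u_2):\mathbb{R}\to\mathbb{R}^2$, and the corresponding functions $\alpha_i^*=-u_i'$, $i=1,2$, provide a Nash equilibrium solution in feedback form to the non-cooperative differential game with dynamics $\dot x=\alpha_1+\alpha_2$, $x(0)=y$, and costs $J_i=\int_0^\infty e^{-t}\big[h_i(x(t))+\alpha_i^2(t)/2\big]\,dt$, $i=1,2$.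
   Context: Sectors: for $k=1,\dots,8$, $\mathcal{A}_k=\{\rho(\cos\theta,\sin\theta)\in\mathbb{R}^2 : \rho>0,\ \theta\in\,](k-1)\pi/4,\ k\pi/4[\,\}$. Admissible solution: a function $u=(u_1,u_2):\mathbb{R}\to\mathbb{R}^2$ is an admissible solution of the displayed system if: (A1) $u$ is absolutely continuous (on bounded intervals) and its derivative $u'$ satisfies the system at a.e. $x\in\mathbb{R}$; (A2) there is a constant $C$ such that $|u(x)|\le C(1+|x|)$ for all $x\in\mathbb{R}$; (A3) at every $y\in\mathbb{R}$ the derivative $u'$ admits right and left limits $u'(y+)$, $u'(y-)$, and at points where $u'$ is discontinuous these limits satisfy at least one of the conditions $u_1'(y+)+u_2'(y+)\le 0$ or $u_1'(y-)+u_2'(y-)\ge 0$. Game: two players; player $i$ chooses a control $t\mapsto\alpha_i(t)$, $t\in[0,\infty[$, with values in a compact set $U_i\subset\mathbb{R}$ of admissible control values (taken large enough to contain all values $-u_i'(x)$), so as to minimize $J_i$. A pair of feedback strategies $(\alpha_1^*(x),\alpha_2^*(x))$ is a Nash equilibrium solution in feedback form if, for every initial datum $y\in\mathbb{R}$, the Cauchy problem $\dot x=\alpha_1^*(x)+\alpha_2^*(x)$, $x(0)=y$, has at least one Carathéodory solution (an absolutely continuous function satisfying the equation for a.e. $t>0$) defined for all $t\in[0,\infty[$, and, for every such solution and each $i\in\{1,2\}$, the cost to player $i$ along it equals the minimum of $J_i$ over controls $\alpha_i(\cdot)$ with values in $U_i$ for the dynamics $\dot x=\alpha_i(t)+\alpha_j^*(x)$,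 $x(0)=y$, $j\ne i$. *)

theory Defs
  imports "HOL-Analysis.Analysis"
begin

definition sector :: "nat \<Rightarrow> (real \<times> real) set" where
  "sector k = {(\<rho> * cos \<theta>, \<rho> * sin \<theta>) | \<rho> \<theta>.
     0 < \<rho> \<and> (real k - 1) * pi / 4 < \<theta> \<and> \<theta> < real k * pi / 4}"

definition abs_continuous_on :: "real \<Rightarrow> real \<Rightarrow> (real \<Rightarrow> 'a::real_normed_vector) \<Rightarrow> bool" where
  "abs_continuous_on a b f \<longleftrightarrow>
     (\<forall>\<epsilon>>0. \<exists>\<delta>>0. \<forall>(n::nat) s t.
        (\<forall>k<n. a \<le> s k \<and> s k \<le> t k \<and> t k \<le> b) \<and>
        disjoint_family_on (\<lambda>k. {s k<..<t k}) {..<n} \<and>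
        (\<Sum>k<n. t k - s k) < \<delta> \<longrightarrow>
        (\<Sum>k<n. norm (f (t k) - f (s k))) < \<epsilon>)"

text \<open>
  In the following definition the derivative of \<open>u\<close> is regarded as a function on the set \<open>D\<close> of
  points where \<open>u\<close> is differentiable. Since almost every point belongs to \<open>D\<close>, the one-sided
  limits \<open>r\<close> and \<open>l\<close> along \<open>D\<close> are unique. A point outside \<open>D\<close> counts as a point of discontinuity.
\<close>

definition admissible_solution ::
  "(real \<Rightarrow> real) \<Rightarrow> (real \<Rightarrow> real) \<Rightarrow> (real \<Rightarrow> real \<times> real) \<Rightarrow> bool" where
  "admissible_solution h1 h2 u \<longleftrightarrow>
     (\<forall>a b. abs_continuous_on a b u) \<and>
     (AE x in lebesgue. \<exists>p1 p2. (u has_vector_derivative (p1, p2)) (at x) \<and>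
        fst (u x) = h1 x - p1 * p2 - p1\<^sup>2 / 2 \<and>
        snd (u x) = h2 x - p1 * p2 - p2\<^sup>2 / 2) \<and>
     (\<exists>C. \<forall>x. norm (u x) \<le> C * (1 + \<bar>x\<bar>)) \<and>
     (let D = {x. u differentiable (at x)}; u' = (\<lambda>x. vector_derivative u (at x)) in
      \<forall>y. \<exists>r l. (u' \<longlongrightarrow> r) (at y within D \<inter> {y<..}) \<and>
                (u' \<longlongrightarrow> l) (at y within D \<inter> {..<y}) \<and>
                (\<not> (y \<in> D \<and> continuous (at y within D) u') \<longrightarrow>
                   fst r + snd r \<le> 0 \<or> fst l + snd l \<ge> 0))"

definition caratheodory_solution ::
  "(real \<Rightarrow> real \<Rightarrow> real) \<Rightarrow> real \<Rightarrow> (real \<Rightarrow> real) \<Rightarrow> bool" where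
  "caratheodory_solution g y x \<longleftrightarrow>
     x 0 = y \<and> (\<forall>T\<ge>0. abs_continuous_on 0 T x) \<and>
     (AE t in lebesgue. t > 0 \<longrightarrow> (x has_real_derivative g t (x t)) (at t))"

definition has_cost :: "(real \<Rightarrow> real) \<Rightarrow> (real \<Rightarrow> real) \<Rightarrow> (real \<Rightarrow> real) \<Rightarrow> real \<Rightarrow> bool" where
  "has_cost h \<alpha> x c \<longleftrightarrow>
     has_bochner_integral (lebesgue_on {0..}) (\<lambda>t. exp (- t) * (h (x t) + (\<alpha> t)\<^sup>2 / 2)) c"

text \<open>
  Open-loop controls \<open>\<alpha>\<close> with values in \<open>U\<close>, with a corresponding trajectory \<open>x\<close>, when the opponent
  plays the feedback \<open>b\<close>. As \<open>b\<close> may be discontinuous, a control may have several trajectories or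
  none; the minimum of the cost is taken over all pairs.
\<close>

definition control_trajectory ::
  "real set \<Rightarrow> (real \<Rightarrow> real) \<Rightarrow> real \<Rightarrow> (real \<Rightarrow> real) \<Rightarrow> (real \<Rightarrow> real) \<Rightarrow> bool" where
  "control_trajectory U b y \<alpha> x \<longleftrightarrow>
     \<alpha> \<in> borel_measurable (lebesgue_on {0..}) \<and> (\<forall>t\<ge>0. \<alpha> t \<in> U) \<and>
     caratheodory_solution (\<lambda>t z. \<alpha> t + b z) y x"

definition is_min_cost ::
  "(real \<Rightarrow> real) \<Rightarrow> real set \<Rightarrow> (real \<Rightarrow> real) \<Rightarrow> real \<Rightarrow> real \<Rightarrow> bool" where
  "is_min_cost h U b y c \<longleftrightarrow>
     (\<exists>\<alpha> x. control_trajectory U b y \<alpha> x \<and> has_cost h \<alpha> x c) \<and>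
     (\<forall>\<alpha> x. control_trajectory U b y \<alpha> x \<longrightarrow> (\<exists>c'. has_cost h \<alpha> x c' \<and> c \<le> c'))"

definition nash_feedback ::
  "(real \<Rightarrow> real) \<Rightarrow> (real \<Rightarrow> real) \<Rightarrow> real set \<Rightarrow> real set \<Rightarrow>
   (real \<Rightarrow> real) \<Rightarrow> (real \<Rightarrow> real) \<Rightarrow> bool" where
  "nash_feedback h1 h2 U1 U2 a1 a2 \<longleftrightarrow>
     (\<forall>z. a1 z \<in> U1 \<and> a2 z \<in> U2) \<and>
     (\<forall>y. (\<exists>x. caratheodory_solution (\<lambda>t z. a1 z + a2 z) y x) \<and>
          (\<forall>x. caratheodory_solution (\<lambda>t z. a1 z + a2 z) y x \<longrightarrow>
             (\<exists>c. has_cost h1 (\<lambda>t. a1 (x t)) x c \<and> is_min_cost h1 U1 a2 y c) \<and>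
             (\<exists>c. has_cost h2 (\<lambda>t. a2 (x t)) x c \<and> is_min_cost h2 U2 a1 y c)))"

definition control_sets_for ::
  "(real \<Rightarrow> real \<times> real) \<Rightarrow> real set \<Rightarrow> real set \<Rightarrow> bool" where
  "control_sets_for u U1 U2 \<longleftrightarrow> compact U1 \<and> compact U2 \<and>
     (\<forall>x p1 p2. (u has_vector_derivative (p1, p2)) (at x) \<longrightarrow> - p1 \<in> U1 \<and> - p2 \<in> U2)"

text \<open>
  The feedback given by the negative derivative of \<open>u\<close> is determined only where \<open>u\<close> is differentiable;
  the predicate leaves the values elsewhere arbitrary.
\<close>

definition neg_derivative_feedback ::
  "(real \<Rightarrow> real \<times> real) \<Rightarrow> (real \<Rightarrow> real) \<Rightarrow> (real \<Rightarrow> real) \<Rightarrow> bool" where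
  "neg_derivative_feedback u a1 a2 \<longleftrightarrow>
     (\<forall>x p1 p2. (u has_vector_derivative (p1, p2)) (at x) \<longrightarrow> a1 x = - p1 \<and> a2 x = - p2)"

end

theory Submission
  imports Defs "HOL-Real_Asymp.Real_Asymp"
begin

text \<open>
  With \<open>p = u'\<close>, \<open>f = h - u\<close> and \<open>F p = (p\<^sub>1 * p\<^sub>2 + p\<^sub>1\<^sup>2 / 2, p\<^sub>1 * p\<^sub>2 + p\<^sub>2\<^sup>2 / 2)\<close> the system is
  \<open>F p = f\<close>, and \<open>F p\<close> determines \<open>p\<close> up to sign: a solution can only jump from \<open>p\<close> to \<open>- p\<close>, and (A3)
  allows this only if \<open>p\<^sub>1 + p\<^sub>2 \<ge> 0\<close> to the left of the jump.

  The set where \<open>f\<^sub>1, f\<^sub>2 \<ge> 0\<close>, which is the image under \<open>F\<close> of the quadrants with \<open>p\<^sub>1 * p\<^sub>2 \<ge> 0\<close>, is invariant to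
  the right because \<open>f\<^sub>i = 0\<close> forces \<open>p\<^sub>i = 0\<close>, hence \<open>f\<^sub>i' = h\<^sub>i' > 0\<close>. A solution outside this set stays
  outside on the half-line to the left, where \<open>h'\<close> is constant and \<open>\<bar>f\<^sub>1 - f\<^sub>2\<bar>\<close> grows quadratically; a solution
  with negative slopes keeps them to the right, where \<open>f\<^sub>1 + f\<^sub>2\<close> grows quadratically. Both contradict (A2), so
  both slopes are nonnegative. On that quadrant \<open>F\<close> is monotone, so the distance of two solutions decays to
  the right so fast that, followed to the left, it would violate the growth bound unless it is zero.

  A solution is obtained from the constant slope \<open>h'\<close> on the left half-line and from the Lipschitz equation
  \<open>u' = F\<^sup>-\<^sup>1 (h - u)\<close>, restricted to an invariant box for \<open>f\<close>, to the right. It is continuously differentiable,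
  so \<open>u\<^sub>i\<close> solves the Hamilton-Jacobi equation of player \<open>i\<close> against the other feedback, and integrating
  \<open>(exp (- t) * u\<^sub>i (x t))'\<close> along an arbitrary trajectory shows that \<open>u\<^sub>i\<close> is the minimal cost.
\<close>

section \<open>Absolutely continuous functions\<close>

text \<open>Differentiating \<open>F p = f\<close> would give an equation for \<open>p'\<close>, but
  its coefficient matrix has determinant \<open>p\<^sub>1\<^sup>2 + p\<^sub>1 * p\<^sub>2 +
  p\<^sub>2\<^sup>2\<close> and degenerates at the origin, while \<open>p\<close> may jump and
  \<open>h'\<close> does jump. The proof therefore never differentiates \<open>p\<close>. It follows
  \<open>f\<close>, which is continuous with one-sided derivatives \<open>h' - p\<close> everywhere,
  and passes between \<open>f\<close> and \<open>p\<close> by algebra.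

  As \<open>F\<close> is quadratic, slopes are of order \<open>sqrt \<bar>f\<bar>\<close>; a
  derivative of this order makes \<open>f\<close> grow quadratically, one power more than (A2)
  allows. On the left half-line the drift of \<open>f\<^sub>1 - f\<^sub>2\<close> contains
  \<open>h\<^sub>1' - h\<^sub>2'\<close>, which has a strict sign because the two sectors exclude
  the diagonal.

  The inverse of \<open>F\<close> behaves like a square root at the origin. For existence this is
  met by a box at positive distance from it. An arbitrary admissible solution is not known to stay
  away from the origin, so uniqueness rests on monotonicity instead of a Lipschitz estimate.\<close>

lemma abs_continuous_on_sum_less:
  fixes f :: "real \<Rightarrow> 'a::real_normed_vector"
  assumes "abs_continuous_on a b f" "0 < e"
  obtains d where "0 < d"
    "\<And>(I :: 'i set) s t. \<lbrakk>finite I; \<And>i. i \<in> I \<Longrightarrow> a \<le> s i \<and> s i \<le> t i \<and> t i \<le> b;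
       disjoint_family_on (\<lambda>i. {s i<..<t i}) I; (\<Sum>i\<in>I. t i - s i) < d\<rbrakk>
       \<Longrightarrow> (\<Sum>i\<in>I. norm (f (t i) - f (s i))) < e"
proof -
  obtain d where "0 < d" and d: "\<And>(n::nat) s t. \<lbrakk>\<forall>k<n. a \<le> s k \<and> s k \<le> t k \<and> t k \<le> b;
        disjoint_family_on (\<lambda>k. {s k<..<t k}) {..<n}; (\<Sum>k<n. t k - s k) < d\<rbrakk> \<Longrightarrow>
        (\<Sum>k<n. norm (f (t k) - f (s k))) < e"
    using assms unfolding abs_continuous_on_def by (meson)
  show thesis
  proof
    show "0 < d" by fact
    fix I :: "'i set" and s t
    assume I: "finite I" "\<And>i. i \<in> I \<Longrightarrow> a \<le> s i \<and> s i \<le> t i \<and> t i \<le> b"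
      "disjoint_family_on (\<lambda>i. {s i<..<t i}) I" "(\<Sum>i\<in>I. t i - s i) < d"
    obtain h where h: "bij_betw h {..<card I} I"
      using ex_bij_betw_nat_finite[OF I(1)] by (auto simp: atLeast0LessThan)
    have "(\<Sum>k<card I. norm (f (t (h k)) - f (s (h k)))) < e"
    proof (rule d)
      show "\<forall>k<card I. a \<le> s (h k) \<and> s (h k) \<le> t (h k) \<and> t (h k) \<le> b"
        using I(2) bij_betwE[OF h] by auto
      show "disjoint_family_on (\<lambda>k. {s (h k)<..<t (h k)}) {..<card I}"
        using I(3) bij_betwE[OF h] bij_betw_imp_inj_on[OF h]
        unfolding disjoint_family_on_def inj_on_def by (metis)
      show "(\<Sum>k<card I. t (h k) - s (h k)) < d"
        using sum.reindex_bij_betw[OF h, of "\<lambda>i. t i - s i"] I(4) by simp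
    qed
    then show "(\<Sum>i\<in>I. norm (f (t i) - f (s i))) < e"
      using sum.reindex_bij_betw[OF h, of "\<lambda>i. norm (f (t i) - f (s i))"] by simp
  qed
qed

text \<open>The interiors of the intervals are disjoint subsets of \<open>U\<close>, so their
  lengths add up to at most its measure. Endpoints are written as \<open>Inf\<close> and
  \<open>Sup\<close> of the second component to make them functions on the index set
  \<open>p\<close>, as \<open>abs_continuous_on_sum_less\<close> expects.\<close>

lemma tagged_intervals_length_le_measure:
  fixes p :: "(real \<times> real set) set"
  assumes "p tagged_partial_division_of {a..b}" "open U" "emeasure lebesgue U < ennreal d"
    and sub: "\<And>x K. (x, K) \<in> p \<Longrightarrow> K \<subseteq> U"
  shows "disjoint_family_on (\<lambda>q. {Inf (snd q)<..<Sup (snd q)}) p"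
    and "(\<Sum>q\<in>p. Sup (snd q) - Inf (snd q)) < d"
proof -
  note p = tagged_partial_division_ofD[OF assms(1)]
  have K: "\<exists>u v. u \<le> v \<and> snd q = {u..v} \<and> Inf (snd q) = u \<and> Sup (snd q) = v" if qp: "q \<in> p" for q
  proof -
    obtain x K where q: "q = (x, K)" by force
    obtain u v where "K = {u..v}" using p(4)[of x K] qp q by auto
    moreover have "x \<in> K" using p(2) qp q by auto
    ultimately show ?thesis using q by auto
  qed
  have int: "{Inf (snd q)<..<Sup (snd q)} = interior (snd q)" if "q \<in> p" for q
    using K[OF that] interior_atLeastAtMost_real by metis
  show disj: "disjoint_family_on (\<lambda>q. {Inf (snd q)<..<Sup (snd q)}) p"
    unfolding disjoint_family_on_def
    using int p(5) by (metis prod.collapse)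
  have len: "emeasure lebesgue {Inf (snd q)<..<Sup (snd q)} = ennreal (Sup (snd q) - Inf (snd q))"
    if "q \<in> p" for q
    using K[OF that] by auto
  have "ennreal (\<Sum>q\<in>p. Sup (snd q) - Inf (snd q)) = (\<Sum>q\<in>p. ennreal (Sup (snd q) - Inf (snd q)))"
    using K by (subst sum_ennreal) force+
  also have "\<dots> = (\<Sum>q\<in>p. emeasure lebesgue {Inf (snd q)<..<Sup (snd q)})"
    using len by simp
  also have "\<dots> = emeasure lebesgue (\<Union>q\<in>p. {Inf (snd q)<..<Sup (snd q)})"
    by (rule sum_emeasure) (use disj p(1) in auto)
  also have "\<dots> \<le> emeasure lebesgue U"
  proof (rule emeasure_mono)
    show "(\<Union>q\<in>p. {Inf (snd q)<..<Sup (snd q)}) \<subseteq> U"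
    proof (rule UN_least)
      fix q assume q: "q \<in> p"
      show "{Inf (snd q)<..<Sup (snd q)} \<subseteq> U"
        unfolding int[OF q] using sub[of "fst q" "snd q"] q interior_subset[of "snd q"] by auto
    qed
  qed (use \<open>open U\<close> in auto)
  also have "\<dots> < ennreal d" by fact
  finally show "(\<Sum>q\<in>p. Sup (snd q) - Inf (snd q)) < d"
    by (metis ennreal_leI linorder_not_le)
qed

text \<open>A gauge argument with two kinds of tags. Intervals tagged in \<open>N\<close> lie in an
  open set of small measure, and absolute continuity makes the increments of \<open>f\<close> over
  them small. Intervals tagged elsewhere satisfy the straddle estimate of differentiability. Setting
  the integrand to 0 on \<open>N\<close> removes the Riemann terms of the first kind.\<close>

theorem abs_continuous_on_fundamental_theorem:
  fixes f :: "real \<Rightarrow> 'a::banach"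
  assumes "a \<le> b" and ac: "abs_continuous_on a b f" and N: "negligible N"
    and vecd: "\<And>x. x \<in> {a..b} - N \<Longrightarrow> (f has_vector_derivative f' x) (at x)"
  shows "(f' has_integral (f b - f a)) {a..b}"
proof -
  define g where "g x = (if x \<in> N then 0 else f' x)" for x
  have "(g has_integral (f b - f a)) (cbox a b)"
    unfolding has_integral
  proof (intro allI impI)
    fix e :: real assume "e > 0"
    \<comment> \<open>The \<open>+ 1\<close> covers \<open>a = b\<close> and leaves the strict bound
      \<open>e1 * (b - a) < e / 2\<close>.\<close>
    define e1 where "e1 = e / (2 * (b - a + 1))"
    have "e1 > 0" using \<open>e > 0\<close> \<open>a \<le> b\<close> by (simp add: e1_def)
    have e1b: "e1 * (b - a) < e / 2"
    proof -
      have "e1 * (b - a) < e1 * (b - a + 1)" using \<open>e1 > 0\<close> by simp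
      also have "\<dots> = e / 2" using \<open>a \<le> b\<close> by (simp add: e1_def divide_simps)
      finally show ?thesis .
    qed
    obtain \<delta> where \<delta>: "0 < \<delta>"
      "\<And>(I :: (real \<times> real set) set) s t. \<lbrakk>finite I; \<And>i. i \<in> I \<Longrightarrow> a \<le> s i \<and> s i \<le> t i \<and> t i \<le> b;
       disjoint_family_on (\<lambda>i. {s i<..<t i}) I; (\<Sum>i\<in>I. t i - s i) < \<delta>\<rbrakk>
       \<Longrightarrow> (\<Sum>i\<in>I. norm (f (t i) - f (s i))) < e / 2"
      by (rule abs_continuous_on_sum_less[OF ac half_gt_zero[OF \<open>e > 0\<close>], where 'i = "real \<times> real set"])
         blast
    have "N \<in> null_sets lebesgue" using N by (simp add: negligible_iff_null_sets)
    then obtain U where U: "open U" "N \<subseteq> U" "emeasure lebesgue (U - N) < ennreal \<delta>"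
      using sets_lebesgue_outer_open[OF null_setsD2[OF \<open>N \<in> null_sets lebesgue\<close>] \<delta>(1)] by metis
    have emU: "emeasure lebesgue U < ennreal \<delta>"
      using emeasure_Diff_null_set[OF \<open>N \<in> null_sets lebesgue\<close>, of U] U by auto
    have "\<exists>d>0. x \<in> {a..b} - N \<longrightarrow>
          (\<forall>y. norm (y-x) < d \<longrightarrow> norm (f y - f x - (y-x) *\<^sub>R f' x) \<le> e1 * norm (y-x))" for x
    proof (cases "x \<in> {a..b} - N")
      case True
      then show ?thesis
        using vecd[unfolded has_vector_derivative_def has_derivative_at_alt] \<open>e1 > 0\<close> by blast
    qed (use zero_less_one in blast)
    then obtain d where d: "\<And>x. 0 < d x"
      "\<And>x y. \<lbrakk>x \<in> {a..b} - N; norm (y-x) < d x\<rbrakk> \<Longrightarrow> norm (f y - f x - (y-x) *\<^sub>R f' x) \<le> e1 * norm (y-x)"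
      by metis
    define \<gamma> where "\<gamma> x = (if x \<in> N then U else ball x (d x))" for x
    have gauge: "gauge \<gamma>"
      unfolding gauge_def \<gamma>_def using U d(1) by auto
    show "\<exists>\<gamma>. gauge \<gamma> \<and> (\<forall>p. p tagged_division_of (cbox a b) \<and> \<gamma> fine p \<longrightarrow>
        norm ((\<Sum>(x, k)\<in>p. measure lborel k *\<^sub>R g x) - (f b - f a)) < e)"
    proof (intro exI conjI allI impI, rule gauge, elim conjE)
      fix p assume ptag: "p tagged_division_of cbox a b" and fine: "\<gamma> fine p"
      let ?L = "\<lambda>q. Sup (snd q) - Inf (snd q)"
      let ?D = "\<lambda>q. f (Sup (snd q)) - f (Inf (snd q))"
      note tp = tagged_division_ofD[OF ptag]
      have K: "\<exists>u v. u \<le> v \<and> snd q = {u..v} \<and> a \<le> u \<and> v \<le> b \<and> fst q \<in> {u..v}" if qp: "q \<in> p" for q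
      proof -
        obtain x K where q: "q = (x, K)" by force
        obtain u v where uv: "K = {u..v}" using tp(4)[of x K] qp q by auto
        moreover have "x \<in> K" using tp(2) qp q by auto
        moreover have "K \<subseteq> {a..b}" using tp(3) qp q by auto
        ultimately show ?thesis using q by (intro exI[of _ u] exI[of _ v]) auto
      qed
      have ba: "b - a = (\<Sum>q\<in>p. ?L q)" "f b - f a = (\<Sum>q\<in>p. ?D q)"
        using additive_tagged_division_1[where f= "\<lambda>x. x"] additive_tagged_division_1[where f= f]
          \<open>a \<le> b\<close> ptag by (auto simp: split_def)
      have L0: "0 \<le> ?L q" if "q \<in> p" for q using K[OF that] by auto
      define B where "B = {q \<in> p. fst q \<in> N}"
      have Bp: "B \<subseteq> p" by (auto simp: B_def)
      have "finite p" using tp(1) .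
      have "B tagged_partial_division_of {a..b}"
        using ptag Bp tagged_partial_division_subset unfolding tagged_division_of_def by auto
      note B = tagged_intervals_length_le_measure[OF this U(1) emU]
      have subU: "K \<subseteq> U" if "(x, K) \<in> B" for x K
        using that fine unfolding fine_def B_def \<gamma>_def by fastforce
      have "(\<Sum>q\<in>B. norm (?D q)) < e / 2"
      proof (rule \<delta>(2))
        show "finite B" using Bp \<open>finite p\<close> finite_subset by blast
        show "a \<le> Inf (snd q) \<and> Inf (snd q) \<le> Sup (snd q) \<and> Sup (snd q) \<le> b" if "q \<in> B" for q
          using K[of q] that Bp cInf_atLeastAtMost cSup_atLeastAtMost by (metis subset_iff)
      qed (use B subU in auto)
      moreover have "norm (?D q) = norm (?D q - measure lborel (snd q) *\<^sub>R g (fst q))" if "q \<in> B" for q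
        using that by (simp add: B_def g_def)
      ultimately have 1: "(\<Sum>q\<in>B. norm (?D q - measure lborel (snd q) *\<^sub>R g (fst q))) < e / 2"
        by simp
      have "(\<Sum>q\<in>p - B. norm (?D q - measure lborel (snd q) *\<^sub>R g (fst q))) \<le> (\<Sum>q\<in>p - B. e1 * ?L q)"
      proof (rule sum_mono)
        fix q assume q: "q \<in> p - B"
        obtain x where x: "x = fst q" by simp
        from q obtain u v where uv: "u \<le> v" "snd q = {u..v}" "a \<le> u" "v \<le> b" "x \<in> {u..v}"
          using K[of q] x by blast
        have xN: "x \<in> {a..b} - N" using q uv x by (auto simp: B_def)
        have "snd q \<subseteq> ball x (d x)"
          using fineD[OF fine, of "fst q" "snd q"] q x xN by (auto simp: \<gamma>_def)
        moreover have "u \<in> snd q" "v \<in> snd q"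
          using uv by auto
        ultimately have "u \<in> ball x (d x)" "v \<in> ball x (d x)"
          by blast+
        then have "norm (u - x) < d x" "norm (v - x) < d x"
          by (simp_all add: dist_norm norm_minus_commute)
        note bd = d(2)[OF xN this(1)] d(2)[OF xN this(2)]
        have "norm (?D q - measure lborel (snd q) *\<^sub>R g (fst q)) = norm ((f v - f u) - (v - u) *\<^sub>R f' x)"
          using uv xN by (simp add: x[symmetric] g_def)
        \<comment> \<open>Straddle estimate: both endpoints are compared with the tag, which lies
          between them, so the two errors add up to \<open>e1\<close> times the length.\<close>
        also have "\<dots> = norm ((f v - f x - (v - x) *\<^sub>R f' x) - (f u - f x - (u - x) *\<^sub>R f' x))"
          by (simp add: algebra_simps)
        also have "\<dots> \<le> e1 * norm (v - x) + e1 * norm (u - x)"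
          using bd norm_triangle_ineq4 by (smt (verit))
        also have "\<dots> = e1 * ?L q"
          using uv by (simp add: algebra_simps)
        finally show "norm (?D q - measure lborel (snd q) *\<^sub>R g (fst q)) \<le> e1 * ?L q" .
      qed
      also have "\<dots> \<le> (\<Sum>q\<in>p. e1 * ?L q)"
        using L0 \<open>e1 > 0\<close> \<open>finite p\<close> by (intro sum_mono2) auto
      also have "\<dots> = e1 * (b - a)" by (simp add: ba sum_distrib_left)
      finally have 2: "(\<Sum>q\<in>p - B. norm (?D q - measure lborel (snd q) *\<^sub>R g (fst q))) < e / 2"
        using e1b by linarith
      have "norm ((\<Sum>q\<in>p. measure lborel (snd q) *\<^sub>R g (fst q)) - (f b - f a))
          = norm (\<Sum>q\<in>p. ?D q - measure lborel (snd q) *\<^sub>R g (fst q))"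
        by (simp add: ba sum_subtractf norm_minus_commute)
      also have "\<dots> \<le> (\<Sum>q\<in>p. norm (?D q - measure lborel (snd q) *\<^sub>R g (fst q)))"
        by (rule norm_sum)
      also have "\<dots> = (\<Sum>q\<in>p - B. norm (?D q - measure lborel (snd q) *\<^sub>R g (fst q))) +
          (\<Sum>q\<in>B. norm (?D q - measure lborel (snd q) *\<^sub>R g (fst q)))"
        by (rule sum.subset_diff[OF Bp \<open>finite p\<close>])
      also have "\<dots> < e" using 1 2 by linarith
      finally show "norm ((\<Sum>(x, k)\<in>p. measure lborel k *\<^sub>R g x) - (f b - f a)) < e"
        by (simp add: split_def)
    qed
  qed
  then have "(g has_integral (f b - f a)) {a..b}" by simp
  then show ?thesis
    by (rule has_integral_spike[OF N, rotated]) (auto simp: g_def)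
qed

lemma abs_continuous_on_subinterval:
  assumes "abs_continuous_on a b f" "a \<le> c" "d \<le> b"
  shows "abs_continuous_on c d f"
  unfolding abs_continuous_on_def
proof (intro allI impI)
  fix e :: real assume "e > 0"
  then obtain \<delta> where \<delta>: "\<delta> > 0" "\<And>(n::nat) s t. (\<forall>k<n. a \<le> s k \<and> s k \<le> t k \<and> t k \<le> b) \<and>
        disjoint_family_on (\<lambda>k. {s k<..<t k}) {..<n} \<and> (\<Sum>k<n. t k - s k) < \<delta> \<Longrightarrow>
        (\<Sum>k<n. norm (f (t k) - f (s k))) < e"
    using assms(1) unfolding abs_continuous_on_def by meson
  show "\<exists>\<delta>>0. \<forall>(n::nat) s t. (\<forall>k<n. c \<le> s k \<and> s k \<le> t k \<and> t k \<le> d) \<and>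
        disjoint_family_on (\<lambda>k. {s k<..<t k}) {..<n} \<and> (\<Sum>k<n. t k - s k) < \<delta> \<longrightarrow>
        (\<Sum>k<n. norm (f (t k) - f (s k))) < e"
  proof (rule exI[of _ \<delta>], intro conjI allI impI \<delta>(1))
    fix n :: nat and s t
    assume *: "(\<forall>k<n. c \<le> s k \<and> s k \<le> t k \<and> t k \<le> d) \<and>
        disjoint_family_on (\<lambda>k. {s k<..<t k}) {..<n} \<and> (\<Sum>k<n. t k - s k) < \<delta>"
    show "(\<Sum>k<n. norm (f (t k) - f (s k))) < e"
    proof (rule \<delta>(2), intro conjI)
      show "\<forall>k<n. a \<le> s k \<and> s k \<le> t k \<and> t k \<le> b"
        using * assms(2,3) by (meson order_trans)
    qed (use * in auto)
  qed
qed

text \<open>A mean value inequality obtained by integrating the derivative. With \<open>c\<close> a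
  limit of the derivative it upgrades that limit to a one-sided derivative; with
  \<open>c = 0\<close> it bounds the displacement of a trajectory.\<close>

lemma abs_continuous_on_norm_diff_le:
  fixes f :: "real \<Rightarrow> 'a::banach"
  assumes "a \<le> b" "0 \<le> e" and ac: "abs_continuous_on a b f"
    and ae: "AE x in lebesgue. x \<in> {a<..<b} \<longrightarrow> (\<exists>D. (f has_vector_derivative D) (at x) \<and> norm (D - c) \<le> e)"
  shows "norm (f b - f a - (b - a) *\<^sub>R c) \<le> e * (b - a)"
proof -
  obtain N0 where "N0 \<in> null_sets lebesgue"
    "{x \<in> space lebesgue. \<not> (x \<in> {a<..<b} \<longrightarrow>
        (\<exists>D. (f has_vector_derivative D) (at x) \<and> norm (D - c) \<le> e))} \<subseteq> N0"
    using ae unfolding eventually_ae_filter by blast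
  then have N0: "N0 \<in> null_sets lebesgue"
    "\<And>x. x \<notin> N0 \<Longrightarrow> x \<in> {a<..<b} \<Longrightarrow> \<exists>D. (f has_vector_derivative D) (at x) \<and> norm (D - c) \<le> e"
    by auto
  define N where "N = N0 \<union> {a, b}"
  have N: "negligible N"
    using N0(1) by (simp add: N_def negligible_iff_null_sets[symmetric])
  obtain D where D: "\<And>x. x \<notin> N \<Longrightarrow> x \<in> {a..b} \<Longrightarrow> (f has_vector_derivative D x) (at x) \<and> norm (D x - c) \<le> e"
    using N0(2) unfolding N_def by (metis (no_types, lifting) UnI1 UnI2 atLeastAtMost_iff greaterThanLessThan_iff insert_iff less_eq_real_def)
  let ?g = "\<lambda>x. if x \<in> N then c else D x"
  have "(?g has_integral (f b - f a)) {a..b}"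
    by (rule abs_continuous_on_fundamental_theorem[OF \<open>a \<le> b\<close> ac N]) (use D in auto)
  moreover have "((\<lambda>x. c) has_integral (b - a) *\<^sub>R c) {a..b}"
    using has_integral_const_real[of c a b] \<open>a \<le> b\<close> by simp
  ultimately have "((\<lambda>x. ?g x - c) has_integral (f b - f a - (b - a) *\<^sub>R c)) {a..b}"
    by (rule has_integral_diff)
  then have "norm (f b - f a - (b - a) *\<^sub>R c) \<le> e * measure lborel {a..b}"
    using D by (intro has_integral_bound_real[OF \<open>0 \<le> e\<close>, of "{}"]) (auto simp: \<open>0 \<le> e\<close>)
  then show ?thesis using \<open>a \<le> b\<close> by simp
qed

lemma abs_continuous_on_lipschitz:
  fixes f :: "real \<Rightarrow> 'a::real_normed_vector"
  assumes "\<And>x y. x \<in> {a..b} \<Longrightarrow> y \<in> {a..b} \<Longrightarrow> norm (f x - f y) \<le> L * \<bar>x - y\<bar>"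
  shows "abs_continuous_on a b f"
  unfolding abs_continuous_on_def
proof (intro allI impI)
  fix e :: real assume "e > 0"
  show "\<exists>d>0. \<forall>(n::nat) s t. (\<forall>k<n. a \<le> s k \<and> s k \<le> t k \<and> t k \<le> b) \<and>
        disjoint_family_on (\<lambda>k. {s k<..<t k}) {..<n} \<and> (\<Sum>k<n. t k - s k) < d \<longrightarrow>
        (\<Sum>k<n. norm (f (t k) - f (s k))) < e"
  proof (rule exI[of _ "e / (\<bar>L\<bar> + 1)"], intro conjI allI impI)
    show "0 < e / (\<bar>L\<bar> + 1)" using \<open>e > 0\<close> by simp
    fix n :: nat and s t
    assume "(\<forall>k<n. a \<le> s k \<and> s k \<le> t k \<and> t k \<le> b) \<and>
      disjoint_family_on (\<lambda>k. {s k<..<t k}) {..<n} \<and> (\<Sum>k<n. t k - s k) < e / (\<bar>L\<bar> + 1)"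
    then have st: "\<forall>k<n. a \<le> s k \<and> s k \<le> t k \<and> t k \<le> b"
      and sum: "(\<Sum>k<n. t k - s k) < e / (\<bar>L\<bar> + 1)"
      by auto
    have "norm (f (t k) - f (s k)) \<le> (\<bar>L\<bar> + 1) * (t k - s k)" if "k < n" for k
    proof -
      have "norm (f (t k) - f (s k)) \<le> L * \<bar>t k - s k\<bar>"
        using st that by (intro assms) force+
      also have "\<dots> \<le> (\<bar>L\<bar> + 1) * (t k - s k)"
        using st that by (intro mult_mono) auto
      finally show ?thesis .
    qed
    then have "(\<Sum>k<n. norm (f (t k) - f (s k))) \<le> (\<bar>L\<bar> + 1) * (\<Sum>k<n. t k - s k)"
      unfolding sum_distrib_left by (intro sum_mono) auto
    also have "\<dots> < (\<bar>L\<bar> + 1) * (e / (\<bar>L\<bar> + 1))"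
      by (rule mult_strict_left_mono[OF sum]) auto
    also have "\<dots> = e" by simp
    finally show "(\<Sum>k<n. norm (f (t k) - f (s k))) < e" .
  qed
qed

section \<open>One-sided derivatives\<close>

text \<open>Consider the infimum of the points where \<open>P\<close> fails: by \<open>lim\<close>,
  \<open>P\<close> still holds there, and \<open>step\<close> carries it further, a
  contradiction.\<close>

lemma real_induct_right:
  fixes P :: "real \<Rightarrow> bool"
  assumes "P a" "a \<le> b"
    and step: "\<And>x. a \<le> x \<Longrightarrow> (\<And>y. a \<le> y \<Longrightarrow> y \<le> x \<Longrightarrow> P y) \<Longrightarrow> eventually P (at_right x)"
    and lim: "\<And>x. a < x \<Longrightarrow> (\<And>y. a \<le> y \<Longrightarrow> y < x \<Longrightarrow> P y) \<Longrightarrow> P x"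
  shows "P b"
proof (rule ccontr)
  assume "\<not> P b"
  define T where "T = {y. a \<le> y \<and> \<not> P y}"
  have T: "b \<in> T" "bdd_below T" using \<open>\<not> P b\<close> \<open>a \<le> b\<close> by (auto simp: T_def bdd_below_def)
  have as: "a \<le> Inf T" using T by (intro cInf_greatest) (auto simp: T_def)
  have below: "P y" if "a \<le> y" "y < Inf T" for y
    using cInf_lower[of y T] T that by (force simp: T_def)
  have "P (Inf T)"
    using lim[of "Inf T"] below as \<open>P a\<close> by (cases "a = Inf T") auto
  then have "P y" if "a \<le> y" "y \<le> Inf T" for y
    using below that by (cases "y = Inf T") auto
  from step[OF as this] obtain d where d: "d > Inf T" "\<And>y. Inf T < y \<Longrightarrow> y < d \<Longrightarrow> P y"
    by (auto simp: eventually_at_right_field)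
  have "d \<le> Inf T"
  proof (rule cInf_greatest)
    show "d \<le> y" if "y \<in> T" for y
      using that d(2)[of y] below[of y] \<open>P (Inf T)\<close> by (force simp: T_def)
  qed (use T in auto)
  then show False using d by simp
qed

lemma real_induct_left:
  fixes P :: "real \<Rightarrow> bool"
  assumes "P a" "b \<le> a"
    and step: "\<And>x. x \<le> a \<Longrightarrow> (\<And>y. x \<le> y \<Longrightarrow> y \<le> a \<Longrightarrow> P y) \<Longrightarrow> eventually P (at_left x)"
    and lim: "\<And>x. x < a \<Longrightarrow> (\<And>y. x < y \<Longrightarrow> y \<le> a \<Longrightarrow> P y) \<Longrightarrow> P x"
  shows "P b"
proof -
  have "P (- (- b))"
  proof (rule real_induct_right[of "\<lambda>x. P (- x)" "- a" "- b"])
    show "eventually (\<lambda>x. P (- x)) (at_right x)"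
      if "- a \<le> x" "\<And>y. - a \<le> y \<Longrightarrow> y \<le> x \<Longrightarrow> P (- y)" for x
      using step[of "- x"] that(2)[of "- y" for y] that(1)
      by (simp add: at_left_minus eventually_filtermap)
    show "P (- x)" if "- a < x" "\<And>y. - a \<le> y \<Longrightarrow> y < x \<Longrightarrow> P (- y)" for x
      using lim[of "- x"] that(2)[of "- y" for y] that(1) by simp
  qed (use assms in auto)
  then show ?thesis by simp
qed

text \<open>Real induction on a bound with slack \<open>e' * (x - a)\<close>: the slack turns a
  nonnegative right derivative into an inequality on a whole right neighbourhood, and it can be made
  arbitrarily small.\<close>

lemma right_derivative_nonneg_imp_le:
  fixes f :: "real \<Rightarrow> real"
  assumes "a \<le> b" and cont: "continuous_on {a..b} f"
    and der: "\<And>x. a \<le> x \<Longrightarrow> x < b \<Longrightarrow> \<exists>D\<ge>0. (f has_real_derivative D) (at_right x)"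
  shows "f a \<le> f b"
proof (rule field_le_epsilon)
  fix e :: real assume "e > 0"
  define e' where "e' = e / (b - a + 1)"
  have "e' > 0" using \<open>e > 0\<close> \<open>a \<le> b\<close> by (simp add: e'_def)
  have "b \<le> b \<longrightarrow> f a \<le> f b + e' * (b - a)"
  proof (rule real_induct_right[of "\<lambda>x. x \<le> b \<longrightarrow> f a \<le> f x + e' * (x - a)" a b])
    fix x assume x: "a \<le> x" "\<And>y. a \<le> y \<Longrightarrow> y \<le> x \<Longrightarrow> y \<le> b \<longrightarrow> f a \<le> f y + e' * (y - a)"
    show "eventually (\<lambda>y. y \<le> b \<longrightarrow> f a \<le> f y + e' * (y - a)) (at_right x)"
    proof (cases "x < b")
      case True
      from der[OF x(1) True] obtain D where "D \<ge> 0" "((\<lambda>y. (f y - f x) / (y - x)) \<longlongrightarrow> D) (at_right x)"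
        by (auto simp: has_field_derivative_iff)
      then have "eventually (\<lambda>y. - e' < (f y - f x) / (y - x)) (at_right x)"
        using \<open>e' > 0\<close> by (intro order_tendstoD(1)) auto
      moreover have "eventually (\<lambda>y. y > x) (at_right x)" by (simp add: eventually_at_right_less)
      ultimately show ?thesis
      proof eventually_elim
        case (elim y)
        then have "- e' * (y - x) < f y - f x"
          by (simp add: pos_less_divide_eq)
        then show ?case using x(2)[of x] x(1) True by (simp add: algebra_simps)
      qed
    next
      case False
      have "eventually (\<lambda>y. y > x) (at_right x)" by (simp add: eventually_at_right_less)
      then show ?thesis by eventually_elim (use False in auto)
    qed
  next
    fix x assume x: "a < x" "\<And>y. a \<le> y \<Longrightarrow> y < x \<Longrightarrow> y \<le> b \<longrightarrow> f a \<le> f y + e' * (y - a)"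
    show "x \<le> b \<longrightarrow> f a \<le> f x + e' * (x - a)"
    proof
      assume "x \<le> b"
      have "continuous_on {a..x} f" using cont \<open>x \<le> b\<close> by (auto elim: continuous_on_subset)
      from continuous_on_Icc_at_leftD[OF this x(1)] have "((\<lambda>y. f y + e' * (y - a)) \<longlongrightarrow> f x + e' * (x - a)) (at_left x)"
        by (intro tendsto_intros)
      moreover have "eventually (\<lambda>y. f a \<le> f y + e' * (y - a)) (at_left x)"
        by (rule eventually_mono[OF eventually_at_left_real[OF x(1)]]) (use x(2) \<open>x \<le> b\<close> in auto)
      ultimately show "f a \<le> f x + e' * (x - a)"
        by (rule tendsto_lowerbound) auto
    qed
  qed (use \<open>a \<le> b\<close> in auto)
  moreover have "e' * (b - a) \<le> e"
  proof -
    have "e' * (b - a) \<le> e' * (b - a + 1)" using \<open>e' > 0\<close> by simp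
    also have "\<dots> = e" using \<open>a \<le> b\<close> by (simp add: e'_def)
    finally show ?thesis .
  qed
  ultimately show "f a \<le> f b + e" by linarith
qed

lemma has_real_derivative_at_right_reflect:
  fixes f :: "real \<Rightarrow> real"
  assumes "(f has_real_derivative D) (at_left (- x))"
  shows "((\<lambda>x. f (- x)) has_real_derivative - D) (at_right x)"
proof -
  have "(f \<circ> uminus has_real_derivative D * (-1)) (at x within {x<..})"
    by (rule DERIV_image_chain) (use assms in \<open>auto intro!: derivative_eq_intros\<close>)
  then show ?thesis by (simp add: o_def)
qed

lemma left_derivative_nonneg_imp_le:
  fixes f :: "real \<Rightarrow> real"
  assumes "a \<le> b" and cont: "continuous_on {a..b} f"
    and der: "\<And>x. a < x \<Longrightarrow> x \<le> b \<Longrightarrow> \<exists>D\<ge>0. (f has_real_derivative D) (at_left x)"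
  shows "f a \<le> f b"
proof -
  have "- f (- (- b)) \<le> - f (- (- a))"
  proof (rule right_derivative_nonneg_imp_le[of "- b" "- a" "\<lambda>x. - f (- x)"])
    show "continuous_on {- b..- a} (\<lambda>x. - f (- x))"
      by (intro continuous_intros continuous_on_compose2[OF cont]) auto
    fix x assume x: "- b \<le> x" "x < - a"
    then obtain D where D: "D \<ge> 0" "(f has_real_derivative D) (at_left (- x))" using der[of "- x"] by auto
    show "\<exists>D\<ge>0. ((\<lambda>x. - f (- x)) has_real_derivative D) (at_right x)"
      using DERIV_minus[OF has_real_derivative_at_right_reflect[OF D(2)]] D(1) by auto
  qed (use assms in auto)
  then show ?thesis by simp
qed

text \<open>By the chain rule \<open>sqrt g\<close> has right derivative at least
  \<open>c / 2\<close>, so \<open>g\<close> grows quadratically and overtakes every linear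
  bound.\<close>

lemma sqrt_growth_right_False:
  fixes g :: "real \<Rightarrow> real"
  assumes c: "0 < c" and cont: "continuous_on {a..} g"
    and pos: "\<And>x. a \<le> x \<Longrightarrow> 0 < g x"
    and der: "\<And>x. a \<le> x \<Longrightarrow> \<exists>D. (g has_real_derivative D) (at_right x) \<and> c * sqrt (g x) \<le> D"
    and le: "\<And>x. g x \<le> C * (1 + \<bar>x\<bar>)"
  shows False
proof -
  have growth: "c / 2 * (x - a) \<le> sqrt (g x)" if "a \<le> x" for x
  proof -
    have "sqrt (g a) - c / 2 * a \<le> sqrt (g x) - c / 2 * x"
    proof (rule right_derivative_nonneg_imp_le[of a x "\<lambda>x. sqrt (g x) - c / 2 * x"])
      show "continuous_on {a..x} (\<lambda>x. sqrt (g x) - c / 2 * x)"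
        using continuous_on_subset[OF cont, of "{a..x}"] by (intro continuous_intros) auto
      fix y assume y: "a \<le> y"
      then obtain D where D: "(g has_real_derivative D) (at_right y)" "c * sqrt (g y) \<le> D"
        using der by blast
      have "((\<lambda>x. sqrt (g x)) has_real_derivative inverse (sqrt (g y)) / 2 * D) (at_right y)"
        by (rule DERIV_chain2[OF DERIV_real_sqrt[OF pos[OF y]] D(1)])
      then have "((\<lambda>x. sqrt (g x) - c / 2 * x) has_real_derivative inverse (sqrt (g y)) / 2 * D - c / 2) (at_right y)"
        by (rule DERIV_diff[OF _ DERIV_cmult_Id])
      moreover have "inverse (sqrt (g y)) / 2 * D - c / 2 \<ge> 0"
        using D(2) pos[OF y] by (simp add: field_simps)
      ultimately show "\<exists>D\<ge>0. ((\<lambda>x. sqrt (g x) - c / 2 * x) has_real_derivative D) (at_right y)"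
        by blast
    qed (use that in auto)
    moreover have "0 \<le> sqrt (g a)" using pos[of a] by simp
    ultimately show ?thesis unfolding right_diff_distrib by linarith
  qed
  define A where "A = \<bar>C\<bar> * (2 + \<bar>a\<bar>)"
  have "A \<ge> 0" by (simp add: A_def)
  \<comment> \<open>For \<open>t \<ge> 1\<close> the linear bound is at most \<open>A * t\<close>,
    while the lower bound is \<open>c\<^sup>2 / 4 * t * t\<close>; this choice makes
    \<open>c\<^sup>2 / 4 * t\<close> exceed \<open>A\<close> by
    \<open>c\<^sup>2 / 4\<close>.\<close>
  define t where "t = 1 + 4 / c\<^sup>2 * A"
  have t: "t \<ge> 1" using \<open>A \<ge> 0\<close> by (simp add: t_def)
  have "(c / 2 * t)\<^sup>2 \<le> (sqrt (g (a + t)))\<^sup>2"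
    using growth[of "a + t"] t c by (intro power_mono) auto
  also have "\<dots> = g (a + t)" using pos[of "a + t"] t by simp
  also have "\<dots> \<le> C * (1 + \<bar>a + t\<bar>)" by (rule le)
  also have "\<dots> \<le> \<bar>C\<bar> * (1 + \<bar>a + t\<bar>)" by (intro mult_right_mono) auto
  also have "\<dots> \<le> \<bar>C\<bar> * ((2 + \<bar>a\<bar>) * t)"
  proof (rule mult_left_mono)
    have "1 + \<bar>a + t\<bar> \<le> 1 + \<bar>a\<bar> + t" using t by linarith
    also have "\<dots> \<le> 1 * t + \<bar>a\<bar> * t + t" using t mult_left_mono[of 1 t "\<bar>a\<bar>"] by linarith
    finally show "1 + \<bar>a + t\<bar> \<le> (2 + \<bar>a\<bar>) * t" by (simp add: algebra_simps)
  qed auto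
  finally have "c\<^sup>2 / 4 * t * t \<le> A * t" by (simp add: A_def power2_eq_square algebra_simps)
  then have "c\<^sup>2 / 4 * t \<le> A" using t by simp
  moreover have "c\<^sup>2 / 4 * t = c\<^sup>2 / 4 + A" using c by (simp add: t_def algebra_simps)
  ultimately show False using c by simp
qed

lemma sqrt_growth_left_False:
  fixes g :: "real \<Rightarrow> real"
  assumes c: "0 < c" and cont: "continuous_on {..a} g"
    and pos: "\<And>x. x \<le> a \<Longrightarrow> 0 < g x"
    and der: "\<And>x. x \<le> a \<Longrightarrow> \<exists>D. (g has_real_derivative D) (at_left x) \<and> D \<le> - c * sqrt (g x)"
    and le: "\<And>x. g x \<le> C * (1 + \<bar>x\<bar>)"
  shows False
proof (rule sqrt_growth_right_False[of c "- a" "\<lambda>x. g (- x)" C])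
  show "continuous_on {- a..} (\<lambda>x. g (- x))"
    by (intro continuous_on_compose2[OF cont] continuous_intros) auto
  show "0 < g (- x)" if "- a \<le> x" for x using pos that by simp
  fix x assume "- a \<le> x"
  then obtain D where "(g has_real_derivative D) (at_left (- x))" "D \<le> - c * sqrt (g (- x))"
    using der[of "- x"] by auto
  then show "\<exists>D. ((\<lambda>x. g (- x)) has_real_derivative D) (at_right x) \<and> c * sqrt (g (- x)) \<le> D"
    using has_real_derivative_at_right_reflect by fastforce
qed (use c le[of "- x" for x] in auto)

lemma has_real_derivative_right_pos_imp_eventually_greater:
  fixes f :: "real \<Rightarrow> real"
  assumes "(f has_real_derivative D) (at_right x)" "0 < D"
  shows "eventually (\<lambda>y. f x < f y) (at_right x)"
proof -
  have "eventually (\<lambda>y. 0 < (f y - f x) / (y - x)) (at_right x)"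
    using assms by (intro order_tendstoD(1)) (auto simp: has_field_derivative_iff)
  moreover have "eventually (\<lambda>y. y > x) (at_right x)" by (simp add: eventually_at_right_less)
  ultimately show ?thesis
    by eventually_elim (simp add: zero_less_divide_iff)
qed

lemma has_real_derivative_left_pos_imp_eventually_less:
  fixes f :: "real \<Rightarrow> real"
  assumes "(f has_real_derivative D) (at_left x)" "0 < D"
  shows "eventually (\<lambda>y. f y < f x) (at_left x)"
proof -
  have "eventually (\<lambda>y. 0 < (f y - f x) / (y - x)) (at_left x)"
    using assms by (intro order_tendstoD(1)) (auto simp: has_field_derivative_iff)
  moreover have "eventually (\<lambda>y. y < x) (at_left x)"
    by (simp add: eventually_at_filter)
  ultimately show ?thesis
    by eventually_elim (simp add: zero_less_divide_iff)
qed

section \<open>The Hamiltonian map\<close>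

text \<open>With \<open>p = u\<^sub>1'\<close>, \<open>q = u\<^sub>2'\<close> the system reads \<open>hamiltonian p q = h\<^sub>1 - u\<^sub>1\<close> and
  \<open>hamiltonian q p = h\<^sub>2 - u\<^sub>2\<close>.\<close>

definition hamiltonian :: "real \<Rightarrow> real \<Rightarrow> real" where
  "hamiltonian p q = p * q + p\<^sup>2 / 2"

lemma hamiltonian_sum: "hamiltonian p q + hamiltonian q p = 2 * (p * q) + (p\<^sup>2 + q\<^sup>2) / 2"
  by (simp add: hamiltonian_def field_simps)

lemma hamiltonian_diff: "hamiltonian p q - hamiltonian q p = (p - q) * (p + q) / 2"
  by (simp add: hamiltonian_def field_simps power2_eq_square)

text \<open>The two sides differ by \<open>(p + q)\<^sup>2 + 2 * p\<^sup>2\<close>. The inequality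
  serves to turn a very negative Hamiltonian into widely separated slopes.\<close>

lemma hamiltonian_ge: "- 4 * hamiltonian p q \<le> (p - q)\<^sup>2"
proof -
  have "(p - q)\<^sup>2 + 4 * hamiltonian p q = (p + q)\<^sup>2 + 2 * p\<^sup>2"
    by (simp add: hamiltonian_def power2_eq_square algebra_simps)
  moreover have "0 \<le> (p + q)\<^sup>2 + 2 * p\<^sup>2" by simp
  ultimately show ?thesis by linarith
qed

text \<open>If \<open>p * q < 0\<close>, nonnegative Hamiltonians would make
  \<open>p\<^sup>2\<close> and \<open>q\<^sup>2\<close> at least
  \<open>2 * \<bar>p * q\<bar>\<close>; multiplying the two yields
  \<open>(p * q)\<^sup>2 \<ge> 4 * (p * q)\<^sup>2\<close>.\<close>

lemma hamiltonian_nonneg_iff: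
  "0 \<le> hamiltonian p q \<and> 0 \<le> hamiltonian q p \<longleftrightarrow> 0 \<le> p * q"
proof
  assume "0 \<le> p * q"
  then show "0 \<le> hamiltonian p q \<and> 0 \<le> hamiltonian q p"
    by (simp add: hamiltonian_def mult.commute)
next
  assume *: "0 \<le> hamiltonian p q \<and> 0 \<le> hamiltonian q p"
  show "0 \<le> p * q"
  proof (rule ccontr)
    assume "\<not> 0 \<le> p * q"
    then have neg: "p * q < 0" by simp
    have "- 2 * (p * q) \<le> p\<^sup>2" "- 2 * (p * q) \<le> q\<^sup>2"
      using * by (auto simp: hamiltonian_def field_simps)
    then have "(- 2 * (p * q)) * (- 2 * (p * q)) \<le> p\<^sup>2 * q\<^sup>2"
      using neg by (intro mult_mono) auto
    then have "3 * (p * q)\<^sup>2 \<le> 0" by (simp add: power2_eq_square algebra_simps)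
    then have "(p * q)\<^sup>2 \<le> 0" by simp
    then have "p * q = 0" by (simp only: power2_less_eq_zero_iff)
    then show False using neg by linarith
  qed
qed

lemma hamiltonian_eq_0_imp:
  assumes "hamiltonian p q = 0" "0 \<le> hamiltonian q p"
  shows "p = 0"
proof -
  have "0 \<le> p * q" using assms hamiltonian_nonneg_iff[of p q] by simp
  moreover have "p * q + p\<^sup>2 / 2 = 0" using assms by (simp add: hamiltonian_def)
  moreover have "0 \<le> p\<^sup>2" by simp
  ultimately have "p\<^sup>2 = 0" by linarith
  then show ?thesis by simp
qed

text \<open>Writing \<open>z = sqrt 3 * (p + q) + \<i> * (p - q)\<close>, the two Hamiltonians are linear functions of the real
  and imaginary parts of \<open>z\<^sup>2\<close>, so they determine \<open>z\<close> up to sign.\<close>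

lemma hamiltonian_eq_imp:
  assumes "hamiltonian p q = hamiltonian s t" "hamiltonian q p = hamiltonian t s"
  shows "p = s \<and> q = t \<or> p = - s \<and> q = - t"
proof -
  define S d T e where "S = p + q" and "d = p - q" and "T = s + t" and "e = s - t"
  have dS: "d * S = e * T"
    using hamiltonian_diff[of p q] hamiltonian_diff[of s t] assms
    by (simp add: S_def d_def T_def e_def)
  have *: "3 * S\<^sup>2 - d\<^sup>2 = 3 * T\<^sup>2 - e\<^sup>2"
  proof -
    have "3 * (x + y)\<^sup>2 - (x - y)\<^sup>2 = 4 * (hamiltonian x y + hamiltonian y x)" for x y
      by (simp add: hamiltonian_def power2_eq_square algebra_simps)
    from this[of p q] this[of s t] show ?thesis
      using assms by (simp add: S_def d_def T_def e_def)
  qed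
  \<comment> \<open>The squared modulus of \<open>z\<^sup>2\<close>, computed from its real part
    \<open>3 * S\<^sup>2 - d\<^sup>2\<close> and its imaginary part
    \<open>2 * sqrt 3 * d * S\<close>.\<close>
  have "(3 * S\<^sup>2 + d\<^sup>2)\<^sup>2 = (3 * S\<^sup>2 - d\<^sup>2)\<^sup>2 + 12 * (d * S)\<^sup>2"
    by (simp add: power2_eq_square algebra_simps)
  also have "\<dots> = (3 * T\<^sup>2 + e\<^sup>2)\<^sup>2"
    unfolding dS * by (simp add: power2_eq_square algebra_simps)
  finally have "3 * S\<^sup>2 + d\<^sup>2 = 3 * T\<^sup>2 + e\<^sup>2"
    by (rule power2_eq_imp_eq) auto
  with * have "S\<^sup>2 = T\<^sup>2" "d\<^sup>2 = e\<^sup>2" by linarith+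
  then have "S = T \<or> S = - T" "d = e \<or> d = - e" by (simp_all add: power2_eq_iff)
  \<comment> \<open>\<open>dS\<close> ties the two signs together: a mixed choice forces
    \<open>S\<close> or \<open>d\<close> to vanish.\<close>
  then have "S = T \<and> d = e \<or> S = - T \<and> d = - e"
    using dS by auto
  then show ?thesis by (auto simp: S_def d_def T_def e_def)
qed

section \<open>Sign of the derivatives of an admissible solution\<close>

text \<open>Since \<open>l = r\<close> or \<open>l = - r\<close>, condition (A3) becomes the assumption \<open>jump\<close>.\<close>

locale one_sided_solution =
  fixes h1 h2 u1 u2 r1 r2 l1 l2 :: "real \<Rightarrow> real" and a c1 c2 C :: real
  assumes h_cont: "continuous_on UNIV h1" "continuous_on UNIV h2"
    and h1_right: "\<And>y. \<exists>k>0. (h1 has_real_derivative k) (at_right y)"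
    and h2_right: "\<And>y. \<exists>k>0. (h2 has_real_derivative k) (at_right y)"
    and h_left: "\<And>y. y < a \<Longrightarrow> (h1 has_real_derivative c1) (at y)"
      "\<And>y. y < a \<Longrightarrow> (h2 has_real_derivative c2) (at y)"
    and c: "0 < c1" "0 < c2" "c1 \<noteq> c2"
    and u_cont: "continuous_on UNIV u1" "continuous_on UNIV u2"
    and u_right: "\<And>y. (u1 has_real_derivative r1 y) (at_right y)"
      "\<And>y. (u2 has_real_derivative r2 y) (at_right y)"
    and u_left: "\<And>y. (u1 has_real_derivative l1 y) (at_left y)"
      "\<And>y. (u2 has_real_derivative l2 y) (at_left y)"
    and ham_r: "\<And>y. hamiltonian (r1 y) (r2 y) = h1 y - u1 y"
      "\<And>y. hamiltonian (r2 y) (r1 y) = h2 y - u2 y"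
    and ham_l: "\<And>y. hamiltonian (l1 y) (l2 y) = h1 y - u1 y"
      "\<And>y. hamiltonian (l2 y) (l1 y) = h2 y - u2 y"
    and jump: "\<And>y. l1 y = r1 y \<and> l2 y = r2 y \<or>
                 l1 y = - r1 y \<and> l2 y = - r2 y \<and> 0 \<le> l1 y + l2 y"
    and r_right: "\<And>y. (r1 \<longlongrightarrow> r1 y) (at_right y)" "\<And>y. (r2 \<longlongrightarrow> r2 y) (at_right y)"
    and r_left: "\<And>y. (r1 \<longlongrightarrow> l1 y) (at_left y)" "\<And>y. (r2 \<longlongrightarrow> l2 y) (at_left y)"
    and l_right: "\<And>y. (l1 \<longlongrightarrow> r1 y) (at_right y)" "\<And>y. (l2 \<longlongrightarrow> r2 y) (at_right y)"
    and l_left: "\<And>y. (l1 \<longlongrightarrow> l1 y) (at_left y)" "\<And>y. (l2 \<longlongrightarrow> l2 y) (at_left y)"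
    and growth: "\<And>y. \<bar>h1 y - u1 y\<bar> \<le> C * (1 + \<bar>y\<bar>)" "\<And>y. \<bar>h2 y - u2 y\<bar> \<le> C * (1 + \<bar>y\<bar>)"
begin

abbreviation "f1 y \<equiv> h1 y - u1 y"
abbreviation "f2 y \<equiv> h2 y - u2 y"

text \<open>Exchanging the players exchanges the components, so arguments can be given for one
  component, and under the assumption \<open>c2 < c1\<close>.\<close>

lemma swap: "one_sided_solution h2 h1 u2 u1 r2 r1 l2 l1 a c2 c1 C"
proof -
  have "l2 y = r2 y \<and> l1 y = r1 y \<or> l2 y = - r2 y \<and> l1 y = - r1 y \<and> 0 \<le> l2 y + l1 y" for y
    using jump[of y] by linarith
  from one_sided_solution.intro[OF h_cont(2,1) h2_right h1_right h_left(2,1) c(2,1) c(3)[symmetric]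
    u_cont(2,1) u_right(2,1) u_left(2,1) ham_r(2,1) ham_l(2,1) this r_right(2,1) r_left(2,1)
    l_right(2,1) l_left(2,1) growth(2,1)]
  show ?thesis .
qed

lemma f_cont: "continuous_on A f1" "continuous_on A f2"
  using continuous_on_subset[OF continuous_on_diff[OF h_cont(1) u_cont(1)] subset_UNIV]
    continuous_on_subset[OF continuous_on_diff[OF h_cont(2) u_cont(2)] subset_UNIV]
  by simp_all

lemma f_isCont: "isCont f1 y" "isCont f2 y"
  using f_cont[of UNIV] by (auto simp: continuous_on_eq_continuous_at)

lemma f1_left: "y < a \<Longrightarrow> (f1 has_real_derivative c1 - l1 y) (at_left y)"
  by (intro DERIV_diff u_left DERIV_subset[OF h_left(1)]) auto

lemma f2_left: "y < a \<Longrightarrow> (f2 has_real_derivative c2 - l2 y) (at_left y)"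
  by (intro DERIV_diff u_left DERIV_subset[OF h_left(2)]) auto

section \<open>Invariance to the right of the set where both components of h - u are
  nonnegative\<close>

lemma f1_nonneg_eventually:
  assumes "0 \<le> f1 x" "0 \<le> f2 x"
  shows "eventually (\<lambda>y. 0 \<le> f1 y) (at_right x)"
proof (cases "f1 x = 0")
  case True
  then have "r1 x = 0"
    using hamiltonian_eq_0_imp[of "r1 x" "r2 x"] assms by (simp add: ham_r)
  moreover obtain k where "k > 0" "(h1 has_real_derivative k) (at_right x)"
    using h1_right by blast
  ultimately have "(f1 has_real_derivative k) (at_right x)"
    using DERIV_diff[OF _ u_right(1), of h1 k x] by simp
  from has_real_derivative_right_pos_imp_eventually_greater[OF this \<open>k > 0\<close>]
  show ?thesis using True by (auto elim!: eventually_mono)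
next
  case False
  then have "eventually (\<lambda>y. 0 < f1 y) (at_right x)"
    using assms f_isCont(1)[of x]
    by (intro order_tendstoD(1)[of _ "f1 x"]) (auto simp: isCont_def intro: tendsto_within_subset)
  then show ?thesis by (auto elim!: eventually_mono)
qed

lemma f_nonneg_forward:
  assumes "0 \<le> f1 x" "0 \<le> f2 x" "x \<le> y"
  shows "0 \<le> f1 y \<and> 0 \<le> f2 y"
proof (rule real_induct_right[of "\<lambda>y. 0 \<le> f1 y \<and> 0 \<le> f2 y" x y])
  interpret s: one_sided_solution h2 h1 u2 u1 r2 r1 l2 l1 a c2 c1 C by (rule swap)
  show "eventually (\<lambda>y. 0 \<le> f1 y \<and> 0 \<le> f2 y) (at_right z)"
    if "x \<le> z" "\<And>y. x \<le> y \<Longrightarrow> y \<le> z \<Longrightarrow> 0 \<le> f1 y \<and> 0 \<le> f2 y" for z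
    using f1_nonneg_eventually[of z] s.f1_nonneg_eventually[of z] that(2)[of z] that(1)
    by (auto intro: eventually_conj)
next
  fix z assume z: "x < z" "\<And>y. x \<le> y \<Longrightarrow> y < z \<Longrightarrow> 0 \<le> f1 y \<and> 0 \<le> f2 y"
  have ev: "eventually (\<lambda>y. 0 \<le> f1 y) (at_left z)" "eventually (\<lambda>y. 0 \<le> f2 y) (at_left z)"
    by (rule eventually_mono[OF eventually_at_left_real[OF z(1)]], use z(2) in auto)+
  have "(f1 \<longlongrightarrow> f1 z) (at_left z)" "(f2 \<longlongrightarrow> f2 z) (at_left z)"
    using f_isCont[of z] by (auto simp: isCont_def intro: tendsto_within_subset)
  then show "0 \<le> f1 z \<and> 0 \<le> f2 z"
    using tendsto_lowerbound[OF _ ev(1)] tendsto_lowerbound[OF _ ev(2)] trivial_limit_at_left_real by blast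
qed (use assms in auto)

section \<open>Escape to the left outside the invariant set\<close>

lemma opposite_signs:
  assumes "\<not> (0 \<le> f1 x \<and> 0 \<le> f2 x)"
  shows "r1 x * r2 x < 0" "l1 x * l2 x < 0"
  using assms hamiltonian_nonneg_iff[of "r1 x" "r2 x"] hamiltonian_nonneg_iff[of "l1 x" "l2 x"]
  by (auto simp: ham_r ham_l)

lemma f_diff_left:
  assumes "y < a"
  shows "((\<lambda>y. f1 y - f2 y) has_real_derivative (c1 - c2) - (l1 y - l2 y)) (at_left y)"
  using DERIV_diff[OF f1_left[OF assms] f2_left[OF assms]] by (simp add: algebra_simps)

text \<open>The quadrant of \<open>l\<close> fixes the sign of \<open>l1 - l2\<close>. The sign of
  the continuous function \<open>f1 - f2\<close> then tells that of \<open>l1 + l2\<close>, and with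
  it whether a jump is admissible.\<close>

lemma f_diff_eq: "f1 y - f2 y = (l1 y - l2 y) * (l1 y + l2 y) / 2"
  using hamiltonian_diff[of "l1 y" "l2 y"] by (simp add: ham_l)

lemma eventually_l_quadrant4:
  assumes "0 < l1 x" "l2 x < 0"
  shows "eventually (\<lambda>y. 0 < l1 y \<and> l2 y < 0) (at_left x)"
  using order_tendstoD(1)[OF l_left(1) assms(1)] order_tendstoD(2)[OF l_left(2) assms(2)]
  by (rule eventually_conj)

lemma eventually_l_quadrant2:
  assumes "l1 x < 0" "0 < l2 x"
  shows "eventually (\<lambda>y. l1 y < 0 \<and> 0 < l2 y) (at_left x)"
  using order_tendstoD(2)[OF l_left(1) assms(1)] order_tendstoD(1)[OF l_left(2) assms(2)]
  by (rule eventually_conj)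

text \<open>One-sided limits keep only weak signs; the negative product makes them strict.\<close>

lemma r_quadrant4_of_l:
  assumes "x < y" "\<And>z. x < z \<Longrightarrow> z \<le> y \<Longrightarrow> 0 < l1 z \<and> l2 z < 0" "r1 x * r2 x < 0"
  shows "0 < r1 x \<and> r2 x < 0"
proof -
  have "eventually (\<lambda>z. 0 \<le> l1 z) (at_right x)" "eventually (\<lambda>z. l2 z \<le> 0) (at_right x)"
    by (rule eventually_mono[OF eventually_at_right_real[OF assms(1)]], use assms(2) in force)+
  then have "0 \<le> r1 x" "r2 x \<le> 0"
    using tendsto_lowerbound[OF l_right(1)] tendsto_upperbound[OF l_right(2)] by auto
  then show ?thesis using assms(3) by (cases "r1 x = 0"; cases "r2 x = 0") auto
qed

lemma r_quadrant2_of_l: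
  assumes "x < y" "\<And>z. x < z \<Longrightarrow> z \<le> y \<Longrightarrow> l1 z < 0 \<and> 0 < l2 z" "r1 x * r2 x < 0"
  shows "r1 x < 0 \<and> 0 < r2 x"
proof -
  interpret s: one_sided_solution h2 h1 u2 u1 r2 r1 l2 l1 a c2 c1 C by (rule swap)
  show ?thesis using s.r_quadrant4_of_l[OF assms(1)] assms(2,3) by (simp add: mult.commute)
qed

text \<open>Going to the left, a solution with \<open>l\<close> in the second quadrant and \<open>f1 < f2\<close> can neither jump
  nor leave that quadrant, and \<open>f2 - f1\<close> grows quadratically.\<close>

lemma quadrant2_escape:
  assumes "b < a" and neg: "\<And>x. x \<le> b \<Longrightarrow> \<not> (0 \<le> f1 x \<and> 0 \<le> f2 x)" and "c2 < c1"
    and y: "y \<le> b" "l1 y < 0" "0 < l2 y" "f1 y - f2 y \<le> 0"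
  shows False
proof -
  let ?G = "\<lambda>x. f1 x - f2 x"
  \<comment> \<open>The strict sign of \<open>?G\<close> is claimed only to the left of
    \<open>y\<close>, since equality is allowed at \<open>y\<close> itself; hence the intermediate
    point \<open>z\<close> and the shift \<open>y - 1\<close> below.\<close>
  let ?P = "\<lambda>x. l1 x < 0 \<and> 0 < l2 x \<and> (x < y \<longrightarrow> ?G x < 0)"
  have P: "?P x" if "x \<le> y" for x
  proof (rule real_induct_left[of ?P y x])
    fix x assume x: "x \<le> y" and IH: "\<And>z. x \<le> z \<Longrightarrow> z \<le> y \<Longrightarrow> ?P z"
    have l: "l1 x < 0" "0 < l2 x" and G: "?G x \<le> 0"
      using IH[of x] x y by (cases "x = y"; force)+
    have "eventually (\<lambda>z. ?G z < ?G x) (at_left x)"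
      by (rule has_real_derivative_left_pos_imp_eventually_less[OF f_diff_left])
        (use x y l \<open>b < a\<close> \<open>c2 < c1\<close> in auto)
    then have "eventually (\<lambda>z. ?G z < 0) (at_left x)"
      by (rule eventually_mono) (use G in auto)
    with eventually_l_quadrant2[OF l] show "eventually ?P (at_left x)"
      by eventually_elim auto
  next
    fix x assume x: "x < y" and IH: "\<And>z. x < z \<Longrightarrow> z \<le> y \<Longrightarrow> ?P z"
    obtain z where z: "x < z" "z < y" using dense x by blast
    have "?G x \<le> ?G z"
    proof (rule left_derivative_nonneg_imp_le[of x z ?G])
      show "continuous_on {x..z} ?G" by (intro continuous_on_diff f_cont)
      fix t assume t: "x < t" "t \<le> z"
      show "\<exists>D\<ge>0. (?G has_real_derivative D) (at_left t)"
        using IH[of t] t z y \<open>b < a\<close> \<open>c2 < c1\<close> f_diff_left[of t] by (intro exI conjI) auto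
    qed (use z in simp)
    then have G: "?G x < 0" using IH[of z] z by auto
    have r: "r1 x < 0 \<and> 0 < r2 x"
      by (rule r_quadrant2_of_l[OF x]) (use IH opposite_signs(1)[OF neg, of x] x y in auto)
    \<comment> \<open>A jump would put \<open>l\<close> into the fourth quadrant with
      \<open>l1 x + l2 x \<ge> 0\<close>; by \<open>f_diff_eq\<close> this makes \<open>?G x\<close>
      nonnegative.\<close>
    have "l1 x = r1 x \<and> l2 x = r2 x"
    proof (rule ccontr)
      assume "\<not> ?thesis"
      then have l: "l1 x = - r1 x" "l2 x = - r2 x" "0 \<le> l1 x + l2 x" using jump[of x] by auto
      then have "0 \<le> (l1 x - l2 x) * (l1 x + l2 x)" using r by (intro mult_nonneg_nonneg) auto
      then show False using G f_diff_eq[of x] by simp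
    qed
    then show "?P x" using r G by simp
  qed (use that y in auto)
  show False
  proof (rule sqrt_growth_left_False[of 1 "y - 1" "\<lambda>x. - (f1 x - f2 x)" "2 * C"])
    show "continuous_on {..y - 1} (\<lambda>x. - ?G x)" by (intro continuous_on_minus continuous_on_diff f_cont)
    show "0 < - ?G x" if "x \<le> y - 1" for x using P[of x] that by auto
    show "- ?G x \<le> 2 * C * (1 + \<bar>x\<bar>)" for x using growth[of x] by (auto simp: algebra_simps)
    fix x assume x: "x \<le> y - 1"
    have l: "l1 x < 0" "0 < l2 x" using P[of x] x by auto
    \<comment> \<open>With opposite signs, \<open>l1 x + l2 x\<close> is at most
      \<open>l2 x - l1 x\<close>, so \<open>- ?G x\<close> is bounded by the square of the very gap
      that drives its growth.\<close>
    have "- ?G x = (l2 x - l1 x) * (l1 x + l2 x) / 2"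
      using f_diff_eq[of x] by (simp add: algebra_simps)
    also have "\<dots> \<le> (l2 x - l1 x) * (l2 x - l1 x) / 2"
      using l by (intro divide_right_mono mult_left_mono) auto
    also have "\<dots> \<le> (l2 x - l1 x)\<^sup>2" by (simp add: power2_eq_square)
    finally have "sqrt (- ?G x) \<le> l2 x - l1 x" using l by (intro real_le_lsqrt) auto
    moreover have "((\<lambda>x. - ?G x) has_real_derivative - ((c1 - c2) - (l1 x - l2 x))) (at_left x)"
      by (intro DERIV_minus f_diff_left) (use x y \<open>b < a\<close> in auto)
    ultimately show "\<exists>D. ((\<lambda>x. - ?G x) has_real_derivative D) (at_left x) \<and> D \<le> - 1 * sqrt (- ?G x)"
      using \<open>c2 < c1\<close> by (intro exI conjI) auto
  qed simp
qed

text \<open>Here \<open>c1 - c2\<close> and the gap \<open>l1 - l2\<close> act against each other in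
  the derivative of \<open>f1 - f2\<close>. But \<open>f2\<close> falls to the left at a rate of at
  least \<open>c2\<close>, and by \<open>hamiltonian_ge\<close> a very negative \<open>f2\<close>
  forces a large gap. From there on \<open>f1 - f2\<close> grows to the left, at least linearly and,
  once positive, quadratically.\<close>

lemma quadrant4_escape:
  assumes "b < a" and "c2 < c1" and y: "y \<le> b"
    and l4: "\<And>x. x \<le> y \<Longrightarrow> 0 < l1 x \<and> l2 x < 0"
  shows False
proof -
  let ?G = "\<lambda>x. f1 x - f2 x"
  define \<delta> where "\<delta> = c1 - c2"
  have \<delta>: "\<delta> > 0" using assms by (simp add: \<delta>_def)
  have f2_le: "f2 x \<le> f2 y - c2 * (y - x)" if "x \<le> y" for x
  proof -
    have "f2 x - c2 * x \<le> f2 y - c2 * y"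
    proof (rule left_derivative_nonneg_imp_le[OF that, where f = "\<lambda>x. f2 x - c2 * x"])
      show "continuous_on {x..y} (\<lambda>x. f2 x - c2 * x)" by (intro continuous_intros f_cont)
      fix t assume t: "x < t" "t \<le> y"
      have "((\<lambda>x. f2 x - c2 * x) has_real_derivative (c2 - l2 t) - c2) (at_left t)"
        by (intro DERIV_diff f2_left DERIV_cmult_Id) (use t y \<open>b < a\<close> in auto)
      then show "\<exists>D\<ge>0. ((\<lambda>x. f2 x - c2 * x) has_real_derivative D) (at_left t)"
        using l4[of t] t by (intro exI conjI) auto
    qed
    then show ?thesis by (simp add: algebra_simps)
  qed
  \<comment> \<open>To the left of \<open>Y\<close> one has
    \<open>f2 x \<le> - \<delta>\<^sup>2\<close>, which \<open>hamiltonian_ge\<close> converts into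
    a gap of at least \<open>2 * \<delta>\<close>.\<close>
  define Y where "Y = y - (\<bar>f2 y\<bar> + \<delta>\<^sup>2) / c2"
  have "Y \<le> y" using c by (simp add: Y_def)
  have d: "2 * \<delta> \<le> l1 x - l2 x" if "x \<le> Y" for x
  proof (rule power2_le_imp_le)
    have "c2 * (y - x) \<ge> c2 * (y - Y)" using that c by (intro mult_left_mono) auto
    also have "c2 * (y - Y) = \<bar>f2 y\<bar> + \<delta>\<^sup>2" using c by (simp add: Y_def)
    finally have "f2 x \<le> - \<delta>\<^sup>2" using f2_le[of x] that \<open>Y \<le> y\<close> by linarith
    moreover have "- 4 * f2 x \<le> (l1 x - l2 x)\<^sup>2"
      using hamiltonian_ge[of "l2 x" "l1 x"] by (simp add: ham_l power2_commute)
    moreover have "4 * \<delta>\<^sup>2 \<le> - 4 * f2 x" if "f2 x \<le> - \<delta>\<^sup>2" using that by simp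
    ultimately have "4 * \<delta>\<^sup>2 \<le> (l1 x - l2 x)\<^sup>2" using order_trans by blast
    then show "(2 * \<delta>)\<^sup>2 \<le> (l1 x - l2 x)\<^sup>2" by (simp add: power_mult_distrib)
    show "0 \<le> l1 x - l2 x" using l4[of x] that \<open>Y \<le> y\<close> by auto
  qed
  have G_ge: "?G Y + \<delta> * (Y - x) \<le> ?G x" if "x \<le> Y" for x
  proof -
    have "- ?G x - \<delta> * x \<le> - ?G Y - \<delta> * Y"
    proof (rule left_derivative_nonneg_imp_le[OF that, where f = "\<lambda>x. - ?G x - \<delta> * x"])
      show "continuous_on {x..Y} (\<lambda>x. - ?G x - \<delta> * x)" by (intro continuous_intros f_cont)
      fix t assume t: "x < t" "t \<le> Y"
      have "((\<lambda>x. - ?G x - \<delta> * x) has_real_derivative - ((c1 - c2) - (l1 t - l2 t)) - \<delta>) (at_left t)"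
        by (intro DERIV_diff DERIV_minus f_diff_left DERIV_cmult_Id) (use t y \<open>b < a\<close> \<open>Y \<le> y\<close> in auto)
      then show "\<exists>D\<ge>0. ((\<lambda>x. - ?G x - \<delta> * x) has_real_derivative D) (at_left t)"
        using d[of t] t by (intro exI conjI) (auto simp: \<delta>_def)
    qed
    then show ?thesis by (simp add: algebra_simps)
  qed
  \<comment> \<open>From \<open>Z\<close> leftwards the linear lower bound on \<open>?G\<close> is
    at least 1.\<close>
  define Z where "Z = Y - (\<bar>?G Y\<bar> + 1) / \<delta>"
  have "Z \<le> Y" using \<delta> by (simp add: Z_def)
  have G_pos: "0 < ?G x" if "x \<le> Z" for x
  proof -
    have "\<delta> * (Y - x) \<ge> \<delta> * (Y - Z)" using that \<delta> by (intro mult_left_mono) auto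
    also have "\<delta> * (Y - Z) = \<bar>?G Y\<bar> + 1" using \<delta> by (simp add: Z_def)
    finally show ?thesis using G_ge[of x] that \<open>Z \<le> Y\<close> by linarith
  qed
  show False
  \<comment> \<open>As \<open>\<delta>\<close> is at most half the gap, the drift
    \<open>\<delta> - (l1 x - l2 x)\<close> is at most minus half the gap; this is the origin of
    \<open>1 / 2\<close>.\<close>
  proof (rule sqrt_growth_left_False[of "1 / 2" Z ?G "2 * C"])
    show "continuous_on {..Z} ?G" by (intro continuous_on_diff f_cont)
    show "?G x \<le> 2 * C * (1 + \<bar>x\<bar>)" for x using growth[of x] by (auto simp: algebra_simps)
    fix x assume x: "x \<le> Z"
    show "0 < ?G x" using G_pos x .
    have xY: "x \<le> Y" "x < a" using x \<open>Z \<le> Y\<close> \<open>Y \<le> y\<close> y \<open>b < a\<close> by auto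
    have l: "0 < l1 x" "l2 x < 0" using l4[of x] xY \<open>Y \<le> y\<close> by auto
    have "?G x = (l1 x - l2 x) * (l1 x + l2 x) / 2"
      using f_diff_eq[of x] .
    also have "\<dots> \<le> (l1 x - l2 x) * (l1 x - l2 x) / 2"
      using l by (intro divide_right_mono mult_left_mono) auto
    also have "\<dots> \<le> (l1 x - l2 x)\<^sup>2" by (simp add: power2_eq_square)
    finally have "sqrt (?G x) \<le> l1 x - l2 x" using l by (intro real_le_lsqrt) auto
    then show "\<exists>D. (?G has_real_derivative D) (at_left x) \<and> D \<le> - (1/2) * sqrt (?G x)"
      using d[OF xY(1)] f_diff_left[OF xY(2)] by (intro exI conjI) (auto simp: \<delta>_def)
  qed simp
qed

text \<open>By \<open>quadrant2_escape\<close>, \<open>f1 - f2\<close> is positive wherever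
  \<open>l\<close> lies in the second quadrant. If \<open>l\<close> is in the fourth quadrant
  somewhere, it stays there to the left, since a jump would lead to the second quadrant with
  \<open>f1 - f2 \<le> 0\<close>; then \<open>quadrant4_escape\<close> applies. If \<open>l\<close>
  is in the second quadrant throughout, \<open>f1 - f2\<close> decreases to the left and ends up
  nonpositive.\<close>

lemma f_nonneg_aux:
  assumes "c2 < c1"
  shows "0 \<le> f1 x \<and> 0 \<le> f2 x"
proof (rule ccontr)
  assume x: "\<not> ?thesis"
  let ?G = "\<lambda>x. f1 x - f2 x"
  define b where "b = min x (a - 1)"
  have b: "b < a" by (simp add: b_def)
  have neg: "\<not> (0 \<le> f1 z \<and> 0 \<le> f2 z)" if "z \<le> b" for z
    using f_nonneg_forward[of z x] x that by (auto simp: b_def)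
  have opp: "0 < l1 z \<and> l2 z < 0 \<or> l1 z < 0 \<and> 0 < l2 z" if "z \<le> b" for z
    using opposite_signs(2)[OF neg[OF that]] by (auto simp: mult_less_0_iff)
  have G: "0 < ?G z" if "z \<le> b" "l1 z < 0" "0 < l2 z" for z
    using quadrant2_escape[OF b neg assms that] by force
  show False
  proof (cases "\<exists>y\<le>b. 0 < l1 y \<and> l2 y < 0")
    case True
    then obtain y where y: "y \<le> b" "0 < l1 y" "l2 y < 0" by blast
    have "0 < l1 x \<and> l2 x < 0" if "x \<le> y" for x
    proof (rule real_induct_left[of "\<lambda>x. 0 < l1 x \<and> l2 x < 0" y x])
      fix x assume "x \<le> y" "\<And>z. x \<le> z \<Longrightarrow> z \<le> y \<Longrightarrow> 0 < l1 z \<and> l2 z < 0"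
      then show "eventually (\<lambda>x. 0 < l1 x \<and> l2 x < 0) (at_left x)"
        using eventually_l_quadrant4[of x] by simp
    next
      fix x assume x: "x < y" and IH: "\<And>z. x < z \<Longrightarrow> z \<le> y \<Longrightarrow> 0 < l1 z \<and> l2 z < 0"
      have r: "0 < r1 x \<and> r2 x < 0"
        by (rule r_quadrant4_of_l[OF x IH opposite_signs(1)[OF neg]]) (use x y in auto)
      have "l1 x = r1 x \<and> l2 x = r2 x"
      proof (rule ccontr)
        assume "\<not> ?thesis"
        then have l: "l1 x = - r1 x" "l2 x = - r2 x" "0 \<le> l1 x + l2 x" using jump[of x] by auto
        then have "(l1 x - l2 x) * (l1 x + l2 x) \<le> 0" using r by (intro mult_nonpos_nonneg) auto
        moreover have "0 < ?G x" using G[of x] x y l r by auto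
        ultimately show False using f_diff_eq[of x] by simp
      qed
      then show "0 < l1 x \<and> l2 x < 0" using r by simp
    qed (use that y in auto)
    from quadrant4_escape[OF b assms y(1) this] show False .
  next
    case False
    with opp have l: "l1 z < 0 \<and> 0 < l2 z" if "z \<le> b" for z using that by blast
    \<comment> \<open>Between \<open>b\<close> and \<open>Y\<close> the function \<open>?G\<close>
      falls by at least \<open>\<bar>?G b\<bar>\<close>, its slope being at least
      \<open>c1 - c2\<close>.\<close>
    define Y where "Y = b - \<bar>?G b\<bar> / (c1 - c2)"
    have "Y \<le> b" using assms by (simp add: Y_def)
    have "?G Y - (c1 - c2) * Y \<le> ?G b - (c1 - c2) * b"
    proof (rule left_derivative_nonneg_imp_le[OF \<open>Y \<le> b\<close>, where f = "\<lambda>x. ?G x - (c1 - c2) * x"])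
      show "continuous_on {Y..b} (\<lambda>x. ?G x - (c1 - c2) * x)" by (intro continuous_intros f_cont)
      fix t assume t: "Y < t" "t \<le> b"
      have "((\<lambda>x. ?G x - (c1 - c2) * x) has_real_derivative ((c1 - c2) - (l1 t - l2 t)) - (c1 - c2)) (at_left t)"
        by (intro DERIV_diff f_diff_left DERIV_cmult_Id) (use t b in auto)
      then show "\<exists>D\<ge>0. ((\<lambda>x. ?G x - (c1 - c2) * x) has_real_derivative D) (at_left t)"
        using l[of t] t by (intro exI conjI) auto
    qed
    then have "?G Y \<le> ?G b - (c1 - c2) * (b - Y)" by (simp add: algebra_simps)
    also have "\<dots> = ?G b - \<bar>?G b\<bar>" using assms by (simp add: Y_def)
    also have "\<dots> \<le> 0" by simp
    finally show False using G[of Y] l[of Y] \<open>Y \<le> b\<close> by linarith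
  qed
qed

lemma f_nonneg: "0 \<le> f1 x" "0 \<le> f2 x"
proof -
  interpret s: one_sided_solution h2 h1 u2 u1 r2 r1 l2 l1 a c2 c1 C by (rule swap)
  have "0 \<le> f1 x \<and> 0 \<le> f2 x"
    using f_nonneg_aux[of x] s.f_nonneg_aux[of x] c(3) by linarith
  then show "0 \<le> f1 x" "0 \<le> f2 x" by auto
qed

lemma same_signs: "0 \<le> r1 x * r2 x" "0 \<le> l1 x * l2 x"
  using f_nonneg[of x] hamiltonian_nonneg_iff[of "r1 x" "r2 x"] hamiltonian_nonneg_iff[of "l1 x" "l2 x"]
  by (auto simp: ham_r ham_l)

section \<open>Exclusion of negative slopes\<close>

lemma f_sum_right:
  "\<exists>k>0. ((\<lambda>y. f1 y + f2 y) has_real_derivative k - (r1 y + r2 y)) (at_right y)"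
proof -
  obtain k1 k2 where "k1 > 0" "(h1 has_real_derivative k1) (at_right y)"
    "k2 > 0" "(h2 has_real_derivative k2) (at_right y)"
    using h1_right h2_right by blast
  then have "((\<lambda>y. f1 y + f2 y) has_real_derivative (k1 - r1 y) + (k2 - r2 y)) (at_right y)"
    by (intro DERIV_add DERIV_diff u_right)
  then show ?thesis using \<open>k1 > 0\<close> \<open>k2 > 0\<close>
    by (intro exI[of _ "k1 + k2"]) (auto simp: algebra_simps)
qed

text \<open>While the sum of the slopes is negative, \<open>f1 + f2\<close> rises from a positive
  value. The sum cannot reach 0 continuously: slopes of equal sign would then both vanish, and
  \<open>f1 + f2\<close> with them. It cannot jump either, as this requires
  \<open>0 \<le> l1 + l2\<close>. So it remains negative, and \<open>f1 + f2\<close> grows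
  quadratically.\<close>

lemma r_sum_nonneg: "0 \<le> r1 x + r2 x"
proof (rule ccontr)
  assume "\<not> ?thesis"
  then have x: "r1 x + r2 x < 0" by simp
  let ?g = "\<lambda>x. f1 x + f2 x"
  have g_eq: "?g y = 2 * (r1 y * r2 y) + ((r1 y)\<^sup>2 + (r2 y)\<^sup>2) / 2"
    "?g y = 2 * (l1 y * l2 y) + ((l1 y)\<^sup>2 + (l2 y)\<^sup>2) / 2" for y
    using hamiltonian_sum[of "r1 y" "r2 y"] hamiltonian_sum[of "l1 y" "l2 y"]
    by (auto simp: ham_r ham_l)
  have gx: "0 < ?g x"
  proof -
    have "0 < (r1 x)\<^sup>2 + (r2 x)\<^sup>2" using x by (simp add: sum_power2_gt_zero_iff)
    then show ?thesis unfolding g_eq(1)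
      using same_signs(1)[of x] by (intro add_nonneg_pos) simp_all
  qed
  have g_mono: "?g x \<le> ?g y" if "x \<le> y" "\<And>z. x \<le> z \<Longrightarrow> z < y \<Longrightarrow> r1 z + r2 z < 0" for y
  proof (rule right_derivative_nonneg_imp_le[OF that(1), where f = ?g])
    show "continuous_on {x..y} ?g" by (intro continuous_on_add f_cont)
    fix z assume z: "x \<le> z" "z < y"
    obtain k where "k > 0" "(?g has_real_derivative k - (r1 z + r2 z)) (at_right z)"
      using f_sum_right by blast
    then show "\<exists>D\<ge>0. (?g has_real_derivative D) (at_right z)"
      using that(2)[OF z] by (intro exI conjI) auto
  qed
  have r: "r1 y + r2 y < 0" if "x \<le> y" for y
  proof (rule real_induct_right[of "\<lambda>y. r1 y + r2 y < 0" x y])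
    fix y assume "x \<le> y" "\<And>z. x \<le> z \<Longrightarrow> z \<le> y \<Longrightarrow> r1 z + r2 z < 0"
    then show "eventually (\<lambda>y. r1 y + r2 y < 0) (at_right y)"
      using order_tendstoD(2)[OF tendsto_add[OF r_right], of y 0] by simp
  next
    fix y assume y: "x < y" and IH: "\<And>z. x \<le> z \<Longrightarrow> z < y \<Longrightarrow> r1 z + r2 z < 0"
    have "eventually (\<lambda>z. r1 z + r2 z \<le> 0) (at_left y)"
      by (rule eventually_mono[OF eventually_at_left_real[OF y]]) (use IH in \<open>auto simp: less_imp_le\<close>)
    then have le: "l1 y + l2 y \<le> 0"
      using tendsto_upperbound[OF tendsto_add[OF r_left]] by auto
    have "0 < ?g y" using g_mono[of y] gx y IH by auto
    moreover have "?g y = 0" if "l1 y + l2 y = 0"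
    proof -
      have l2: "l2 y = - l1 y" using that by simp
      then have "l1 y = 0" using same_signs(2)[of y] by (auto simp: mult_le_0_iff)
      then show ?thesis using l2 g_eq(2)[of y] by simp
    qed
    ultimately have "l1 y + l2 y < 0" using le by fastforce
    then show "r1 y + r2 y < 0" using jump[of y] by auto
  qed (use x that in auto)
  show False
  proof (rule sqrt_growth_right_False[of 1 x ?g "2 * C"])
    show "continuous_on {x..} ?g" by (intro continuous_on_add f_cont)
    show "?g y \<le> 2 * C * (1 + \<bar>y\<bar>)" for y using growth[of y] by (auto simp: algebra_simps)
    fix y assume y: "x \<le> y"
    show "0 < ?g y" using g_mono[OF y] r gx by (meson order_less_le_trans)
    obtain k where k: "k > 0" "(?g has_real_derivative k - (r1 y + r2 y)) (at_right y)"
      using f_sum_right by blast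
    have "?g y = (r1 y + r2 y)\<^sup>2 - ((r1 y)\<^sup>2 + (r2 y)\<^sup>2) / 2"
      unfolding g_eq(1) by (simp add: power2_eq_square field_simps)
    also have "\<dots> \<le> (- (r1 y + r2 y))\<^sup>2" unfolding power2_minus by simp
    finally have "sqrt (?g y) \<le> - (r1 y + r2 y)" using r[OF y] by (intro real_le_lsqrt) auto
    then show "\<exists>D. (?g has_real_derivative D) (at_right y) \<and> 1 * sqrt (?g y) \<le> D"
      using k by (intro exI[of _ "k - (r1 y + r2 y)"] conjI) auto
  qed simp
qed

lemma r_nonneg: "0 \<le> r1 x" "0 \<le> r2 x"
  using same_signs(1)[of x] r_sum_nonneg[of x] by (auto simp: zero_le_mult_iff)

end

section \<open>Uniqueness\<close>

text \<open>As the Hamiltonians are quadratic, their increments are linear in the increments of the arguments,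
  with coefficients taken at the midpoint.\<close>

lemma hamiltonian_increment:
  fixes p1 p2 q1 q2 :: real
  defines "s \<equiv> (p1 + p2 + q1 + q2) / 2" and "D1 \<equiv> p1 - q1" and "D2 \<equiv> p2 - q2"
  shows "hamiltonian p1 p2 - hamiltonian q1 q2 = s * D1 + (p1 + q1) / 2 * D2"
    and "hamiltonian p2 p1 - hamiltonian q2 q1 = (p2 + q2) / 2 * D1 + s * D2"
  by (simp_all add: hamiltonian_def s_def D1_def D2_def field_simps power2_eq_square)

text \<open>The off-diagonal coefficients of \<open>hamiltonian_increment\<close> add up to
  \<open>s\<close>, so the quadratic form is \<open>s * (D1\<^sup>2 + D2\<^sup>2 + D1 * D2)\<close>;
  since \<open>s \<ge> 0\<close>, it is at least half of its diagonal part.\<close>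

lemma hamiltonian_monotone:
  fixes p1 p2 q1 q2 :: real
  defines "s \<equiv> (p1 + p2 + q1 + q2) / 2"
  assumes "0 \<le> p1" "0 \<le> p2" "0 \<le> q1" "0 \<le> q2"
  shows "s * ((p1 - q1)\<^sup>2 + (p2 - q2)\<^sup>2) / 2 \<le>
     (hamiltonian p1 p2 - hamiltonian q1 q2) * (p1 - q1) + (hamiltonian p2 p1 - hamiltonian q2 q1) * (p2 - q2)"
proof -
  define D1 D2 where "D1 = p1 - q1" and "D2 = p2 - q2"
  have "(hamiltonian p1 p2 - hamiltonian q1 q2) * D1 + (hamiltonian p2 p1 - hamiltonian q2 q1) * D2
    = s * (D1\<^sup>2 + D2\<^sup>2 + D1 * D2)"
    unfolding hamiltonian_increment(1)[of p1 p2 q1 q2] hamiltonian_increment(2)[of p2 p1 q2 q1] D1_def[symmetric] D2_def[symmetric] s_def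
    by (simp add: field_simps power2_eq_square)
  also have "\<dots> = s * (D1\<^sup>2 + D2\<^sup>2) / 2 + s * (D1 + D2)\<^sup>2 / 2"
    by (simp add: field_simps power2_eq_square)
  finally show ?thesis
    using assms by (simp add: D1_def D2_def)
qed

text \<open>On the quadrant the off-diagonal coefficients lie between 0 and \<open>s\<close>, so
  every entry of the increment matrix is at most \<open>s\<close>; bounding the square of each sum
  by twice the sum of squares gives the factor 4.\<close>

lemma hamiltonian_increment_sq_le:
  fixes p1 p2 q1 q2 :: real
  defines "s \<equiv> (p1 + p2 + q1 + q2) / 2"
  assumes "0 \<le> p1" "0 \<le> p2" "0 \<le> q1" "0 \<le> q2"
  shows "(hamiltonian p1 p2 - hamiltonian q1 q2)\<^sup>2 + (hamiltonian p2 p1 - hamiltonian q2 q1)\<^sup>2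
     \<le> 4 * s\<^sup>2 * ((p1 - q1)\<^sup>2 + (p2 - q2)\<^sup>2)"
proof -
  define D1 D2 where "D1 = p1 - q1" and "D2 = p2 - q2"
  define \<alpha> \<beta> where "\<alpha> = (p1 + q1) / 2" and "\<beta> = (p2 + q2) / 2"
  have \<alpha>\<beta>: "0 \<le> \<alpha>" "0 \<le> \<beta>" "\<alpha> \<le> s" "\<beta> \<le> s" using assms by (auto simp: \<alpha>_def \<beta>_def s_def field_simps)
  have two: "(x + y)\<^sup>2 \<le> 2 * x\<^sup>2 + 2 * y\<^sup>2" for x y :: real
    using sum_squares_bound[of x y] by (simp add: power2_sum)
  have le: "\<alpha>\<^sup>2 \<le> s\<^sup>2" "\<beta>\<^sup>2 \<le> s\<^sup>2" using \<alpha>\<beta> by (auto intro: power_mono)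
  have "(s * D1 + \<alpha> * D2)\<^sup>2 + (\<beta> * D1 + s * D2)\<^sup>2
    \<le> (2 * (s * D1)\<^sup>2 + 2 * (\<alpha> * D2)\<^sup>2) + (2 * (\<beta> * D1)\<^sup>2 + 2 * (s * D2)\<^sup>2)"
    by (intro add_mono two)
  also have "\<dots> = 2 * s\<^sup>2 * (D1\<^sup>2 + D2\<^sup>2) + 2 * (\<alpha>\<^sup>2 * D2\<^sup>2) + 2 * (\<beta>\<^sup>2 * D1\<^sup>2)"
    by (simp add: power_mult_distrib algebra_simps)
  also have "\<dots> \<le> 2 * s\<^sup>2 * (D1\<^sup>2 + D2\<^sup>2) + 2 * (s\<^sup>2 * D2\<^sup>2) + 2 * (s\<^sup>2 * D1\<^sup>2)"
    using le by (intro add_mono mult_left_mono mult_right_mono) auto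
  also have "\<dots> = 4 * s\<^sup>2 * (D1\<^sup>2 + D2\<^sup>2)" by (simp add: algebra_simps)
  finally show ?thesis
    unfolding hamiltonian_increment(1)[of p1 p2 q1 q2] hamiltonian_increment(2)[of p2 p1 q2 q1] D1_def[symmetric] D2_def[symmetric] s_def \<alpha>_def \<beta>_def .
qed

lemma exp_sqrt_exceeds_square:
  fixes \<kappa> c C t0 :: real
  assumes "0 < \<kappa>" "0 < c"
  shows "\<exists>t\<ge>t0. C * t\<^sup>2 < c * exp (\<kappa> * sqrt t)"
proof -
  have "((\<lambda>t. t\<^sup>2 / exp (\<kappa> * sqrt t)) \<longlongrightarrow> 0) at_top"
    using assms(1) by real_asymp
  then have "((\<lambda>t. C * (t\<^sup>2 / exp (\<kappa> * sqrt t))) \<longlongrightarrow> C * 0) at_top"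
    by (rule tendsto_mult_left)
  then have "eventually (\<lambda>t. C * (t\<^sup>2 / exp (\<kappa> * sqrt t)) < c) at_top"
    using assms(2) by (intro order_tendstoD(2)) auto
  then have "eventually (\<lambda>t. t0 \<le> t \<and> C * (t\<^sup>2 / exp (\<kappa> * sqrt t)) < c) at_top"
    using eventually_ge_at_top[of t0] by eventually_elim auto
  then obtain t where "t0 \<le> t" "C * (t\<^sup>2 / exp (\<kappa> * sqrt t)) < c"
    by (auto simp: eventually_at_top_linorder)
  then show ?thesis by (intro exI[of _ t]) (simp add: field_simps)
qed

context one_sided_solution
begin

text \<open>For nonnegative slopes \<open>r\<^sup>2 / 2\<close> is at most the Hamiltonian, so
  linear growth of \<open>h - u\<close> leaves slopes of the order of a square root.\<close>

lemma r_le: "r1 x + r2 x \<le> 4 * sqrt (\<bar>C\<bar> + 1) * sqrt (1 + \<bar>x\<bar>)"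
proof -
  have C: "f \<le> (\<bar>C\<bar> + 1) * (1 + \<bar>x\<bar>)" if "\<bar>f\<bar> \<le> C * (1 + \<bar>x\<bar>)" for f
  proof -
    have "f \<le> C * (1 + \<bar>x\<bar>)" using that by linarith
    also have "\<dots> \<le> (\<bar>C\<bar> + 1) * (1 + \<bar>x\<bar>)" by (intro mult_right_mono) auto
    finally show ?thesis .
  qed
  have *: "r \<le> 2 * sqrt (\<bar>C\<bar> + 1) * sqrt (1 + \<bar>x\<bar>)"
    if "0 \<le> r" "0 \<le> s" "\<bar>hamiltonian r s\<bar> \<le> C * (1 + \<bar>x\<bar>)" for r s
  proof (rule power2_le_imp_le)
    have "r\<^sup>2 / 2 \<le> hamiltonian r s" using that by (simp add: hamiltonian_def)
    also have "\<dots> \<le> (\<bar>C\<bar> + 1) * (1 + \<bar>x\<bar>)" using C that by blast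
    finally have "r\<^sup>2 \<le> 2 * ((\<bar>C\<bar> + 1) * (1 + \<bar>x\<bar>))" by simp
    also have "\<dots> \<le> 4 * ((\<bar>C\<bar> + 1) * (1 + \<bar>x\<bar>))" by (rule mult_right_mono) auto
    also have "\<dots> = (2 * sqrt (\<bar>C\<bar> + 1) * sqrt (1 + \<bar>x\<bar>))\<^sup>2" by (simp add: power_mult_distrib)
    finally show "r\<^sup>2 \<le> (2 * sqrt (\<bar>C\<bar> + 1) * sqrt (1 + \<bar>x\<bar>))\<^sup>2" .
  qed simp
  show ?thesis
    using *[OF r_nonneg[of x]] *[OF r_nonneg(2,1)[of x]] growth[of x]
    by (simp add: ham_r)
qed

text \<open>\<open>Q\<close> is the squared distance of the two solutions and \<open>s\<close> the sum of the slopes at the midpoint. By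
  \<open>hamiltonian_monotone\<close> and \<open>hamiltonian_increment_sq_le\<close>, \<open>4 * s * Q' \<le> - Q\<close>; as \<open>s\<close> is of order
  \<open>sqrt \<bar>x\<bar>\<close>, a nonzero \<open>Q\<close> would grow like \<open>exp (\<kappa> * sqrt \<bar>x\<bar>)\<close> towards minus infinity.\<close>

theorem unique:
  assumes v_cont: "continuous_on UNIV v1" "continuous_on UNIV v2"
    and v_right: "\<And>y. (v1 has_real_derivative p1 y) (at_right y)"
      "\<And>y. (v2 has_real_derivative p2 y) (at_right y)"
    and ham_v: "\<And>y. hamiltonian (p1 y) (p2 y) = h1 y - v1 y"
      "\<And>y. hamiltonian (p2 y) (p1 y) = h2 y - v2 y"
    and p: "\<And>y. 0 \<le> p1 y" "\<And>y. 0 \<le> p2 y" "\<And>y. p1 y + p2 y \<le> P"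
    and growth_v: "\<And>y. \<bar>h1 y - v1 y\<bar> \<le> C' * (1 + \<bar>y\<bar>)" "\<And>y. \<bar>h2 y - v2 y\<bar> \<le> C' * (1 + \<bar>y\<bar>)"
  shows "u1 x0 = v1 x0 \<and> u2 x0 = v2 x0"
proof (rule ccontr)
  assume neq: "\<not> ?thesis"
  define Q where "Q x = (u1 x - v1 x)\<^sup>2 + (u2 x - v2 x)\<^sup>2" for x
  define Q' where "Q' x = 2 * ((u1 x - v1 x) * (r1 x - p1 x) + (u2 x - v2 x) * (r2 x - p2 x))" for x
  have Q_right: "(Q has_real_derivative Q' x) (at_right x)" for x
    unfolding Q_def Q'_def
    by (auto intro!: derivative_eq_intros u_right v_right simp: algebra_simps)
  have Q_cont: "continuous_on A Q" for A
    unfolding Q_def using continuous_on_subset[OF _ subset_UNIV] u_cont v_cont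
    by (intro continuous_intros) blast+
  have Q_pos: "0 < Q x0" using neq by (simp add: Q_def sum_power2_gt_zero_iff)
  define B where "B = 2 * sqrt (\<bar>C\<bar> + 1) + P"
  have P: "0 \<le> P" using p[of 0] by linarith
  have B: "0 < B" using P real_sqrt_gt_zero[of "\<bar>C\<bar> + 1"] unfolding B_def by linarith
  define s where "s x = (r1 x + r2 x + p1 x + p2 x) / 2" for x
  have s: "0 \<le> s x" "s x \<le> B * sqrt (1 + \<bar>x\<bar>)" for x
  proof -
    show "0 \<le> s x" using r_nonneg[of x] p[of x] by (simp add: s_def)
    define w where "w = sqrt (1 + \<bar>x\<bar>)"
    have "1 \<le> w" by (simp add: w_def)
    then have P_le: "P \<le> P * w" using P mult_left_mono[of 1 w P] by simp
    have "2 * s x \<le> (4 * sqrt (\<bar>C\<bar> + 1) * w) + P * w"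
      using r_le[of x, folded w_def] p(3)[of x] P_le unfolding s_def by simp
    also have "\<dots> \<le> (4 * sqrt (\<bar>C\<bar> + 1) * w) + 2 * (P * w)"
      using P \<open>1 \<le> w\<close> by simp
    also have "\<dots> = 2 * (B * w)" by (simp add: B_def algebra_simps)
    finally show "s x \<le> B * sqrt (1 + \<bar>x\<bar>)" by (simp add: w_def)
  qed
  have Q'_le: "Q' x \<le> 0" "4 * (B * sqrt (1 + \<bar>x\<bar>)) * Q' x \<le> - Q x" for x
  proof -
    define D where "D = (r1 x - p1 x)\<^sup>2 + (r2 x - p2 x)\<^sup>2"
    have "0 \<le> D" by (simp add: D_def)
    have e: "hamiltonian (r1 x) (r2 x) - hamiltonian (p1 x) (p2 x) = - (u1 x - v1 x)"
      "hamiltonian (r2 x) (r1 x) - hamiltonian (p2 x) (p1 x) = - (u2 x - v2 x)"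
      by (auto simp: ham_r ham_v)
    have "s x * D / 2 \<le> - (u1 x - v1 x) * (r1 x - p1 x) + - (u2 x - v2 x) * (r2 x - p2 x)"
      using hamiltonian_monotone[OF r_nonneg[of x] p(1,2)[of x]] unfolding e s_def D_def
      by (simp add: add.assoc)
    also have "\<dots> = - Q' x / 2" by (simp add: Q'_def algebra_simps)
    finally have 1: "Q' x \<le> - (s x * D)" by simp
    moreover have "0 \<le> s x * D" using s(1) \<open>0 \<le> D\<close> by simp
    ultimately show "Q' x \<le> 0" by linarith
    \<comment> \<open>The estimate is kept as a product because \<open>s x\<close> may vanish; its
      upper bound can be inserted because \<open>Q' x \<le> 0\<close>.\<close>
    then have "4 * (B * sqrt (1 + \<bar>x\<bar>)) * Q' x \<le> 4 * s x * Q' x"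
      using s(2)[of x] by (intro mult_right_mono_neg) auto
    also have "\<dots> \<le> 4 * s x * (- (s x * D))" using 1 s(1)[of x] by (intro mult_left_mono) auto
    also have "\<dots> = - (4 * (s x)\<^sup>2 * D)" by (simp add: power2_eq_square)
    also have "\<dots> \<le> - Q x"
      using hamiltonian_increment_sq_le[OF r_nonneg[of x] p(1,2)[of x]]
      unfolding e s_def D_def Q_def power2_minus by (simp only: neg_le_iff_le)
    finally show "4 * (B * sqrt (1 + \<bar>x\<bar>)) * Q' x \<le> - Q x" .
  qed
  \<comment> \<open>To the left of 0, \<open>1 + \<bar>x\<bar>\<close> is the smooth function
    \<open>1 - x\<close>.\<close>
  define x1 where "x1 = min x0 0"
  have x1: "x1 \<le> x0" "x1 \<le> 0" by (auto simp: x1_def)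
  have "- Q x1 \<le> - Q x0"
    by (rule right_derivative_nonneg_imp_le[OF x1(1), where f = "\<lambda>x. - Q x"])
      (use Q_cont Q'_le(1) DERIV_minus[OF Q_right] in \<open>auto intro!: continuous_on_minus, metis neg_0_le_iff_le\<close>)
  then have Q1: "0 < Q x1" using Q_pos by simp
  \<comment> \<open>The derivative of \<open>\<kappa> * sqrt (1 - x)\<close> is
    \<open>- 1 / (4 * B * sqrt (1 - x))\<close>, which matches the rate in \<open>Q'_le\<close>; so
    the weighted distance \<open>R\<close> does not increase with \<open>x\<close>.\<close>
  define \<kappa> where "\<kappa> = 1 / (2 * B)"
  have \<kappa>: "0 < \<kappa>" using B by (simp add: \<kappa>_def)
  define R where "R x = Q x * exp (- (\<kappa> * sqrt (1 - x)))" for x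
  have R: "R x1 \<le> R x" if "x \<le> x1" for x
  proof -
    have "- R x \<le> - R x1"
    proof (rule right_derivative_nonneg_imp_le[OF that, where f = "\<lambda>x. - R x"])
      show "continuous_on {x..x1} (\<lambda>x. - R x)"
        unfolding R_def by (intro continuous_intros Q_cont)
      fix y assume y: "x \<le> y" "y < x1"
      then have "y < 0" using x1 by auto
      then have pos: "0 < 1 - y" by simp
      have "((\<lambda>x. sqrt (1 - x)) has_real_derivative - inverse (sqrt (1 - y)) / 2) (at_right y)"
        using pos by (auto intro!: derivative_eq_intros)
      then have "((\<lambda>x. exp (- (\<kappa> * sqrt (1 - x)))) has_real_derivative
          exp (- (\<kappa> * sqrt (1 - y))) * (\<kappa> * (inverse (sqrt (1 - y)) / 2))) (at_right y)"
        using DERIV_chain2[OF DERIV_exp DERIV_minus[OF DERIV_cmult]] by fastforce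
      from DERIV_minus[OF DERIV_mult[OF Q_right this]]
      have "((\<lambda>x. - R x) has_real_derivative
          - (Q' y + Q y * (\<kappa> * (inverse (sqrt (1 - y)) / 2))) * exp (- (\<kappa> * sqrt (1 - y)))) (at_right y)"
        unfolding R_def by (simp add: algebra_simps)
      moreover have "Q' y + Q y * (\<kappa> * (inverse (sqrt (1 - y)) / 2)) \<le> 0"
        using Q'_le(2)[of y] \<open>y < 0\<close> pos B by (simp add: \<kappa>_def field_simps)
      then have "0 \<le> - (Q' y + Q y * (\<kappa> * (inverse (sqrt (1 - y)) / 2))) * exp (- (\<kappa> * sqrt (1 - y)))"
        by (intro mult_nonneg_nonneg) auto
      ultimately show "\<exists>D\<ge>0. ((\<lambda>x. - R x) has_real_derivative D) (at_right y)" by blast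
    qed
    then show ?thesis by simp
  qed
  have R1: "0 < R x1" using Q1 by (simp add: R_def)
  have Q_le: "Q x \<le> 2 * (C + C')\<^sup>2 * (1 + \<bar>x\<bar>)\<^sup>2" for x
  proof -
    have "\<bar>u1 x - v1 x\<bar> \<le> (C + C') * (1 + \<bar>x\<bar>)" "\<bar>u2 x - v2 x\<bar> \<le> (C + C') * (1 + \<bar>x\<bar>)"
      using growth[of x] growth_v[of x] unfolding distrib_right by linarith+
    then have "(u1 x - v1 x)\<^sup>2 \<le> ((C + C') * (1 + \<bar>x\<bar>))\<^sup>2" "(u2 x - v2 x)\<^sup>2 \<le> ((C + C') * (1 + \<bar>x\<bar>))\<^sup>2"
      by (metis abs_ge_zero power2_abs power_mono)+
    then show ?thesis by (simp add: Q_def power_mult_distrib)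
  qed
  \<comment> \<open>The contradiction arises at the point \<open>1 - t\<close>, where
    \<open>1 + \<bar>1 - t\<bar> = t\<close>.\<close>
  obtain t where t: "1 - x1 \<le> t" "2 * (C + C')\<^sup>2 * t\<^sup>2 < R x1 * exp (\<kappa> * sqrt t)"
    using exp_sqrt_exceeds_square[OF \<kappa> R1, of "1 - x1" "2 * (C + C')\<^sup>2"] by blast
  have "R x1 * exp (\<kappa> * sqrt t) \<le> R (1 - t) * exp (\<kappa> * sqrt t)"
    using R[of "1 - t"] t by (intro mult_right_mono) auto
  also have "\<dots> = Q (1 - t)" by (simp add: R_def exp_minus)
  also have "\<dots> \<le> 2 * (C + C')\<^sup>2 * t\<^sup>2" using Q_le[of "1 - t"] t x1 by simp
  finally show False using t by simp
qed

end

section \<open>One-sided derivatives of an admissible solution\<close>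

lemma AE_lebesgue_interval_nonempty:
  fixes E :: "real set"
  assumes "AE x in lebesgue. x \<in> E" "a < b"
  shows "\<exists>x\<in>E. a < x \<and> x < b"
proof (rule ccontr)
  assume "\<not> ?thesis"
  then have sub: "{a<..<b} \<subseteq> - E" by auto
  have "negligible (- E)"
    using assms(1) by (auto simp: eventually_ae_filter negligible_iff_null_sets
        intro: null_sets_completion_subset)
  then have "negligible {a<..<b}" using sub negligible_subset by blast
  moreover have "\<not> negligible {a<..<b}"
    using assms(2) by (intro open_not_negligible) auto
  ultimately show False by simp
qed

text \<open>The form in which piecewise linear costs enter: right slopes between
  \<open>m > 0\<close> and \<open>M\<close>, at the breakpoints as well, and constant distinct
  slopes on a left half-line.\<close>

locale monotone_costs =
  fixes h1 h2 :: "real \<Rightarrow> real" and a c1 c2 m M :: real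
  assumes m: "0 < m"
    and h_right: "\<And>y. \<exists>k. m \<le> k \<and> k \<le> M \<and> (h1 has_real_derivative k) (at_right y)"
      "\<And>y. \<exists>k. m \<le> k \<and> k \<le> M \<and> (h2 has_real_derivative k) (at_right y)"
    and h_cont: "continuous_on UNIV h1" "continuous_on UNIV h2"
    and h_half_line: "\<And>y. y < a \<Longrightarrow> (h1 has_real_derivative c1) (at y)"
      "\<And>y. y < a \<Longrightarrow> (h2 has_real_derivative c2) (at y)"
    and c: "m \<le> c1" "c1 \<le> M" "m \<le> c2" "c2 \<le> M" "c1 \<noteq> c2"
begin

lemma swap: "monotone_costs h2 h1 a c2 c1 m M"
  using m h_right h_cont h_half_line c unfolding monotone_costs_def by blast

lemma h1_increment:
  assumes "x \<le> y"
  shows "m * (y - x) \<le> h1 y - h1 x" "h1 y - h1 x \<le> M * (y - x)"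
proof -
  have cont: "continuous_on {x..y} h1" using h_cont(1) continuous_on_subset by blast
  have "h1 x - m * x \<le> h1 y - m * y"
  proof (rule right_derivative_nonneg_imp_le[OF assms, where f = "\<lambda>x. h1 x - m * x"])
    show "continuous_on {x..y} (\<lambda>x. h1 x - m * x)" by (intro continuous_intros cont)
    fix z
    obtain k where "m \<le> k" "(h1 has_real_derivative k) (at_right z)" using h_right(1) by blast
    then show "\<exists>D\<ge>0. ((\<lambda>x. h1 x - m * x) has_real_derivative D) (at_right z)"
      using DERIV_diff[OF _ DERIV_cmult_Id, of h1 k z "{z<..}" m] by (intro exI[of _ "k - m"]) auto
  qed
  then show "m * (y - x) \<le> h1 y - h1 x" by (simp add: algebra_simps)
  have "M * x - h1 x \<le> M * y - h1 y"
  proof (rule right_derivative_nonneg_imp_le[OF assms, where f = "\<lambda>x. M * x - h1 x"])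
    show "continuous_on {x..y} (\<lambda>x. M * x - h1 x)" by (intro continuous_intros cont)
    fix z
    obtain k where "k \<le> M" "(h1 has_real_derivative k) (at_right z)" using h_right(1) by blast
    then show "\<exists>D\<ge>0. ((\<lambda>x. M * x - h1 x) has_real_derivative D) (at_right z)"
      using DERIV_diff[OF DERIV_cmult_Id, of h1 k z "{z<..}" M] by (intro exI[of _ "M - k"]) auto
  qed
  then show "h1 y - h1 x \<le> M * (y - x)" by (simp add: algebra_simps)
qed

lemma h1_lipschitz: "\<bar>h1 x - h1 y\<bar> \<le> M * \<bar>x - y\<bar>"
proof (cases x y rule: linorder_cases)
  case less
  then have "0 \<le> m * (y - x)" using m by simp
  then show ?thesis using h1_increment[of x y] less by simp
next
  case greater
  then have "0 \<le> m * (x - y)" using m by simp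
  then show ?thesis using h1_increment[of y x] greater by simp
qed simp

lemma h1_growth: "\<bar>h1 x\<bar> \<le> (\<bar>h1 0\<bar> + M) * (1 + \<bar>x\<bar>)"
proof -
  have "\<bar>h1 x\<bar> \<le> \<bar>h1 0\<bar> + M * \<bar>x\<bar>" using h1_lipschitz[of x 0] by simp
  also have "\<dots> \<le> \<bar>h1 0\<bar> + M * \<bar>x\<bar> + (\<bar>h1 0\<bar> * \<bar>x\<bar> + M)" using m c by simp
  finally show ?thesis by (simp add: algebra_simps)
qed

lemma h2_lipschitz: "\<bar>h2 x - h2 y\<bar> \<le> M * \<bar>x - y\<bar>"
  by (rule monotone_costs.h1_lipschitz[OF swap])

lemma h2_growth: "\<bar>h2 x\<bar> \<le> (\<bar>h2 0\<bar> + M) * (1 + \<bar>x\<bar>)"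
  by (rule monotone_costs.h1_growth[OF swap])

text \<open>(A3) provides limits of \<open>u'\<close> along \<open>D\<close> only. By the mean value
  inequality for absolutely continuous functions they are the one-sided derivatives of
  \<open>u\<close> at every point. The same limits, taken along the set \<open>E\<close> where the
  system holds, carry the system to both derivatives, and \<open>hamiltonian_eq_imp\<close> leaves
  \<open>l = r\<close> or \<open>l = - r\<close>.\<close>

theorem admissible_imp_one_sided:
  assumes "admissible_solution h1 h2 u"
  shows "\<exists>r1 r2 l1 l2 C. one_sided_solution h1 h2 (\<lambda>x. fst (u x)) (\<lambda>x. snd (u x)) r1 r2 l1 l2 a c1 c2 C"
proof -
  define D where "D = {x. u differentiable (at x)}"
  define u' where "u' = (\<lambda>x. vector_derivative u (at x))"
  define E where "E = {x. \<exists>p1 p2. (u has_vector_derivative (p1, p2)) (at x) \<and>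
        fst (u x) = h1 x - p1 * p2 - p1\<^sup>2 / 2 \<and> snd (u x) = h2 x - p1 * p2 - p2\<^sup>2 / 2}"
  have ac: "abs_continuous_on x y u" for x y
    using assms by (simp add: admissible_solution_def)
  have AE_E: "AE x in lebesgue. x \<in> E"
    using assms unfolding admissible_solution_def E_def by (simp only: mem_Collect_eq)
  obtain C where C: "norm (u x) \<le> C * (1 + \<bar>x\<bar>)" for x
    using assms unfolding admissible_solution_def by blast
  have "\<forall>y. \<exists>r l. (u' \<longlongrightarrow> r) (at y within D \<inter> {y<..}) \<and> (u' \<longlongrightarrow> l) (at y within D \<inter> {..<y}) \<and>
                (\<not> (y \<in> D \<and> continuous (at y within D) u') \<longrightarrow>
                   fst r + snd r \<le> 0 \<or> fst l + snd l \<ge> 0)"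
    using assms unfolding admissible_solution_def Let_def D_def u'_def by (elim conjE) assumption
  then obtain r l where r: "\<And>y. (u' \<longlongrightarrow> r y) (at y within D \<inter> {y<..})"
    and l: "\<And>y. (u' \<longlongrightarrow> l y) (at y within D \<inter> {..<y})"
    and adm: "\<And>y. \<not> (y \<in> D \<and> continuous (at y within D) u') \<Longrightarrow> fst (r y) + snd (r y) \<le> 0 \<or> fst (l y) + snd (l y) \<ge> 0"
    by metis
  have u': "(u has_vector_derivative u' x) (at x)" if "x \<in> D" for x
    using that vector_derivative_works unfolding D_def u'_def by blast
  have ED: "E \<subseteq> D"
    unfolding E_def D_def by (auto intro: differentiableI_vector)
  have E_eq: "hamiltonian (fst (u' x)) (snd (u' x)) = h1 x - fst (u x)"
    "hamiltonian (snd (u' x)) (fst (u' x)) = h2 x - snd (u x)" if "x \<in> E" for x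
    using that vector_derivative_at unfolding E_def u'_def hamiltonian_def by fastforce+
  have right_nontriv: "at y within E \<inter> {y<..} \<noteq> bot" for y
    unfolding trivial_limit_within islimpt_approachable
    using AE_lebesgue_interval_nonempty[OF AE_E, of y "y + e" for e]
    by (force simp: dist_real_def)
  have left_nontriv: "at y within E \<inter> {..<y} \<noteq> bot" for y
    unfolding trivial_limit_within islimpt_approachable
    using AE_lebesgue_interval_nonempty[OF AE_E, of "y - e" y for e]
    by (force simp: dist_real_def)
  have rE: "(u' \<longlongrightarrow> r y) (at y within E \<inter> {y<..})" and lE: "(u' \<longlongrightarrow> l y) (at y within E \<inter> {..<y})" for y
    using r[of y] l[of y] ED by (auto elim!: tendsto_within_subset)
  \<comment> \<open>A closed ball containing all values of \<open>u'\<close> on an interval also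
    contains their one-sided limits at its points; this yields the one-sided limits of
    \<open>r\<close> and \<open>l\<close>.\<close>
  have nearby: "y \<le> x \<Longrightarrow> x < z \<Longrightarrow> r x \<in> cball p e" "y < x \<Longrightarrow> x \<le> z \<Longrightarrow> l x \<in> cball p e"
    if *: "\<And>t. t \<in> D \<Longrightarrow> y < t \<Longrightarrow> t < z \<Longrightarrow> u' t \<in> cball p e" for x y z p e
  proof -
    assume x: "y \<le> x" "x < z"
    have "eventually (\<lambda>t. u' t \<in> cball p e) (at x within E \<inter> {x<..})"
      unfolding eventually_at
      by (rule exI[of _ "z - x"]) (use x * ED in \<open>auto simp: dist_real_def\<close>)
    from Lim_in_closed_set[OF closed_cball this right_nontriv rE]
    show "r x \<in> cball p e" .
  next
    assume x: "y < x" "x \<le> z"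
    have "eventually (\<lambda>t. u' t \<in> cball p e) (at x within E \<inter> {..<x})"
      unfolding eventually_at
      by (rule exI[of _ "x - y"]) (use x * ED in \<open>auto simp: dist_real_def\<close>)
    from Lim_in_closed_set[OF closed_cball this left_nontriv lE]
    show "l x \<in> cball p e" .
  qed
  have near_right: "\<exists>d>0. \<forall>t. t \<in> D \<and> y < t \<and> t < y + d \<longrightarrow> u' t \<in> cball (r y) e" if e: "e > 0" for y e
  proof -
    obtain d where d: "d > 0" "\<forall>t\<in>D \<inter> {y<..}. t \<noteq> y \<and> dist t y < d \<longrightarrow> dist (u' t) (r y) < e"
      using tendstoD[OF r e, of y] unfolding eventually_at by blast
    then show ?thesis
      by (intro exI[of _ d]) (auto simp: dist_real_def dist_commute less_imp_le)
  qed
  have near_left: "\<exists>d>0. \<forall>t. t \<in> D \<and> y - d < t \<and> t < y \<longrightarrow> u' t \<in> cball (l y) e" if e: "e > 0" for y e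
  proof -
    obtain d where d: "d > 0" "\<forall>t\<in>D \<inter> {..<y}. t \<noteq> y \<and> dist t y < d \<longrightarrow> dist (u' t) (l y) < e"
      using tendstoD[OF l e, of y] unfolding eventually_at by blast
    then show ?thesis
      by (intro exI[of _ d]) (auto simp: dist_real_def dist_commute less_imp_le)
  qed
  have mean: "norm (u z - u y - (z - y) *\<^sub>R p) \<le> e * (z - y)"
    if "y \<le> z" "0 \<le> e" "\<And>t. t \<in> D \<Longrightarrow> y < t \<Longrightarrow> t < z \<Longrightarrow> u' t \<in> cball p e" for y z p e
  proof (rule abs_continuous_on_norm_diff_le[OF that(1,2) ac])
    show "AE x in lebesgue. x \<in> {y<..<z} \<longrightarrow> (\<exists>D. (u has_vector_derivative D) (at x) \<and> norm (D - p) \<le> e)"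
    proof (rule AE_mp[OF AE_E], rule AE_I2, intro impI)
      fix x assume x: "x \<in> E" "x \<in> {y<..<z}"
      then show "\<exists>D. (u has_vector_derivative D) (at x) \<and> norm (D - p) \<le> e"
        using that(3)[of x] ED u'[of x] by (intro exI[of _ "u' x"]) (auto simp: dist_norm norm_minus_commute)
    qed
  qed
  have u_right: "(u has_vector_derivative r y) (at_right y)" for y
    unfolding has_vector_derivative_def has_derivative_within_alt
  proof (intro conjI allI impI bounded_linear_scaleR_left)
    fix e :: real assume "0 < e"
    from near_right[OF this] obtain d
      where d: "d > 0" "\<And>t. t \<in> D \<Longrightarrow> y < t \<Longrightarrow> t < y + d \<Longrightarrow> u' t \<in> cball (r y) e" by metis
    have "norm (u z - u y - (z - y) *\<^sub>R r y) \<le> e * norm (z - y)" if z: "z > y" "norm (z - y) < d" for z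
      using mean[of y z e "r y"] d(2) z \<open>0 < e\<close> by simp
    then show "\<exists>d>0. \<forall>z\<in>{y<..}. norm (z - y) < d \<longrightarrow> norm (u z - u y - (z - y) *\<^sub>R r y) \<le> e * norm (z - y)"
      using d(1) by blast
  qed
  have u_left: "(u has_vector_derivative l y) (at_left y)" for y
    unfolding has_vector_derivative_def has_derivative_within_alt
  proof (intro conjI allI impI bounded_linear_scaleR_left)
    fix e :: real assume "0 < e"
    from near_left[OF this] obtain d
      where d: "d > 0" "\<And>t. t \<in> D \<Longrightarrow> y - d < t \<Longrightarrow> t < y \<Longrightarrow> u' t \<in> cball (l y) e" by metis
    have "norm (u z - u y - (z - y) *\<^sub>R l y) \<le> e * norm (z - y)" if z: "z < y" "norm (z - y) < d" for z
    proof -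
      have "norm (u y - u z - (y - z) *\<^sub>R l y) \<le> e * (y - z)"
        using mean[of z y e "l y"] d(2) z \<open>0 < e\<close> by simp
      moreover have "u z - u y - (z - y) *\<^sub>R l y = - (u y - u z - (y - z) *\<^sub>R l y)"
        by (simp add: algebra_simps)
      ultimately show ?thesis using z by (simp only: norm_minus_cancel) simp
    qed
    then show "\<exists>d>0. \<forall>z\<in>{..<y}. norm (z - y) < d \<longrightarrow> norm (u z - u y - (z - y) *\<^sub>R l y) \<le> e * norm (z - y)"
      using d(1) by blast
  qed
  have lim_right: "(r \<longlongrightarrow> r y) (at_right y)" "(l \<longlongrightarrow> r y) (at_right y)" for y
  proof -
    have *: "\<exists>d>0. \<forall>x. y < x \<and> x < y + d \<longrightarrow> dist (r x) (r y) < e \<and> dist (l x) (r y) < e" if "0 < e" for e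
    proof -
      from near_right[of "e / 2" y] that obtain d
        where d: "d > 0" "\<And>t. t \<in> D \<Longrightarrow> y < t \<Longrightarrow> t < y + d \<Longrightarrow> u' t \<in> cball (r y) (e / 2)" by (metis half_gt_zero)
      have "dist (r x) (r y) < e \<and> dist (l x) (r y) < e" if x: "y < x" "x < y + d" for x
      proof -
        have "r x \<in> cball (r y) (e / 2)" by (rule nearby(1)[OF d(2)]) (use x in auto)
        moreover have "l x \<in> cball (r y) (e / 2)" by (rule nearby(2)[OF d(2)]) (use x in auto)
        ultimately show ?thesis using \<open>0 < e\<close> by (auto simp: dist_commute)
      qed
      then show ?thesis using d(1) by blast
    qed
    show "(r \<longlongrightarrow> r y) (at_right y)" "(l \<longlongrightarrow> r y) (at_right y)"
      by (rule tendstoI, drule *, auto simp: eventually_at dist_real_def; fastforce)+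
  qed
  have lim_left: "(r \<longlongrightarrow> l y) (at_left y)" "(l \<longlongrightarrow> l y) (at_left y)" for y
  proof -
    have *: "\<exists>d>0. \<forall>x. y - d < x \<and> x < y \<longrightarrow> dist (r x) (l y) < e \<and> dist (l x) (l y) < e" if "0 < e" for e
    proof -
      from near_left[of "e / 2" y] that obtain d
        where d: "d > 0" "\<And>t. t \<in> D \<Longrightarrow> y - d < t \<Longrightarrow> t < y \<Longrightarrow> u' t \<in> cball (l y) (e / 2)" by (metis half_gt_zero)
      have "dist (r x) (l y) < e \<and> dist (l x) (l y) < e" if x: "y - d < x" "x < y" for x
      proof -
        have "r x \<in> cball (l y) (e / 2)" by (rule nearby(1)[OF d(2)]) (use x in auto)
        moreover have "l x \<in> cball (l y) (e / 2)" by (rule nearby(2)[OF d(2)]) (use x in auto)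
        ultimately show ?thesis using \<open>0 < e\<close> by (auto simp: dist_commute)
      qed
      then show ?thesis using d(1) by blast
    qed
    show "(r \<longlongrightarrow> l y) (at_left y)" "(l \<longlongrightarrow> l y) (at_left y)"
      by (rule tendstoI, drule *, auto simp: eventually_at dist_real_def; fastforce)+
  qed
  have u_isCont: "isCont u y" for y
    unfolding continuous_at_split
    using has_vector_derivative_continuous[OF u_right] has_vector_derivative_continuous[OF u_left] by blast
  have h_isCont: "isCont h1 y" "isCont h2 y" for y
    using h_cont by (auto simp: continuous_on_eq_continuous_at)
  have lim_eq: "hamiltonian (fst p) (snd p) = h1 y - fst (u y) \<and> hamiltonian (snd p) (fst p) = h2 y - snd (u y)"
    if p: "(u' \<longlongrightarrow> p) (at y within E \<inter> S)" "at y within E \<inter> S \<noteq> bot" for y p S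
  proof -
    have "((\<lambda>x. hamiltonian (fst (u' x)) (snd (u' x))) \<longlongrightarrow> hamiltonian (fst p) (snd p)) (at y within E \<inter> S)"
      "((\<lambda>x. hamiltonian (snd (u' x)) (fst (u' x))) \<longlongrightarrow> hamiltonian (snd p) (fst p)) (at y within E \<inter> S)"
      unfolding hamiltonian_def by (intro tendsto_intros p(1); simp)+
    moreover have ev: "eventually (\<lambda>x. x \<in> E) (at y within E \<inter> S)"
      by (simp add: eventually_at_filter)
    ultimately have
      "((\<lambda>x. h1 x - fst (u x)) \<longlongrightarrow> hamiltonian (fst p) (snd p)) (at y within E \<inter> S)"
      "((\<lambda>x. h2 x - snd (u x)) \<longlongrightarrow> hamiltonian (snd p) (fst p)) (at y within E \<inter> S)"
      by (auto elim!: Lim_transform_eventually elim: eventually_mono simp: E_eq)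
    moreover have "((\<lambda>x. h1 x - fst (u x)) \<longlongrightarrow> h1 y - fst (u y)) (at y within E \<inter> S)"
      "((\<lambda>x. h2 x - snd (u x)) \<longlongrightarrow> h2 y - snd (u y)) (at y within E \<inter> S)"
      using u_isCont[of y] h_isCont[of y] unfolding isCont_def
      by (auto intro!: tendsto_intros intro: tendsto_within_subset)
    ultimately show ?thesis using tendsto_unique[OF p(2)] by blast
  qed
  have r_eq: "hamiltonian (fst (r y)) (snd (r y)) = h1 y - fst (u y)"
    "hamiltonian (snd (r y)) (fst (r y)) = h2 y - snd (u y)" for y
    using lim_eq[OF rE right_nontriv] by auto
  have l_eq: "hamiltonian (fst (l y)) (snd (l y)) = h1 y - fst (u y)"
    "hamiltonian (snd (l y)) (fst (l y)) = h2 y - snd (u y)" for y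
    using lim_eq[OF lE left_nontriv] by auto
  have jump: "fst (l y) = fst (r y) \<and> snd (l y) = snd (r y) \<or>
    fst (l y) = - fst (r y) \<and> snd (l y) = - snd (r y) \<and> 0 \<le> fst (l y) + snd (l y)" for y
  proof (cases "y \<in> D \<and> continuous (at y within D) u'")
    case True
    then have "(u' \<longlongrightarrow> u' y) (at y within E)"
      using ED unfolding continuous_within by (auto intro: tendsto_within_subset)
    then have "(u' \<longlongrightarrow> u' y) (at y within E \<inter> S)" for S by (rule tendsto_within_subset) auto
    then have "r y = u' y" "l y = u' y"
      using tendsto_unique[OF right_nontriv rE] tendsto_unique[OF left_nontriv lE] by blast+
    then show ?thesis by simp
  next
    case False
    \<comment> \<open>For \<open>l = - r\<close> both alternatives of (A3) say that the sum of the
      left slopes is nonnegative.\<close>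
    from hamiltonian_eq_imp[of "fst (l y)" "snd (l y)" "fst (r y)" "snd (r y)"] adm[OF False]
    show ?thesis by (auto simp: r_eq l_eq)
  qed
  define C' where "C' = \<bar>h1 0\<bar> + \<bar>h2 0\<bar> + M + C"
  have growth: "\<bar>h1 y - fst (u y)\<bar> \<le> C' * (1 + \<bar>y\<bar>)" "\<bar>h2 y - snd (u y)\<bar> \<le> C' * (1 + \<bar>y\<bar>)" for y
  proof -
    have "0 \<le> \<bar>h1 0\<bar> * (1 + \<bar>y\<bar>)" "0 \<le> \<bar>h2 0\<bar> * (1 + \<bar>y\<bar>)" by auto
    moreover have "\<bar>fst (u y)\<bar> \<le> C * (1 + \<bar>y\<bar>)" "\<bar>snd (u y)\<bar> \<le> C * (1 + \<bar>y\<bar>)"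
      using C[of y] norm_fst_le[of "fst (u y)" "snd (u y)"] norm_snd_le[of "snd (u y)" "fst (u y)"] by auto
    ultimately show "\<bar>h1 y - fst (u y)\<bar> \<le> C' * (1 + \<bar>y\<bar>)" "\<bar>h2 y - snd (u y)\<bar> \<le> C' * (1 + \<bar>y\<bar>)"
      using h1_growth[of y] h2_growth[of y] unfolding C'_def distrib_right by linarith+
  qed
  have "one_sided_solution h1 h2 (\<lambda>x. fst (u x)) (\<lambda>x. snd (u x)) (\<lambda>x. fst (r x)) (\<lambda>x. snd (r x))
      (\<lambda>x. fst (l x)) (\<lambda>x. snd (l x)) a c1 c2 C'"
  proof (rule one_sided_solution.intro)
    show "\<exists>k>0. (h1 has_real_derivative k) (at_right y)" "\<exists>k>0. (h2 has_real_derivative k) (at_right y)" for y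
      using h_right[of y] m by (meson less_le_trans)+
    show "0 < c1" "0 < c2" using m c by auto
    show "continuous_on UNIV (\<lambda>x. fst (u x))" "continuous_on UNIV (\<lambda>x. snd (u x))"
      using u_isCont by (auto intro!: continuous_intros simp: continuous_on_eq_continuous_at)
    show "((\<lambda>x. fst (u x)) has_real_derivative fst (r y)) (at_right y)"
      "((\<lambda>x. snd (u x)) has_real_derivative snd (r y)) (at_right y)"
      "((\<lambda>x. fst (u x)) has_real_derivative fst (l y)) (at_left y)"
      "((\<lambda>x. snd (u x)) has_real_derivative snd (l y)) (at_left y)" for y
      unfolding has_real_derivative_iff_has_vector_derivative
      using bounded_linear.has_vector_derivative[OF bounded_linear_fst]
        bounded_linear.has_vector_derivative[OF bounded_linear_snd] u_right u_left by blast+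
  qed (use h_cont h_half_line c r_eq l_eq jump lim_right lim_left growth in \<open>auto intro!: tendsto_intros\<close>)
  then show ?thesis by blast
qed

end

section \<open>Existence\<close>

lemma integral_has_vector_derivative_atLeast:
  fixes w :: "real \<Rightarrow> 'a::banach"
  assumes "continuous_on {a..} w" "a \<le> t"
  shows "((\<lambda>t. integral {a..t} w) has_vector_derivative w t) (at t within {a..})"
proof -
  have "((\<lambda>t. integral {a..t} w) has_vector_derivative w t) (at t within {a..t + 1})"
    by (rule integral_has_vector_derivative) (use assms in \<open>auto elim: continuous_on_subset\<close>)
  moreover have "at t within {a..t + 1} = at t within {a..}"
    by (rule at_within_nhd[of t "{..<t + 1}"]) auto
  ultimately show ?thesis by simp
qed

text \<open>The Picard operator is made a contraction on all of \<open>[a, \<infinity>)\<close> at once by the weight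
  \<open>exp (- 2 * L * (t - a))\<close>.\<close>

theorem global_lipschitz_ode:
  fixes g :: "real \<Rightarrow> 'a::banach \<Rightarrow> 'a"
  assumes cont: "continuous_on UNIV (\<lambda>(t, x). g t x)"
    and lip: "\<And>t x y. norm (g t x - g t y) \<le> L * norm (x - y)" and "0 < L"
    and bound: "\<And>t x. norm (g t x) \<le> B"
  shows "\<exists>u. u a = x0 \<and> (\<forall>t\<ge>a. (u has_vector_derivative g t (u t)) (at t within {a..}))"
proof -
  \<comment> \<open>The unknown \<open>v\<close> is the displacement from \<open>x0\<close> divided
    by the exponential weight, which makes it bounded.\<close>
  define curve where "curve v s = x0 + exp (2 * L * (s - a)) *\<^sub>R apply_bcontfun v s"
    for v :: "real \<Rightarrow>\<^sub>C 'a" and s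
  define w where "w v s = g s (curve v s)" for v s
  \<comment> \<open>With \<open>max a t\<close> the operator takes the value 0 to the left of
    \<open>a\<close>, as its elements are functions on the whole line.\<close>
  define T where "T v t = exp (- (2 * L * (max a t - a))) *\<^sub>R integral {a..max a t} (w v)" for v t
  have curve_cont: "continuous_on A (curve v)" for A v
    unfolding curve_def by (intro continuous_intros) auto
  have w_cont: "continuous_on A (w v)" for A v
  proof -
    have "continuous_on A (\<lambda>s. case (s, curve v s) of (t, x) \<Rightarrow> g t x)"
      by (rule continuous_on_compose2[OF cont]) (intro continuous_intros curve_cont, auto)
    then show ?thesis by (simp add: w_def)
  qed
  have w_int: "w v integrable_on {a..t}" for v t
    by (rule integrable_continuous_real[OF w_cont])
  have T_bcontfun: "T v \<in> bcontfun" for v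
  proof (rule bcontfun_normI)
    have "continuous_on {a..} (\<lambda>t. integral {a..t} (w v))"
      using integral_has_vector_derivative_atLeast[OF w_cont] has_vector_derivative_continuous
      unfolding continuous_on_eq_continuous_within by (metis atLeast_iff)
    then have "continuous_on UNIV (\<lambda>t. integral {a..max a t} (w v))"
      by (rule continuous_on_compose2) (auto intro!: continuous_intros)
    then show "continuous_on UNIV (T v)"
      unfolding T_def by (intro continuous_intros)
    fix t
    define \<tau> where "\<tau> = max a t - a"
    have "0 \<le> \<tau>" by (simp add: \<tau>_def)
    have "0 \<le> B" using bound[of 0 0] norm_ge_zero order_trans by blast
    have "norm (integral {a..max a t} (w v)) \<le> integral {a..max a t} (\<lambda>s. B)"
      by (rule integral_norm_bound_integral[OF w_int]) (auto simp: w_def bound)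
    also have "\<dots> = B * \<tau>" by (simp add: \<tau>_def)
    finally have "norm (T v t) \<le> exp (- (2 * L * \<tau>)) * (B * \<tau>)"
      unfolding T_def \<tau>_def[symmetric] by (simp add: mult_left_mono)
    also have "\<dots> \<le> exp (- (2 * L * \<tau>)) * (B * (exp (2 * L * \<tau>) / (2 * L)))"
    proof (intro mult_left_mono)
      have "2 * L * \<tau> \<le> exp (2 * L * \<tau>)" using exp_ge_add_one_self[of "2 * L * \<tau>"] by linarith
      then show "\<tau> \<le> exp (2 * L * \<tau>) / (2 * L)" using \<open>0 < L\<close> by (simp add: field_simps)
    qed (use \<open>0 \<le> B\<close> in auto)
    also have "\<dots> = B / (2 * L)" by (simp add: exp_minus)
    finally show "norm (T v t) \<le> B / (2 * L)" .
  qed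
  define \<Phi> where "\<Phi> v = Bcontfun (T v)" for v
  have \<Phi>: "apply_bcontfun (\<Phi> v) = T v" for v
    unfolding \<Phi>_def by (rule Bcontfun_inverse[OF T_bcontfun])
  have "\<exists>!v. \<Phi> v = v"
  proof (rule banach_fix_type[of "1 / 2"])
    show "\<forall>v v'. dist (\<Phi> v) (\<Phi> v') \<le> 1 / 2 * dist v v'"
    proof (intro allI dist_bound)
      fix v v' :: "real \<Rightarrow>\<^sub>C 'a" and t :: real
      define \<tau> where "\<tau> = max a t - a"
      have "0 \<le> \<tau>" by (simp add: \<tau>_def)
      let ?d = "dist v v'"
      have w_diff: "norm (w v s - w v' s) \<le> L * ?d * exp (2 * L * (s - a))" for s
      proof -
        have "norm (w v s - w v' s) \<le> L * norm (curve v s - curve v' s)"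
          unfolding w_def by (rule lip)
        also have "norm (curve v s - curve v' s) = exp (2 * L * (s - a)) * dist (v s) (v' s)"
          unfolding curve_def dist_norm
          by (metis abs_exp_cancel add_diff_cancel_left norm_scaleR scaleR_right_diff_distrib)
        also have "L * \<dots> \<le> L * (exp (2 * L * (s - a)) * ?d)"
          using \<open>0 < L\<close> dist_bounded[of v s v'] by (intro mult_left_mono) auto
        finally show ?thesis by (simp add: mult_ac)
      qed
      \<comment> \<open>Integrating the weight contributes \<open>1 / (2 * L)\<close> against the
        Lipschitz constant \<open>L\<close>: hence the contraction factor
        \<open>1 / 2\<close>.\<close>
      have exp_int: "((\<lambda>s. L * ?d * exp (2 * L * (s - a))) has_integral
         (?d / 2 * exp (2 * L * (max a t - a)) - ?d / 2 * exp (2 * L * (a - a)))) {a..max a t}"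
      proof (rule fundamental_theorem_of_calculus)
        fix s
        have "((\<lambda>s. ?d / 2 * exp (2 * L * (s - a))) has_real_derivative ?d / 2 * (exp (2 * L * (s - a)) * (2 * L)))
          (at s within {a..max a t})"
          by (auto intro!: derivative_eq_intros)
        then show "((\<lambda>s. ?d / 2 * exp (2 * L * (s - a))) has_vector_derivative L * ?d * exp (2 * L * (s - a)))
          (at s within {a..max a t})"
          by (simp add: has_real_derivative_iff_has_vector_derivative mult_ac)
      qed simp
      have "norm (integral {a..max a t} (w v) - integral {a..max a t} (w v'))
        = norm (integral {a..max a t} (\<lambda>s. w v s - w v' s))"
        by (simp add: integral_diff w_int)
      also have "\<dots> \<le> integral {a..max a t} (\<lambda>s. L * ?d * exp (2 * L * (s - a)))"
        by (rule integral_norm_bound_integral)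
          (use exp_int w_diff in \<open>auto intro: integrable_diff w_int has_integral_integrable\<close>)
      also have "\<dots> = ?d / 2 * exp (2 * L * \<tau>) - ?d / 2"
        using integral_unique[OF exp_int] by (simp add: \<tau>_def)
      also have "\<dots> \<le> ?d / 2 * exp (2 * L * \<tau>)" by simp
      finally have le: "norm (integral {a..max a t} (w v) - integral {a..max a t} (w v')) \<le> ?d / 2 * exp (2 * L * \<tau>)" .
      have "dist (T v t) (T v' t) = exp (- (2 * L * \<tau>)) * norm (integral {a..max a t} (w v) - integral {a..max a t} (w v'))"
        unfolding T_def dist_norm \<tau>_def
        by (metis abs_exp_cancel norm_scaleR scaleR_right_diff_distrib)
      also have "\<dots> \<le> exp (- (2 * L * \<tau>)) * (?d / 2 * exp (2 * L * \<tau>))"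
        by (rule mult_left_mono[OF le]) simp
      also have "\<dots> = 1 / 2 * ?d" by (simp add: exp_minus)
      finally show "dist (\<Phi> v t) (\<Phi> v' t) \<le> 1 / 2 * ?d" by (simp add: \<Phi>)
    qed
  qed auto
  then obtain v where v: "\<Phi> v = v" by blast
  define u where "u t = x0 + integral {a..t} (w v)" for t
  have u_eq: "u t = curve v t" if "a \<le> t" for t
  proof -
    have "apply_bcontfun v t = T v t" using \<Phi>[of v] v by simp
    then show ?thesis using that
      by (simp add: u_def curve_def T_def max_absorb2 exp_minus)
  qed
  have "(u has_vector_derivative g t (u t)) (at t within {a..})" if "a \<le> t" for t
  proof -
    have "(u has_vector_derivative w v t) (at t within {a..})"
      unfolding u_def using integral_has_vector_derivative_atLeast[OF w_cont that, of v]
      by (auto intro!: derivative_eq_intros)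
    then show ?thesis using u_eq[OF that] by (simp add: w_def)
  qed
  moreover have "u a = x0" by (simp add: u_def)
  ultimately show ?thesis by blast
qed

text \<open>In the unknowns \<open>S = p + q\<close> and \<open>d = p - q\<close> the equations are
  \<open>d * S = 2 * \<delta>\<close> and \<open>3 * S\<^sup>2 - d\<^sup>2 = 4 * \<sigma>\<close>.
  Eliminating \<open>d\<close> leaves a quadratic equation for \<open>S\<^sup>2\<close>, with
  positive root \<open>2 / 3 * (2 * R + \<sigma>)\<close>.\<close>

lemma hamiltonian_surj:
  assumes "0 \<le> f1" "0 \<le> f2"
  shows "\<exists>p q. 0 \<le> p \<and> 0 \<le> q \<and> hamiltonian p q = f1 \<and> hamiltonian q p = f2"
proof (cases "f1 = 0 \<and> f2 = 0")
  case True
  then show ?thesis by (intro exI[of _ 0]) (simp add: hamiltonian_def)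
next
  case False
  define \<sigma> \<delta> where "\<sigma> = f1 + f2" and "\<delta> = f1 - f2"
  have \<sigma>: "0 < \<sigma>" using False assms by (auto simp: \<sigma>_def)
  define R where "R = sqrt ((\<sigma>\<^sup>2 + 3 * \<delta>\<^sup>2) / 4)"
  have "0 \<le> R" by (simp add: R_def)
  have R2: "R\<^sup>2 = (\<sigma>\<^sup>2 + 3 * \<delta>\<^sup>2) / 4" by (simp add: R_def)
  define S where "S = sqrt (2 / 3 * (2 * R + \<sigma>))"
  have S: "0 < S" using \<open>0 \<le> R\<close> \<sigma> by (simp add: S_def)
  have S2: "S\<^sup>2 = 2 / 3 * (2 * R + \<sigma>)" using \<open>0 \<le> R\<close> \<sigma> by (simp add: S_def)
  define d where "d = 2 * \<delta> / S"
  have dS: "d * S = 2 * \<delta>" using S by (simp add: d_def)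
  define p q where "p = (S + d) / 2" and "q = (S - d) / 2"
  have diff: "hamiltonian p q - hamiltonian q p = \<delta>"
    unfolding hamiltonian_diff using dS by (simp add: p_def q_def field_simps)
  have "hamiltonian p q + hamiltonian q p = (3 * S\<^sup>2 - d\<^sup>2) / 4"
    unfolding hamiltonian_sum by (simp add: p_def q_def field_simps power2_eq_square)
  moreover have "(3 * S\<^sup>2 - d\<^sup>2) / 4 = \<sigma>"
  proof -
    have "(3 * S\<^sup>2 - d\<^sup>2) * S\<^sup>2 = 3 * (S\<^sup>2)\<^sup>2 - (d * S)\<^sup>2"
      by (simp add: power2_eq_square algebra_simps)
    also have "\<dots> = 4 / 3 * (4 * R\<^sup>2 + 4 * R * \<sigma> + \<sigma>\<^sup>2) - 4 * \<delta>\<^sup>2"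
      unfolding S2 dS by (simp add: power2_eq_square algebra_simps)
    also have "\<dots> = 4 * \<sigma> * S\<^sup>2"
      unfolding R2 S2 by (simp add: power2_eq_square algebra_simps)
    finally show ?thesis using S by simp
  qed
  ultimately have sum: "hamiltonian p q + hamiltonian q p = \<sigma>" by simp
  have eq: "hamiltonian p q = f1" "hamiltonian q p = f2"
    using sum diff by (simp_all add: \<sigma>_def \<delta>_def)
  then have "0 \<le> p * q" using assms hamiltonian_nonneg_iff[of p q] by simp
  moreover have "0 < p + q" using S by (simp add: p_def q_def field_simps)
  ultimately have "0 \<le> p" "0 \<le> q" by (auto simp: zero_le_mult_iff)
  then show ?thesis using eq by blast
qed

text \<open>Monotonicity with constant \<open>s / 2\<close> and the Cauchy-Schwarz inequality bound
  the inverse, and \<open>\<epsilon>\<close> keeps \<open>s\<close> at least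
  \<open>sqrt \<epsilon>\<close>. The constant blows up at the origin.\<close>

lemma hamiltonian_inj_lipschitz:
  assumes pq: "0 \<le> p1" "0 \<le> p2" "0 \<le> q1" "0 \<le> q2" and "0 < \<epsilon>"
    and eps: "\<epsilon> \<le> hamiltonian p1 p2 + hamiltonian p2 p1" "\<epsilon> \<le> hamiltonian q1 q2 + hamiltonian q2 q1"
  shows "norm ((p1, p2) - (q1, q2)) \<le> 2 / sqrt \<epsilon> *
    norm ((hamiltonian p1 p2, hamiltonian p2 p1) - (hamiltonian q1 q2, hamiltonian q2 q1))"
proof -
  have sq: "sqrt \<epsilon> \<le> p + q" if "0 \<le> p" "0 \<le> q" "\<epsilon> \<le> hamiltonian p q + hamiltonian q p" for p q
  proof (rule real_le_lsqrt)
    have "hamiltonian p q + hamiltonian q p + (p\<^sup>2 + q\<^sup>2) / 2 = (p + q)\<^sup>2"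
      unfolding hamiltonian_sum by (simp add: power2_eq_square field_simps)
    moreover have "0 \<le> (p\<^sup>2 + q\<^sup>2) / 2" by simp
    ultimately show "\<epsilon> \<le> (p + q)\<^sup>2" using that by linarith
  qed (use that in simp)
  define s where "s = (p1 + p2 + q1 + q2) / 2"
  have s: "sqrt \<epsilon> \<le> s"
    using sq[OF pq(1,2) eps(1)] sq[OF pq(3,4) eps(2)] by (simp add: s_def)
  define D where "D = (p1, p2) - (q1, q2)"
  define H where "H = (hamiltonian p1 p2, hamiltonian p2 p1) - (hamiltonian q1 q2, hamiltonian q2 q1)"
  have "(p1 - q1)\<^sup>2 + (p2 - q2)\<^sup>2 = (norm D)\<^sup>2" by (simp add: D_def norm_Pair)
  then have "s * (norm D)\<^sup>2 / 2 \<le> inner H D"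
    using hamiltonian_monotone[OF pq] by (simp add: s_def D_def H_def)
  also have "\<dots> \<le> norm H * norm D" by (rule norm_cauchy_schwarz)
  finally have 1: "s * (norm D)\<^sup>2 / 2 \<le> norm H * norm D" .
  have "sqrt \<epsilon> * norm D \<le> 2 * norm H"
  proof (cases "norm D = 0")
    case False
    have "sqrt \<epsilon> * (norm D)\<^sup>2 \<le> s * (norm D)\<^sup>2" using s by (intro mult_right_mono) auto
    then have "(sqrt \<epsilon> * norm D) * norm D \<le> (2 * norm H) * norm D"
      using 1 by (simp add: power2_eq_square)
    then show ?thesis using False by (simp add: mult_le_cancel_right)
  qed simp
  then show ?thesis using \<open>0 < \<epsilon>\<close> by (simp add: D_def H_def field_simps)
qed

text \<open>Where \<open>\<phi>\<close> touches the barrier, its derivative pushes it back; above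
  the barrier continuity suffices.\<close>

lemma right_barrier:
  fixes \<phi> :: "real \<Rightarrow> real"
  assumes cont: "continuous_on {b..} \<phi>" and "e \<le> \<phi> b"
    and der: "\<And>t. b \<le> t \<Longrightarrow> \<phi> t = e \<Longrightarrow> \<exists>D>0. (\<phi> has_real_derivative D) (at_right t)"
    and "b \<le> t"
  shows "e \<le> \<phi> t"
proof (rule real_induct_right[of "\<lambda>t. e \<le> \<phi> t" b t])
  fix x assume x: "b \<le> x" "\<And>y. b \<le> y \<Longrightarrow> y \<le> x \<Longrightarrow> e \<le> \<phi> y"
  show "eventually (\<lambda>t. e \<le> \<phi> t) (at_right x)"
  proof (cases "\<phi> x = e")
    case True
    from der[OF x(1) this] obtain D where "D > 0" "(\<phi> has_real_derivative D) (at_right x)" by blast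
    then have "eventually (\<lambda>y. \<phi> x < \<phi> y) (at_right x)"
      using has_real_derivative_right_pos_imp_eventually_greater by blast
    then show ?thesis by (rule eventually_mono) (use True in simp)
  next
    case False
    have "(\<phi> \<longlongrightarrow> \<phi> x) (at x within {b..})" using cont x(1) by (simp add: continuous_on_def)
    then have "(\<phi> \<longlongrightarrow> \<phi> x) (at_right x)" by (rule tendsto_within_subset) (use x in auto)
    then have "eventually (\<lambda>y. e < \<phi> y) (at_right x)"
      by (rule order_tendstoD(1)) (use x(2)[of x] x(1) False in simp)
    then show ?thesis by (rule eventually_mono) simp
  qed
next
  fix x assume x: "b < x" "\<And>y. b \<le> y \<Longrightarrow> y < x \<Longrightarrow> e \<le> \<phi> y"
  have "continuous_on {b..x} \<phi>" using cont by (auto elim: continuous_on_subset)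
  from continuous_on_Icc_at_leftD[OF this x(1)] show "e \<le> \<phi> x"
    by (rule tendsto_lowerbound)
      (auto intro!: eventually_mono[OF eventually_at_left_real[OF x(1)]] x(2))
qed (use assms in auto)

lemma has_real_derivative_glue:
  fixes f g :: "real \<Rightarrow> real"
  assumes "f b = g b" "f' b = g' b"
    and f: "\<And>t. t \<le> b \<Longrightarrow> (f has_real_derivative f' t) (at t)"
    and g: "\<And>t. b \<le> t \<Longrightarrow> (g has_real_derivative g' t) (at t within {b..})"
  shows "((\<lambda>t. if t \<le> b then f t else g t) has_real_derivative (if t \<le> b then f' t else g' t)) (at t)"
    (is "(?u has_real_derivative _) _")
proof (cases t b rule: linorder_cases)
  case less
  have "(?u has_real_derivative f' t) (at t)"
    by (rule has_field_derivative_transform_within_open[OF f, of _ "{..<b}"]) (use less in auto)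
  then show ?thesis using less by simp
next
  case greater
  have "at t within {b..} = at t" by (rule at_within_interior) (use greater in simp)
  then have "(g has_real_derivative g' t) (at t)" using g[of t] greater by simp
  then have "(?u has_real_derivative g' t) (at t)"
    by (rule has_field_derivative_transform_within_open[of _ _ _ "{b<..}"]) (use greater in auto)
  then show ?thesis using greater by simp
next
  case equal
  have "(f has_real_derivative f' b) (at b within {..b})"
    by (rule DERIV_subset[OF f]) auto
  then have "(?u has_real_derivative f' b) (at b within {..b})"
    by (rule has_field_derivative_transform_within[where d = 1]) auto
  then have "(?u has_real_derivative f' b) (at_left b)"
    by (rule DERIV_subset) auto
  moreover have "(?u has_real_derivative f' b) (at b within {b..})"
    by (rule has_field_derivative_transform_within[OF g[of b, folded assms(2)], where d = 1])
      (use assms in auto)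
  then have "(?u has_real_derivative f' b) (at_right b)"
    by (rule DERIV_subset) auto
  ultimately have "(?u has_real_derivative f' b) (at b)"
    unfolding has_field_derivative_iff by (rule filterlim_split_at)
  then show ?thesis using equal by simp
qed

context monotone_costs
begin

lemma M: "m \<le> M" "0 < M"
  using c m by auto

text \<open>Up to \<open>a - 1\<close>, \<open>h - u\<close> is constant, equal to the Hamiltonians
  of \<open>(c1, c2)\<close>. Beyond, \<open>h - u\<close> cannot leave the box \<open>[\<epsilon>, X]\<^sup>2\<close>: on its lower faces the corresponding
  slope is smaller than \<open>m\<close>, on its upper faces it is larger than \<open>M\<close>. Inside the box the inverse
  of the Hamiltonian map is Lipschitz, and \<open>cl\<close> extends it globally.\<close>

theorem classical_solution:
  obtains u1 u2 p1 p2 P L where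
    "\<And>y. (u1 has_real_derivative p1 y) (at y)" "\<And>y. (u2 has_real_derivative p2 y) (at y)"
    "\<And>y. hamiltonian (p1 y) (p2 y) = h1 y - u1 y" "\<And>y. hamiltonian (p2 y) (p1 y) = h2 y - u2 y"
    "\<And>y. 0 \<le> p1 y \<and> p1 y \<le> P" "\<And>y. 0 \<le> p2 y \<and> p2 y \<le> P"
    "\<And>x y. \<bar>p1 x - p1 y\<bar> \<le> L * \<bar>x - y\<bar>" "\<And>x y. \<bar>p2 x - p2 y\<bar> \<le> L * \<bar>x - y\<bar>"
proof -
  \<comment> \<open>On a lower face \<open>p\<^sup>2 / 2 \<le> \<epsilon>\<close> gives
    \<open>p \<le> m / 2\<close>. In the box slopes are at most \<open>4 * M\<close>, so
    \<open>p \<le> M\<close> would keep the Hamiltonian below \<open>5 * M\<^sup>2\<close>, hence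
    off the upper face.\<close>
  define \<epsilon> X where "\<epsilon> = m\<^sup>2 / 8" and "X = 8 * M\<^sup>2"
  have "m\<^sup>2 \<le> M\<^sup>2" using M m by (intro power_mono) auto
  then have "1 * m\<^sup>2 \<le> 64 * M\<^sup>2" by (intro mult_mono) auto
  then have \<epsilon>: "0 < \<epsilon>" and \<epsilon>X: "\<epsilon> \<le> X" using m unfolding \<epsilon>_def X_def by simp_all
  have le_4M: "p \<le> 4 * M" if "0 \<le> p" "0 \<le> q" "hamiltonian p q \<le> X" for p q
  proof (rule power2_le_imp_le)
    have "p\<^sup>2 / 2 \<le> hamiltonian p q" using that(1,2) by (simp add: hamiltonian_def)
    then show "p\<^sup>2 \<le> (4 * M)\<^sup>2" using that(3) by (simp add: X_def power_mult_distrib)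
  qed (use M in simp)
  have less_m: "p < m" if "0 \<le> p" "0 \<le> q" "hamiltonian p q = \<epsilon>" for p q
  proof (rule power2_less_imp_less)
    have "p\<^sup>2 / 2 \<le> hamiltonian p q" using that(1,2) by (simp add: hamiltonian_def)
    then have "p\<^sup>2 \<le> m\<^sup>2 / 4" using that(3) by (simp add: \<epsilon>_def)
    also have "\<dots> < m\<^sup>2" using m by simp
    finally show "p\<^sup>2 < m\<^sup>2" .
  qed (use m in simp)
  have greater_M: "M < p" if "0 \<le> p" "0 \<le> q" "hamiltonian p q = X" "hamiltonian q p \<le> X" for p q
  proof (rule ccontr)
    assume "\<not> M < p"
    then have "p * q \<le> M * (4 * M)" "p\<^sup>2 \<le> M\<^sup>2"
      using that le_4M[OF that(2,1,4)] by (auto intro!: mult_mono power_mono)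
    then have "hamiltonian p q \<le> M * (4 * M) + M\<^sup>2 / 2" by (simp add: hamiltonian_def)
    moreover have "M * (4 * M) + M\<^sup>2 / 2 < X" using M by (simp add: X_def power2_eq_square)
    ultimately show False using that(3) by simp
  qed
  obtain P1 P2 where inv: "\<And>f1 f2. 0 \<le> f1 \<Longrightarrow> 0 \<le> f2 \<Longrightarrow> 0 \<le> P1 f1 f2 \<and> 0 \<le> P2 f1 f2 \<and>
      hamiltonian (P1 f1 f2) (P2 f1 f2) = f1 \<and> hamiltonian (P2 f1 f2) (P1 f1 f2) = f2"
    using hamiltonian_surj by metis
  define cl where "cl r = max \<epsilon> (min X r)" for r
  have cl: "\<epsilon> \<le> cl r" "cl r \<le> X" "\<epsilon> \<le> r \<Longrightarrow> r \<le> X \<Longrightarrow> cl r = r" "\<bar>cl r - cl s\<bar> \<le> \<bar>r - s\<bar>" for r s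
    using \<epsilon>X by (auto simp: cl_def)
  define Z where "Z z = (P1 (cl (fst z)) (cl (snd z)), P2 (cl (fst z)) (cl (snd z)))" for z
  have Z: "0 \<le> fst (Z z)" "0 \<le> snd (Z z)" "hamiltonian (fst (Z z)) (snd (Z z)) = cl (fst z)"
    "hamiltonian (snd (Z z)) (fst (Z z)) = cl (snd z)" for z
    using inv[of "cl (fst z)" "cl (snd z)"] cl(1)[of "fst z"] cl(1)[of "snd z"] \<epsilon> by (auto simp: Z_def)
  have Z_le: "fst (Z z) \<le> 4 * M" "snd (Z z) \<le> 4 * M" for z
    using le_4M[OF Z(1,2)[of z]] le_4M[OF Z(2,1)[of z]] by (simp_all add: Z(3,4) cl(2))
  define K where "K = 2 / sqrt \<epsilon>"
  have K: "0 < K" using \<epsilon> by (simp add: K_def)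
  have Z_lip: "norm (Z z - Z z') \<le> K * norm (z - z')" for z z'
  proof -
    have "norm ((fst (Z z), snd (Z z)) - (fst (Z z'), snd (Z z')))
      \<le> 2 / sqrt \<epsilon> * norm ((cl (fst z), cl (snd z)) - (cl (fst z'), cl (snd z')))"
    proof -
      have "\<epsilon> \<le> cl r + cl s" for r s using cl(1)[of r] cl(1)[of s] \<epsilon> by linarith
      then show ?thesis
        using hamiltonian_inj_lipschitz[OF Z(1,2)[of z] Z(1,2)[of z'] \<epsilon>] unfolding Z(3,4) by blast
    qed
    moreover have "norm ((cl (fst z), cl (snd z)) - (cl (fst z'), cl (snd z'))) \<le> norm (z - z')"
      by (cases z; cases z') (auto simp: norm_Pair intro!: add_mono real_sqrt_le_mono abs_le_square_iff[THEN iffD1] cl(4))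
    ultimately have "norm ((fst (Z z), snd (Z z)) - (fst (Z z'), snd (Z z'))) \<le> K * norm (z - z')"
      using K unfolding K_def by (meson less_imp_le mult_left_mono order_trans)
    then show ?thesis by simp
  qed
  have "K-lipschitz_on UNIV Z"
    by (rule lipschitz_onI) (use Z_lip K in \<open>auto simp: dist_norm\<close>)
  then have Z_cont: "continuous_on UNIV Z" by (rule lipschitz_on_continuous_on)
  define g where "g t w = Z (h1 t - fst w, h2 t - snd w)" for t w
  \<comment> \<open>\<open>h_half_line\<close> holds strictly to the left of \<open>a\<close>, and
    the two-sided derivative is needed at \<open>b\<close> too.\<close>
  define b where "b = a - 1"
  define H1 H2 where "H1 = hamiltonian c1 c2" and "H2 = hamiltonian c2 c1"
  have H_bounds: "\<epsilon> \<le> hamiltonian p q \<and> hamiltonian p q \<le> X" if "m \<le> p" "p \<le> M" "m \<le> q" "q \<le> M" for p q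
  proof -
    have "m\<^sup>2 \<le> p\<^sup>2" "p\<^sup>2 \<le> M\<^sup>2" "0 \<le> p * q" "p * q \<le> M\<^sup>2"
      using that m by (auto simp: power2_eq_square intro!: mult_mono)
    moreover have "0 < M\<^sup>2" "0 < m\<^sup>2" using M m by auto
    ultimately show ?thesis
      unfolding \<epsilon>_def X_def hamiltonian_def by linarith
  qed
  have H: "\<epsilon> \<le> H1" "H1 \<le> X" "\<epsilon> \<le> H2" "H2 \<le> X"
    using H_bounds c by (auto simp: H1_def H2_def)
  have "\<exists>w. w b = (h1 b - H1, h2 b - H2) \<and> (\<forall>t\<ge>b. (w has_vector_derivative g t (w t)) (at t within {b..}))"
  proof (rule global_lipschitz_ode[of g K "8 * M"])
    show "continuous_on UNIV (\<lambda>(t, w). g t w)"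
      unfolding g_def split_def
      by (intro continuous_on_compose2[OF Z_cont] continuous_intros
          continuous_on_compose2[OF h_cont(1)] continuous_on_compose2[OF h_cont(2)]) auto
    show "norm (g t v - g t w) \<le> K * norm (v - w)" for t v w
    proof -
      have "norm (g t v - g t w) \<le> K * norm ((h1 t - fst v, h2 t - snd v) - (h1 t - fst w, h2 t - snd w))"
        unfolding g_def by (rule Z_lip)
      also have "(h1 t - fst v, h2 t - snd v) - (h1 t - fst w, h2 t - snd w) = w - v"
        by (simp add: prod_eq_iff)
      finally show ?thesis by (simp add: norm_minus_commute)
    qed
    show "norm (g t w) \<le> 8 * M" for t w
      using norm_Pair_le[of "fst (g t w)" "snd (g t w)"] Z(1,2) Z_le unfolding g_def
      by (smt (verit) prod.collapse real_norm_def)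
  qed (fact K)
  then obtain w where wb: "w b = (h1 b - H1, h2 b - H2)"
    and w: "\<And>t. b \<le> t \<Longrightarrow> (w has_vector_derivative g t (w t)) (at t within {b..})" by blast
  define q1 q2 where "q1 t = fst (g t (w t))" and "q2 t = snd (g t (w t))" for t
  have w1: "((\<lambda>t. fst (w t)) has_real_derivative q1 t) (at t within {b..})"
    and w2: "((\<lambda>t. snd (w t)) has_real_derivative q2 t) (at t within {b..})" if "b \<le> t" for t
    unfolding has_real_derivative_iff_has_vector_derivative q1_def q2_def
    using bounded_linear.has_vector_derivative[OF bounded_linear_fst w[OF that]]
      bounded_linear.has_vector_derivative[OF bounded_linear_snd w[OF that]] by auto
  define F1 F2 where "F1 t = h1 t - fst (w t)" and "F2 t = h2 t - snd (w t)" for t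
  have F_cont: "continuous_on {b..} F1" "continuous_on {b..} F2"
  proof -
    have "continuous_on {b..} (\<lambda>t. fst (w t))" "continuous_on {b..} (\<lambda>t. snd (w t))"
      unfolding continuous_on_eq_continuous_within using w1 w2 by (auto intro: DERIV_continuous)
    moreover have "continuous_on {b..} h1" "continuous_on {b..} h2"
      using h_cont by (auto elim: continuous_on_subset)
    ultimately show "continuous_on {b..} F1" "continuous_on {b..} F2"
      unfolding F1_def F2_def by (auto intro: continuous_on_diff)
  qed
  have ham_q: "hamiltonian (q1 t) (q2 t) = cl (F1 t)" "hamiltonian (q2 t) (q1 t) = cl (F2 t)"
    "0 \<le> q1 t" "0 \<le> q2 t" for t
    using Z by (simp_all add: q1_def q2_def g_def F1_def F2_def)
  have F_right: "\<exists>k. m \<le> k \<and> k \<le> M \<and> (F1 has_real_derivative k - q1 t) (at_right t)"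
    "\<exists>k. m \<le> k \<and> k \<le> M \<and> (F2 has_real_derivative k - q2 t) (at_right t)" if "b \<le> t" for t
  proof -
    have "((\<lambda>t. fst (w t)) has_real_derivative q1 t) (at_right t)"
      "((\<lambda>t. snd (w t)) has_real_derivative q2 t) (at_right t)"
      using that by (auto intro: DERIV_subset[OF w1] DERIV_subset[OF w2])
    note w' = this
    obtain k1 k2 where k: "m \<le> k1" "k1 \<le> M" "(h1 has_real_derivative k1) (at_right t)"
      "m \<le> k2" "k2 \<le> M" "(h2 has_real_derivative k2) (at_right t)"
      using h_right[of t] by blast
    show "\<exists>k. m \<le> k \<and> k \<le> M \<and> (F1 has_real_derivative k - q1 t) (at_right t)"
      using k(1,2) DERIV_diff[OF k(3) w'(1)] unfolding F1_def by blast
    show "\<exists>k. m \<le> k \<and> k \<le> M \<and> (F2 has_real_derivative k - q2 t) (at_right t)"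
      using k(4,5) DERIV_diff[OF k(6) w'(2)] unfolding F2_def by blast
  qed
  have F_lower: "\<epsilon> \<le> F1 t" "\<epsilon> \<le> F2 t" if "b \<le> t" for t
  proof -
    have *: "\<exists>D>0. (F1 has_real_derivative D) (at_right t)" if "b \<le> t" "F1 t = \<epsilon>" for t
    proof -
      have "q1 t < m" using less_m[OF ham_q(3,4)[of t]] ham_q(1)[of t] that(2) cl(3)[of \<epsilon>] \<epsilon>X by simp
      then show ?thesis using F_right(1)[OF that(1)] by (metis diff_gt_0_iff_gt order_less_le_trans)
    qed
    have **: "\<exists>D>0. (F2 has_real_derivative D) (at_right t)" if "b \<le> t" "F2 t = \<epsilon>" for t
    proof -
      have "q2 t < m" using less_m[OF ham_q(4,3)[of t]] ham_q(2)[of t] that(2) cl(3)[of \<epsilon>] \<epsilon>X by simp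
      then show ?thesis using F_right(2)[OF that(1)] by (metis diff_gt_0_iff_gt order_less_le_trans)
    qed
    show "\<epsilon> \<le> F1 t" "\<epsilon> \<le> F2 t"
      using right_barrier[OF F_cont(1) _ * that] right_barrier[OF F_cont(2) _ ** that] H
      by (simp_all add: F1_def F2_def wb)
  qed
  have F_upper: "F1 t \<le> X" "F2 t \<le> X" if "b \<le> t" for t
  proof -
    have *: "\<exists>D>0. ((\<lambda>t. - F1 t) has_real_derivative D) (at_right t)" if t: "b \<le> t" "- F1 t = - X" for t
    proof -
      have "M < q1 t" using greater_M[OF ham_q(3,4)[of t]] ham_q(1,2)[of t] that(2) cl(2) cl(3)[of X] \<epsilon>X by simp
      moreover obtain k where k: "k \<le> M" "(F1 has_real_derivative k - q1 t) (at_right t)"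
        using F_right(1)[OF t(1)] by blast
      ultimately show ?thesis using DERIV_minus[OF k(2)] by (intro exI[of _ "- (k - q1 t)"]) auto
    qed
    have **: "\<exists>D>0. ((\<lambda>t. - F2 t) has_real_derivative D) (at_right t)" if t: "b \<le> t" "- F2 t = - X" for t
    proof -
      have "M < q2 t" using greater_M[OF ham_q(4,3)[of t]] ham_q(1,2)[of t] that(2) cl(2) cl(3)[of X] \<epsilon>X by simp
      moreover obtain k where k: "k \<le> M" "(F2 has_real_derivative k - q2 t) (at_right t)"
        using F_right(2)[OF t(1)] by blast
      ultimately show ?thesis using DERIV_minus[OF k(2)] by (intro exI[of _ "- (k - q2 t)"]) auto
    qed
    have "- X \<le> - F1 t" "- X \<le> - F2 t"
      using right_barrier[OF continuous_on_minus[OF F_cont(1)] _ * that]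
        right_barrier[OF continuous_on_minus[OF F_cont(2)] _ ** that] H
      by (simp_all add: F1_def F2_def wb)
    then show "F1 t \<le> X" "F2 t \<le> X" by simp_all
  qed
  \<comment> \<open>As \<open>F1\<close> and \<open>F2\<close> stay in the box, \<open>cl\<close>
    drops out and the truncated equation becomes the original system.\<close>
  have F_eq: "hamiltonian (q1 t) (q2 t) = F1 t" "hamiltonian (q2 t) (q1 t) = F2 t" if "b \<le> t" for t
    using ham_q(1,2)[of t] cl(3) F_lower[OF that] F_upper[OF that] by auto
  \<comment> \<open>Equal Hamiltonians leave only a sign, which nonnegativity fixes; so the slopes
    match at the junction.\<close>
  have qb: "q1 b = c1" "q2 b = c2"
  proof -
    have "hamiltonian (q1 b) (q2 b) = hamiltonian c1 c2" "hamiltonian (q2 b) (q1 b) = hamiltonian c2 c1"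
      using F_eq[of b] by (simp_all add: F1_def F2_def wb H1_def H2_def)
    from hamiltonian_eq_imp[OF this] show "q1 b = c1" "q2 b = c2"
      using ham_q(3,4)[of b] m c by auto
  qed
  define u1 u2 where "u1 t = (if t \<le> b then h1 t - H1 else fst (w t))"
    and "u2 t = (if t \<le> b then h2 t - H2 else snd (w t))" for t
  define p1 p2 where "p1 t = (if t \<le> b then c1 else q1 t)" and "p2 t = (if t \<le> b then c2 else q2 t)" for t
  have u1: "(u1 has_real_derivative p1 t) (at t)" for t
    unfolding u1_def p1_def
  proof (rule has_real_derivative_glue)
    show "((\<lambda>t. h1 t - H1) has_real_derivative c1) (at t)" if "t \<le> b" for t
      using DERIV_diff[OF h_half_line(1)[of t] DERIV_const[of H1]] that by (simp add: b_def)
  qed (use wb qb w1 in auto)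
  have u2: "(u2 has_real_derivative p2 t) (at t)" for t
    unfolding u2_def p2_def
  proof (rule has_real_derivative_glue)
    show "((\<lambda>t. h2 t - H2) has_real_derivative c2) (at t)" if "t \<le> b" for t
      using DERIV_diff[OF h_half_line(2)[of t] DERIV_const[of H2]] that by (simp add: b_def)
  qed (use wb qb w2 in auto)
  have ham: "hamiltonian (p1 t) (p2 t) = h1 t - u1 t" "hamiltonian (p2 t) (p1 t) = h2 t - u2 t" for t
    using F_eq[of t] by (auto simp: p1_def p2_def u1_def u2_def H1_def H2_def F1_def F2_def)
  have bounds: "\<epsilon> \<le> h1 t - u1 t" "\<epsilon> \<le> h2 t - u2 t" for t
    using F_lower[of t] H by (auto simp: u1_def u2_def F1_def F2_def)
  have p: "0 \<le> p1 t \<and> p1 t \<le> 4 * M" "0 \<le> p2 t \<and> p2 t \<le> 4 * M" for t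
    using ham_q(3,4)[of t] Z_le c m M by (auto simp: p1_def p2_def q1_def q2_def g_def)
  have lip_u: "\<bar>u1 x - u1 y\<bar> \<le> 4 * M * \<bar>x - y\<bar>" "\<bar>u2 x - u2 y\<bar> \<le> 4 * M * \<bar>x - y\<bar>" for x y
    using field_differentiable_bound[of UNIV u1 p1 "4 * M" x y] field_differentiable_bound[of UNIV u2 p2 "4 * M" x y]
      u1 u2 p by auto
  \<comment> \<open>Each component of \<open>h - u\<close> has Lipschitz constant
    \<open>5 * M\<close>, from \<open>M\<close> for \<open>h\<close> and \<open>4 * M\<close> for
    \<open>u\<close>; \<open>K\<close> is the constant of the inverse.\<close>
  define L where "L = K * (2 * (5 * M))"
  have lip: "norm ((p1 x, p2 x) - (p1 y, p2 y)) \<le> L * \<bar>x - y\<bar>" for x y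
  proof -
    have "norm ((p1 x, p2 x) - (p1 y, p2 y)) \<le> K * norm ((h1 x - u1 x, h2 x - u2 x) - (h1 y - u1 y, h2 y - u2 y))"
      using hamiltonian_inj_lipschitz[of "p1 x" "p2 x" "p1 y" "p2 y" \<epsilon>] p[of x] p[of y] \<epsilon>
        bounds[of x] bounds[of y] unfolding ham K_def by force
    moreover have "norm ((h1 x - u1 x, h2 x - u2 x) - (h1 y - u1 y, h2 y - u2 y))
      \<le> \<bar>(h1 x - h1 y) - (u1 x - u1 y)\<bar> + \<bar>(h2 x - h2 y) - (u2 x - u2 y)\<bar>"
      using norm_Pair_le[of "h1 x - u1 x - (h1 y - u1 y)" "h2 x - u2 x - (h2 y - u2 y)"]
      by (simp add: algebra_simps)
    moreover have "\<bar>(h1 x - h1 y) - (u1 x - u1 y)\<bar> + \<bar>(h2 x - h2 y) - (u2 x - u2 y)\<bar> \<le> 2 * (5 * M) * \<bar>x - y\<bar>"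
      using lip_u[of x y] h1_lipschitz[of x y] h2_lipschitz[of x y] by linarith
    ultimately show ?thesis
      using K unfolding L_def mult.assoc[of K] by (meson less_imp_le mult_left_mono order_trans)
  qed
  have "\<bar>p1 x - p1 y\<bar> \<le> L * \<bar>x - y\<bar>" "\<bar>p2 x - p2 y\<bar> \<le> L * \<bar>x - y\<bar>" for x y
    using lip[of x y] norm_fst_le[of "p1 x - p1 y" "p2 x - p2 y"] norm_snd_le[of "p2 x - p2 y" "p1 x - p1 y"]
    by auto
  with u1 u2 ham p show thesis by (rule that)
qed

end

section \<open>Verification of the feedback strategies\<close>

lemma caratheodory_solution_lipschitz:
  assumes x: "caratheodory_solution g y x" and bound: "\<And>t. 0 \<le> t \<Longrightarrow> \<bar>g t (x t)\<bar> \<le> B"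
    and st: "0 \<le> s" "0 \<le> t"
  shows "\<bar>x t - x s\<bar> \<le> B * \<bar>t - s\<bar>"
proof -
  have "0 \<le> B" using bound[of 0] by simp
  have *: "\<bar>x t - x s\<bar> \<le> B * (t - s)" if "0 \<le> s" "s \<le> t" for s t
  proof -
    have "norm (x t - x s - (t - s) *\<^sub>R 0) \<le> B * (t - s)"
    proof (rule abs_continuous_on_norm_diff_le[OF \<open>s \<le> t\<close> \<open>0 \<le> B\<close>])
      show "abs_continuous_on s t x"
        using x that unfolding caratheodory_solution_def
        by (auto intro: abs_continuous_on_subinterval[of 0 t])
      have "AE t in lebesgue. t > 0 \<longrightarrow> (x has_real_derivative g t (x t)) (at t)"
        using x by (simp add: caratheodory_solution_def)
      then show "AE r in lebesgue. r \<in> {s<..<t} \<longrightarrow> (\<exists>D. (x has_vector_derivative D) (at r) \<and> norm (D - 0) \<le> B)"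
        by eventually_elim
          (use that bound in \<open>auto simp: has_real_derivative_iff_has_vector_derivative\<close>)
    qed
    then show ?thesis by simp
  qed
  show ?thesis using *[of s t] *[of t s] st by (cases "s \<le> t") (auto simp: abs_minus_commute)
qed

text \<open>Half of the discount absorbs the growth, since
  \<open>1 + t \<le> 2 * exp (t / 2)\<close>; the other half remains integrable.\<close>

lemma absolutely_integrable_discounted:
  fixes f :: "real \<Rightarrow> real"
  assumes meas: "f \<in> borel_measurable (lebesgue_on {0..})"
    and bound: "\<And>t. 0 \<le> t \<Longrightarrow> \<bar>f t\<bar> \<le> K * (1 + t)"
  shows "(\<lambda>t. exp (- t) * f t) absolutely_integrable_on {0..}"
proof (rule measurable_bounded_by_integrable_imp_absolutely_integrable)
  have "(\<lambda>t::real. exp (- t)) \<in> borel_measurable (lebesgue_on {0..})"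
    by (intro continuous_imp_measurable_on_sets_lebesgue continuous_intros) auto
  then show "(\<lambda>t. exp (- t) * f t) \<in> borel_measurable (lebesgue_on {0..})"
    using meas by (rule borel_measurable_times)
  have "(\<lambda>t::real. exp (- (1 / 2) * t)) integrable_on {0..}"
    using has_integral_exp_minus_to_infinity[of "1 / 2" 0] by (intro has_integral_integrable) auto
  then show "(\<lambda>t. 2 * K * exp (- (1 / 2) * t)) integrable_on {0..}"
    by (rule integrable_on_mult_right)
  fix t :: real assume t: "t \<in> {0..}"
  have "0 \<le> K" using bound[of 0] by simp
  have "1 + t / 2 \<le> exp (t / 2)" by (rule exp_ge_add_one_self)
  then have "K * (1 + t) \<le> K * (2 * exp (t / 2))"
    using \<open>0 \<le> K\<close> by (intro mult_left_mono) linarith+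
  then have "\<bar>f t\<bar> \<le> 2 * K * exp (t / 2)" using bound[of t] t by simp
  then have "exp (- t) * \<bar>f t\<bar> \<le> exp (- t) * (2 * K * exp (t / 2))" by (intro mult_left_mono) auto
  also have "\<dots> = 2 * K * exp (- (1 / 2) * t)" by (simp flip: exp_add)
  finally show "norm (exp (- t) * f t) \<le> 2 * K * exp (- (1 / 2) * t)" by (simp add: abs_mult)
qed auto

text \<open>Completion of the square: by \<open>hjb\<close>, the derivative of
  \<open>exp (- t) * u (x t)\<close> plus the running cost is
  \<open>exp (- t) * ((p (x t) + \<alpha> t)\<^sup>2 / 2)\<close>, which is nonnegative and vanishes
  for \<open>\<alpha> t = - p (x t)\<close>.\<close>

theorem verification:
  fixes h u p b \<alpha> x :: "real \<Rightarrow> real"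
  assumes h_lip: "\<And>x y. \<bar>h x - h y\<bar> \<le> M * \<bar>x - y\<bar>"
    and u: "\<And>y. (u has_real_derivative p y) (at y)" and p: "\<And>y. \<bar>p y\<bar> \<le> P"
    and b: "\<And>y. \<bar>b y\<bar> \<le> P" and hjb: "\<And>y. u y = h y + p y * b y - (p y)\<^sup>2 / 2"
    and x: "caratheodory_solution (\<lambda>t z. \<alpha> t + b z) y x"
    and \<alpha>: "\<alpha> \<in> borel_measurable (lebesgue_on {0..})" "\<And>t. 0 \<le> t \<Longrightarrow> \<bar>\<alpha> t\<bar> \<le> A"
  shows "\<exists>c. has_cost h \<alpha> x c \<and> u y \<le> c \<and> ((\<forall>t\<ge>0. \<alpha> t = - p (x t)) \<longrightarrow> c = u y)"
proof -
  define B where "B = A + P"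
  have P: "0 \<le> P" and A: "0 \<le> A" using p[of 0] \<alpha>(2)[of 0] by auto
  then have B: "0 \<le> B" by (simp add: B_def)
  have M: "0 \<le> M" using h_lip[of 1 0] by simp
  have x0: "x 0 = y" using x by (simp add: caratheodory_solution_def)
  have x_lip: "\<bar>x t - x s\<bar> \<le> B * \<bar>t - s\<bar>" if "0 \<le> s" "0 \<le> t" for s t
  proof (rule caratheodory_solution_lipschitz[OF x _ that])
    show "\<bar>\<alpha> t + b (x t)\<bar> \<le> B" if "0 \<le> t" for t
      using \<alpha>(2)[OF that] b[of "x t"] by (simp add: B_def)
  qed
  have u_lip: "\<bar>u s - u t\<bar> \<le> P * \<bar>s - t\<bar>" for s t
    using field_differentiable_bound[of UNIV u p P s t] u p by auto
  have "M-lipschitz_on UNIV h" "B-lipschitz_on {0..} x"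
    using h_lip M x_lip B by (auto intro!: lipschitz_onI simp: dist_real_def)
  then have h_cont: "continuous_on UNIV h" and x_cont: "continuous_on {0..} x"
    by (auto intro: lipschitz_on_continuous_on)
  define f where "f t = h (x t) + (\<alpha> t)\<^sup>2 / 2" for t
  have f_meas: "f \<in> borel_measurable (lebesgue_on {0..})"
  proof -
    have "(\<lambda>t. h (x t)) \<in> borel_measurable (lebesgue_on {0..})"
      by (intro continuous_imp_measurable_on_sets_lebesgue continuous_on_compose2[OF h_cont x_cont]) auto
    then show ?thesis
      unfolding f_def using \<alpha>(1) by (intro borel_measurable_add borel_measurable_divide borel_measurable_power) auto
  qed
  have f_bound: "\<bar>f t\<bar> \<le> (\<bar>h y\<bar> + M * B + A\<^sup>2) * (1 + t)" if "0 \<le> t" for t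
  proof -
    have "\<bar>h (x t) - h y\<bar> \<le> M * \<bar>x t - y\<bar>" by (rule h_lip)
    also have "\<dots> \<le> M * (B * t)" using x_lip[of 0 t] that x0 M by (intro mult_left_mono) auto
    finally have h: "\<bar>h (x t)\<bar> \<le> \<bar>h y\<bar> + M * (B * t)" by linarith
    have "\<bar>(\<alpha> t)\<^sup>2 / 2\<bar> \<le> (\<alpha> t)\<^sup>2" by simp
    also have "\<dots> \<le> A\<^sup>2" using \<alpha>(2)[OF that] by (metis abs_ge_zero power2_abs power_mono)
    finally have "\<bar>f t\<bar> \<le> \<bar>h y\<bar> + M * (B * t) + A\<^sup>2" using h unfolding f_def by linarith
    also have "\<dots> \<le> \<bar>h y\<bar> + M * (B * t) + A\<^sup>2 + (\<bar>h y\<bar> * t + M * B + A\<^sup>2 * t)"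
      using that M B by simp
    also have "\<dots> = (\<bar>h y\<bar> + M * B + A\<^sup>2) * (1 + t)" by (simp add: algebra_simps)
    finally show ?thesis .
  qed
  define c where "c t = exp (- t) * f t" for t
  have c_int: "c absolutely_integrable_on {0..}"
    unfolding c_def by (rule absolutely_integrable_discounted[OF f_meas f_bound])
  then have c_leb: "integrable (lebesgue_on {0..}) c"
    by (rule absolutely_integrable_imp_integrable) auto
  have cost: "has_cost h \<alpha> x (integral {0..} c)"
    using has_bochner_integral_integrable[OF c_leb] lebesgue_integral_eq_integral[OF c_leb]
    by (simp add: has_cost_def c_def[abs_def] f_def)
  have c_on: "c integrable_on {0..T}" for T
    by (rule integrable_on_subinterval[OF set_lebesgue_integral_eq_integral(1)[OF c_int]]) auto
  have c_lim: "((\<lambda>T. integral {0..T} c) \<longlongrightarrow> integral {0..} c) at_top"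
  proof -
    have "((\<lambda>T. set_lebesgue_integral lebesgue {0..T} c) \<longlongrightarrow> set_lebesgue_integral lebesgue {0..} c) at_top"
      by (rule tendsto_set_lebesgue_integral_at_top[OF _ c_int]) auto
    moreover have "set_lebesgue_integral lebesgue {0..T} c = integral {0..T} c" for T
      by (rule set_lebesgue_integral_eq_integral(2)[OF set_integrable_subset[OF c_int]]) auto
    ultimately show ?thesis using set_lebesgue_integral_eq_integral(2)[OF c_int] by simp
  qed
  define V where "V t = exp (- t) * u (x t)" for t
  define v where "v t = exp (- t) * (p (x t) * (\<alpha> t + b (x t)) - u (x t))" for t
  have vc: "v t + c t = exp (- t) * ((p (x t) + \<alpha> t)\<^sup>2 / 2)" for t
    unfolding v_def c_def f_def distrib_left[symmetric] hjb[of "x t"]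
    by (simp add: power2_eq_square field_simps)
  have V_int: "(v has_integral (V T - V 0)) {0..T}" if "0 \<le> T" for T
  proof -
    have u_bound: "\<bar>u (x t)\<bar> \<le> \<bar>u y\<bar> + P * (B * T)" if "t \<in> {0..T}" for t
    proof -
      have "\<bar>u (x t) - u y\<bar> \<le> P * \<bar>x t - y\<bar>" by (rule u_lip)
      also have "\<dots> \<le> P * (B * t)" using x_lip[of 0 t] that x0 P by (intro mult_left_mono) auto
      also have "\<dots> \<le> P * (B * T)" using that P B by (intro mult_left_mono) auto
      finally show ?thesis by linarith
    qed
    have exp_lip: "\<bar>exp (- t) - exp (- s)\<bar> \<le> 1 * \<bar>t - s\<bar>" if "0 \<le> s" "0 \<le> t" for s t :: real
    proof -
      have "((\<lambda>t. exp (- t)) has_real_derivative - exp (- z)) (at z within {0..})" for z :: real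
        by (auto intro!: derivative_eq_intros)
      then show ?thesis
        using field_differentiable_bound[of "{0..}" "\<lambda>t::real. exp (- t)" "\<lambda>t. - exp (- t)" 1 t s] that
        by auto
    qed
    \<comment> \<open>A Lipschitz constant of \<open>V\<close> on \<open>[0, T]\<close>: the first
      term comes from \<open>u\<close> along the trajectory, the second from the discount.\<close>
    define W where "W = P * B + (\<bar>u y\<bar> + P * (B * T))"
    have "norm (V t - V s) \<le> W * \<bar>t - s\<bar>" if st: "t \<in> {0..T}" "s \<in> {0..T}" for s t
    proof -
      have "V t - V s = exp (- t) * (u (x t) - u (x s)) + u (x s) * (exp (- t) - exp (- s))"
        by (simp add: V_def algebra_simps)
      then have "norm (V t - V s) \<le> exp (- t) * \<bar>u (x t) - u (x s)\<bar> + \<bar>u (x s)\<bar> * \<bar>exp (- t) - exp (- s)\<bar>"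
        by (metis abs_exp_cancel abs_mult abs_triangle_ineq real_norm_def)
      also have "\<dots> \<le> 1 * (P * (B * \<bar>t - s\<bar>)) + (\<bar>u y\<bar> + P * (B * T)) * (1 * \<bar>t - s\<bar>)"
      proof (intro add_mono mult_mono u_bound st exp_lip)
        have "\<bar>u (x t) - u (x s)\<bar> \<le> P * \<bar>x t - x s\<bar>" by (rule u_lip)
        also have "\<dots> \<le> P * (B * \<bar>t - s\<bar>)" using x_lip[of s t] st P by (intro mult_left_mono) auto
        finally show "\<bar>u (x t) - u (x s)\<bar> \<le> P * (B * \<bar>t - s\<bar>)" .
      qed (use st P B \<open>0 \<le> T\<close> in auto)
      also have "\<dots> = W * \<bar>t - s\<bar>" by (simp add: W_def algebra_simps)
      finally show ?thesis .
    qed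
    then have ac: "abs_continuous_on 0 T V" by (rule abs_continuous_on_lipschitz)
    have "AE t in lebesgue. t > 0 \<longrightarrow> (x has_real_derivative \<alpha> t + b (x t)) (at t)"
      using x by (simp add: caratheodory_solution_def)
    then obtain N where N: "N \<in> null_sets lebesgue"
      "{t \<in> space lebesgue. \<not> (t > 0 \<longrightarrow> (x has_real_derivative \<alpha> t + b (x t)) (at t))} \<subseteq> N"
      unfolding eventually_ae_filter by blast
    show ?thesis
    proof (rule abs_continuous_on_fundamental_theorem[OF \<open>0 \<le> T\<close> ac, of "insert 0 N"])
      show "negligible (insert 0 N)" using N(1) by (simp add: negligible_iff_null_sets[symmetric])
      fix t assume t: "t \<in> {0..T} - insert 0 N"
      then have "0 < t" "t \<notin> N" by auto
      then have "(x has_real_derivative \<alpha> t + b (x t)) (at t)" using N(2) by auto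
      then have "((\<lambda>t. u (x t)) has_real_derivative p (x t) * (\<alpha> t + b (x t))) (at t)"
        by (rule DERIV_chain2[OF u])
      moreover have "((\<lambda>t. exp (- t)) has_real_derivative - exp (- t)) (at t)"
        by (auto intro!: derivative_eq_intros)
      ultimately have "(V has_real_derivative - exp (- t) * u (x t) + p (x t) * (\<alpha> t + b (x t)) * exp (- t)) (at t)"
        unfolding V_def by (rule DERIV_mult[rotated])
      then show "(V has_vector_derivative v t) (at t)"
        unfolding has_real_derivative_iff_has_vector_derivative[symmetric]
        by (simp add: v_def algebra_simps)
    qed
  qed
  have vc_int: "((\<lambda>t. v t + c t) has_integral (V T - V 0 + integral {0..T} c)) {0..T}" if "0 \<le> T" for T
    by (intro has_integral_add V_int[OF that] integrable_integral c_on)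
  \<comment> \<open>\<open>u (x t)\<close> grows at most linearly in time, so the discounted
    boundary term disappears.\<close>
  have V_lim: "(V \<longlongrightarrow> 0) at_top"
  proof (rule Lim_null_comparison)
    show "eventually (\<lambda>t. norm (V t) \<le> exp (- t) * (\<bar>u y\<bar> + P * B * t)) at_top"
      using eventually_ge_at_top[of 0]
    proof eventually_elim
      case (elim t)
      have "\<bar>u (x t) - u y\<bar> \<le> P * \<bar>x t - y\<bar>" by (rule u_lip)
      also have "\<dots> \<le> P * (B * t)" using x_lip[of 0 t] elim x0 P by (intro mult_left_mono) auto
      finally have "\<bar>u (x t)\<bar> \<le> \<bar>u y\<bar> + P * B * t" by simp
      then show ?case by (simp add: V_def abs_mult)
    qed
    show "((\<lambda>t. exp (- t) * (\<bar>u y\<bar> + P * B * t)) \<longlongrightarrow> 0) at_top"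
      by real_asymp
  qed
  have lim: "((\<lambda>T. V T - V 0 + integral {0..T} c) \<longlongrightarrow> 0 - V 0 + integral {0..} c) at_top"
    by (intro tendsto_intros V_lim c_lim)
  have V0: "V 0 = u y" by (simp add: V_def x0)
  have "0 \<le> 0 - V 0 + integral {0..} c"
  proof (rule tendsto_lowerbound[OF lim])
    show "eventually (\<lambda>T. 0 \<le> V T - V 0 + integral {0..T} c) at_top"
      using eventually_ge_at_top[of 0]
      by eventually_elim (rule has_integral_nonneg[OF vc_int], auto simp: vc)
  qed simp
  moreover have "integral {0..} c = u y" if "\<forall>t\<ge>0. \<alpha> t = - p (x t)"
  proof -
    have "eventually (\<lambda>T. V T - V 0 + integral {0..T} c = 0) at_top"
      using eventually_ge_at_top[of 0]
    proof eventually_elim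
      case (elim T)
      have "((\<lambda>t. v t + c t) has_integral 0) {0..T}"
        by (rule has_integral_is_0) (use that in \<open>auto simp: vc\<close>)
      then show ?case using vc_int[OF elim] has_integral_unique by blast
    qed
    then have "((\<lambda>T. V T - V 0 + integral {0..T} c) \<longlongrightarrow> 0) at_top" by (rule tendsto_eventually)
    then have "0 - V 0 + integral {0..} c = 0" using tendsto_unique[OF _ lim] by force
    then show ?thesis using V0 by simp
  qed
  ultimately show ?thesis using cost V0 by (intro exI[of _ "integral {0..} c"]) auto
qed

text \<open>A closed-loop trajectory is also a trajectory of the open-loop control
  \<open>- p (x t)\<close>, measurable by continuity of \<open>p\<close>. So
  \<open>verification\<close> yields both its cost and the lower bound for all competitors.\<close>

lemma feedback_is_min_cost:
  fixes h u p b :: "real \<Rightarrow> real"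
  assumes h_lip: "\<And>x y. \<bar>h x - h y\<bar> \<le> M * \<bar>x - y\<bar>"
    and u: "\<And>y. (u has_real_derivative p y) (at y)" and p: "\<And>y. \<bar>p y\<bar> \<le> P"
    and b: "\<And>y. \<bar>b y\<bar> \<le> P" and hjb: "\<And>y. u y = h y + p y * b y - (p y)\<^sup>2 / 2"
    and p_cont: "continuous_on UNIV p"
    and U: "bounded U" "\<And>y. - p y \<in> U"
    and x: "caratheodory_solution (\<lambda>t z. - p z + b z) y x"
  shows "has_cost h (\<lambda>t. - p (x t)) x (u y) \<and> is_min_cost h U b y (u y)"
proof -
  have x': "caratheodory_solution (\<lambda>t z. - p (x t) + b z) y x"
    using x by (simp add: caratheodory_solution_def)
  have "\<bar>x t - x s\<bar> \<le> (P + P) * \<bar>t - s\<bar>" if "0 \<le> s" "0 \<le> t" for s t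
  proof (rule caratheodory_solution_lipschitz[OF x _ that])
    show "\<bar>- p (x t) + b (x t)\<bar> \<le> P + P" for t using p[of "x t"] b[of "x t"] by simp
  qed
  then have "(P + P)-lipschitz_on {0..} x"
    using p[of 0] by (intro lipschitz_onI) (auto simp: dist_real_def)
  then have "continuous_on {0..} x" by (rule lipschitz_on_continuous_on)
  then have meas: "(\<lambda>t. - p (x t)) \<in> borel_measurable (lebesgue_on {0..})"
    by (intro continuous_imp_measurable_on_sets_lebesgue continuous_on_minus continuous_on_compose2[OF p_cont]) auto
  obtain c where "has_cost h (\<lambda>t. - p (x t)) x c" "c = u y"
    using verification[OF h_lip u p b hjb x' meas, of P] p by auto
  then have cost: "has_cost h (\<lambda>t. - p (x t)) x (u y)" by simp
  moreover have "control_trajectory U b y (\<lambda>t. - p (x t)) x"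
    using meas x' U(2) by (simp add: control_trajectory_def)
  moreover have "\<exists>c'. has_cost h \<alpha> z c' \<and> u y \<le> c'" if "control_trajectory U b y \<alpha> z" for \<alpha> z
  proof -
    obtain A where A: "\<And>r. r \<in> U \<Longrightarrow> norm r \<le> A" using U(1) by (auto simp: bounded_iff)
    show ?thesis
      using verification[OF h_lip u p b hjb, of \<alpha> y z A] that A
      unfolding control_trajectory_def by fastforce
  qed
  ultimately show ?thesis unfolding is_min_cost_def by blast
qed

lemma caratheodory_solution_exists:
  fixes g :: "real \<Rightarrow> real"
  assumes lip: "\<And>x y. \<bar>g x - g y\<bar> \<le> L * \<bar>x - y\<bar>" and bound: "\<And>x. \<bar>g x\<bar> \<le> B"
  shows "\<exists>x. caratheodory_solution (\<lambda>t z. g z) y x"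
proof -
  have L: "0 \<le> L" using lip[of 1 0] by simp
  have "L-lipschitz_on UNIV g" using lip L by (intro lipschitz_onI) (auto simp: dist_real_def)
  then have g_cont: "continuous_on UNIV g" by (rule lipschitz_on_continuous_on)
  have "\<exists>x. x 0 = y \<and> (\<forall>t\<ge>0. (x has_vector_derivative g (x t)) (at t within {0..}))"
  \<comment> \<open>\<open>L + 1\<close> because the constant must be positive, and \<open>L\<close>
    may be 0.\<close>
  proof (rule global_lipschitz_ode[of "\<lambda>t z. g z" "L + 1" B 0 y])
    show "continuous_on UNIV (\<lambda>(t :: real, x). g x)"
      unfolding split_def by (rule continuous_on_compose2[OF g_cont]) (auto intro: continuous_intros)
    show "norm (g v - g w) \<le> (L + 1) * norm (v - w)" for v w
    proof -
      have "L * \<bar>v - w\<bar> \<le> (L + 1) * \<bar>v - w\<bar>" by (intro mult_right_mono) auto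
      then show ?thesis using lip[of v w] by simp
    qed
  qed (use L bound in auto)
  then obtain x where x: "x 0 = y" "\<And>t. 0 \<le> t \<Longrightarrow> (x has_real_derivative g (x t)) (at t within {0..})"
    by (auto simp: has_real_derivative_iff_has_vector_derivative)
  have "abs_continuous_on 0 T x" for T
  proof (rule abs_continuous_on_lipschitz[where L = B])
    show "norm (x s - x t) \<le> B * \<bar>s - t\<bar>" if "s \<in> {0..T}" "t \<in> {0..T}" for s t
      using field_differentiable_bound[of "{0..}" x "\<lambda>t. g (x t)" B s t] x(2) bound that by auto
  qed
  moreover have "(x has_real_derivative g (x t)) (at t)" if "t > 0" for t
  proof -
    have "at t within {0..} = at t" by (rule at_within_interior) (use that in simp)
    then show ?thesis using x(2)[of t] that by simp
  qed
  ultimately show ?thesis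
    using x(1) unfolding caratheodory_solution_def by (intro exI[of _ x]) simp
qed

section \<open>The equilibrium for piecewise linear costs\<close>

text \<open>The constructed solution is differentiable everywhere, so
  \<open>neg_derivative_feedback\<close> determines both strategies at every point, and admissible
  control sets contain all their values.\<close>

theorem (in monotone_costs) unique_admissible_Nash:
  "(\<exists>!u. admissible_solution h1 h2 u) \<and>
    (\<forall>u. admissible_solution h1 h2 u \<longrightarrow>
       (\<exists>U1 U2. control_sets_for u U1 U2) \<and>
       (\<forall>U1 U2 a1 a2. control_sets_for u U1 U2 \<longrightarrow> neg_derivative_feedback u a1 a2 \<longrightarrow>
          nash_feedback h1 h2 U1 U2 a1 a2))"
proof -
  obtain u1 u2 p1 p2 P L where
    u: "\<And>y. (u1 has_real_derivative p1 y) (at y)" "\<And>y. (u2 has_real_derivative p2 y) (at y)"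
    and ham: "\<And>y. hamiltonian (p1 y) (p2 y) = h1 y - u1 y" "\<And>y. hamiltonian (p2 y) (p1 y) = h2 y - u2 y"
    and p: "\<And>y. 0 \<le> p1 y \<and> p1 y \<le> P" "\<And>y. 0 \<le> p2 y \<and> p2 y \<le> P"
    and p_lip: "\<And>x y. \<bar>p1 x - p1 y\<bar> \<le> L * \<bar>x - y\<bar>" "\<And>x y. \<bar>p2 x - p2 y\<bar> \<le> L * \<bar>x - y\<bar>"
    by (rule classical_solution) blast
  have P: "0 \<le> P" using p(1)[of 0] by linarith
  have L: "0 \<le> L" using p_lip(1)[of 1 0] by simp
  have "L-lipschitz_on UNIV p1" "L-lipschitz_on UNIV p2"
    using p_lip L by (auto intro!: lipschitz_onI simp: dist_real_def)
  then have p_cont: "continuous_on UNIV p1" "continuous_on UNIV p2"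
    by (auto intro: lipschitz_on_continuous_on)
  have u_cont: "continuous_on UNIV u1" "continuous_on UNIV u2"
    using u by (auto intro!: DERIV_continuous_on DERIV_isCont continuous_at_imp_continuous_on)
  define v where "v y = (u1 y, u2 y)" for y
  have v: "(v has_vector_derivative (p1 y, p2 y)) (at y)" for y
    unfolding v_def using u[of y]
    by (auto intro: has_vector_derivative_Pair simp: has_real_derivative_iff_has_vector_derivative)
  have p_norm: "norm (p1 y, p2 y) \<le> 2 * P" for y
    using norm_Pair_le[of "p1 y" "p2 y"] p[of y] by simp
  have v_lip: "norm (v s - v t) \<le> 2 * P * \<bar>s - t\<bar>" for s t
  proof -
    have "norm (v s - v t) \<le> 2 * P * norm (s - t)"
    proof (rule differentiable_bound[of UNIV v "\<lambda>x r. r *\<^sub>R (p1 x, p2 x)"])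
      show "onorm (\<lambda>r. r *\<^sub>R (p1 x, p2 x)) \<le> 2 * P" for x
      proof (rule onorm_le)
        fix r :: real
        have "norm (r *\<^sub>R (p1 x, p2 x)) = norm r * norm (p1 x, p2 x)"
          by (simp only: norm_scaleR real_norm_def)
        also have "\<dots> \<le> norm r * (2 * P)" by (rule mult_left_mono[OF p_norm]) simp
        finally show "norm (r *\<^sub>R (p1 x, p2 x)) \<le> 2 * P * norm r" by (simp only: mult.commute)
      qed
    qed (use v in \<open>auto simp: has_vector_derivative_def\<close>)
    then show ?thesis by simp
  qed
  have adm: "admissible_solution h1 h2 v"
    unfolding admissible_solution_def Let_def
  proof (intro conjI allI)
    show "abs_continuous_on s t v" for s t
      by (rule abs_continuous_on_lipschitz) (rule v_lip)
    show "AE y in lebesgue. \<exists>p1 p2. (v has_vector_derivative (p1, p2)) (at y) \<and>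
        fst (v y) = h1 y - p1 * p2 - p1\<^sup>2 / 2 \<and> snd (v y) = h2 y - p1 * p2 - p2\<^sup>2 / 2"
    proof (rule AE_I2, intro exI conjI)
      fix y
      show "(v has_vector_derivative (p1 y, p2 y)) (at y)" by (rule v)
      show "fst (v y) = h1 y - p1 y * p2 y - (p1 y)\<^sup>2 / 2" "snd (v y) = h2 y - p1 y * p2 y - (p2 y)\<^sup>2 / 2"
        using ham[of y] by (simp_all add: v_def hamiltonian_def mult.commute)
    qed
    have "norm (v y) \<le> (norm (v 0) + 2 * P) * (1 + \<bar>y\<bar>)" for y
    proof -
      have "norm (v y) \<le> norm (v 0) + norm (v y - v 0)" by (metis norm_triangle_sub)
      also have "\<dots> \<le> norm (v 0) + 2 * P * \<bar>y\<bar>" using v_lip[of y 0] by simp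
      also have "\<dots> \<le> norm (v 0) + 2 * P * \<bar>y\<bar> + (norm (v 0) * \<bar>y\<bar> + 2 * P)" using P by simp
      finally show ?thesis by (simp add: algebra_simps)
    qed
    then show "\<exists>C. \<forall>y. norm (v y) \<le> C * (1 + \<bar>y\<bar>)" by blast
    fix y
    have D: "{x. v differentiable at x} = UNIV" using v by (auto intro: differentiableI_vector)
    have v': "(\<lambda>x. vector_derivative v (at x)) = (\<lambda>x. (p1 x, p2 x))"
      using v by (auto intro: vector_derivative_at)
    have cont: "continuous_on UNIV (\<lambda>x. (p1 x, p2 x))" by (intro continuous_intros p_cont)
    then have lim: "((\<lambda>x. (p1 x, p2 x)) \<longlongrightarrow> (p1 y, p2 y)) (at y)"
      by (auto simp: continuous_on_eq_continuous_at isCont_def)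
    show "\<exists>r l. ((\<lambda>x. vector_derivative v (at x)) \<longlongrightarrow> r) (at y within {x. v differentiable at x} \<inter> {y<..}) \<and>
        ((\<lambda>x. vector_derivative v (at x)) \<longlongrightarrow> l) (at y within {x. v differentiable at x} \<inter> {..<y}) \<and>
        (\<not> (y \<in> {x. v differentiable at x} \<and>
            continuous (at y within {x. v differentiable at x}) (\<lambda>x. vector_derivative v (at x))) \<longrightarrow>
         fst r + snd r \<le> 0 \<or> 0 \<le> fst l + snd l)"
      unfolding v' D using lim
      by (intro exI[of _ "(p1 y, p2 y)"]) (auto simp: continuous_within intro: tendsto_within_subset)
  qed
  have uniq: "w = v" if "admissible_solution h1 h2 w" for w
  proof
    fix y
    obtain r1 r2 l1 l2 C where
      "one_sided_solution h1 h2 (\<lambda>x. fst (w x)) (\<lambda>x. snd (w x)) r1 r2 l1 l2 a c1 c2 C"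
      using admissible_imp_one_sided[OF \<open>admissible_solution h1 h2 w\<close>] by blast
    then interpret s: one_sided_solution h1 h2 "\<lambda>x. fst (w x)" "\<lambda>x. snd (w x)" r1 r2 l1 l2 a c1 c2 C .
    define Q where "Q = P * P + P * P"
    have bd: "\<bar>hamiltonian q q'\<bar> \<le> Q * (1 + \<bar>z\<bar>)" if "0 \<le> q" "q \<le> P" "0 \<le> q'" "q' \<le> P" for q q' z
    proof -
      have "q * q' \<le> P * P" "q * q \<le> P * P" "0 \<le> q * q'" "0 \<le> q * q" using that by (auto intro!: mult_mono)
      then have "\<bar>hamiltonian q q'\<bar> \<le> Q * 1" unfolding hamiltonian_def Q_def power2_eq_square by simp
      also have "\<dots> \<le> Q * (1 + \<bar>z\<bar>)" using P by (intro mult_left_mono) (auto simp: Q_def)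
      finally show ?thesis .
    qed
    have "fst (w y) = u1 y \<and> snd (w y) = u2 y"
    proof (rule s.unique[OF u_cont _ _ ham, where P = "2 * P" and C' = Q])
      show "(u1 has_real_derivative p1 z) (at_right z)" "(u2 has_real_derivative p2 z) (at_right z)" for z
        using u by (auto intro: DERIV_subset)
      show "\<bar>h1 z - u1 z\<bar> \<le> Q * (1 + \<bar>z\<bar>)" "\<bar>h2 z - u2 z\<bar> \<le> Q * (1 + \<bar>z\<bar>)" for z
        using bd[of "p1 z" "p2 z" z] bd[of "p2 z" "p1 z" z] p[of z] unfolding ham by auto
      show "0 \<le> p1 z" "0 \<le> p2 z" "p1 z + p2 z \<le> 2 * P" for z using p[of z] by auto
    qed
    then show "w y = v y" by (simp add: v_def prod_eq_iff)
  qed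
  have deriv_unique: "q1 = p1 y \<and> q2 = p2 y" if "(v has_vector_derivative (q1, q2)) (at y)" for y q1 q2
    using vector_derivative_unique_at[OF that v] by simp
  have sets: "\<exists>U1 U2. control_sets_for v U1 U2"
  proof (intro exI)
    show "control_sets_for v {- P..0} {- P..0}"
      unfolding control_sets_for_def
    proof (intro conjI allI impI compact_Icc)
      fix y q1 q2
      assume "(v has_vector_derivative (q1, q2)) (at y)"
      from deriv_unique[OF this] show "- q1 \<in> {- P..0}" "- q2 \<in> {- P..0}" using p[of y] by auto
    qed
  qed
  have nash: "nash_feedback h1 h2 U1 U2 a1 a2"
    if U: "control_sets_for v U1 U2" and "neg_derivative_feedback v a1 a2" for U1 U2 a1 a2
  proof -
    have a: "a1 z = - p1 z" "a2 z = - p2 z" for z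
      using \<open>neg_derivative_feedback v a1 a2\<close> v unfolding neg_derivative_feedback_def by blast+
    then have a_eq: "a1 = (\<lambda>z. - p1 z)" "a2 = (\<lambda>z. - p2 z)" by auto
    have U': "bounded U1" "bounded U2" "- p1 z \<in> U1" "- p2 z \<in> U2" for z
      using U v[of z] unfolding control_sets_for_def by (auto intro: compact_imp_bounded)
    have abs_p: "\<bar>p1 z\<bar> \<le> P" "\<bar>p2 z\<bar> \<le> P" "\<bar>- p1 z\<bar> \<le> P" "\<bar>- p2 z\<bar> \<le> P" for z
      using p[of z] by auto
    have hjb: "u1 z = h1 z + p1 z * (- p2 z) - (p1 z)\<^sup>2 / 2" "u2 z = h2 z + p2 z * (- p1 z) - (p2 z)\<^sup>2 / 2" for z
      using ham[of z] by (simp_all add: hamiltonian_def)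
    show ?thesis
      unfolding nash_feedback_def a_eq
    proof (intro conjI allI impI)
      show "- p1 z \<in> U1" "- p2 z \<in> U2" for z by (fact U')+
      fix y
      show "\<exists>x. caratheodory_solution (\<lambda>t z. - p1 z + - p2 z) y x"
      proof (rule caratheodory_solution_exists[where L = "L + L" and B = "P + P"])
        show "\<bar>(- p1 x + - p2 x) - (- p1 z + - p2 z)\<bar> \<le> (L + L) * \<bar>x - z\<bar>" for x z
          using p_lip[of x z] unfolding distrib_right by linarith
        show "\<bar>- p1 x + - p2 x\<bar> \<le> P + P" for x using p[of x] by auto
      qed
      fix x assume x: "caratheodory_solution (\<lambda>t z. - p1 z + - p2 z) y x"
      then have x': "caratheodory_solution (\<lambda>t z. - p2 z + - p1 z) y x" by (simp add: add.commute)
      show "\<exists>c. has_cost h1 (\<lambda>t. - p1 (x t)) x c \<and> is_min_cost h1 U1 (\<lambda>z. - p2 z) y c"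
        using feedback_is_min_cost[OF h1_lipschitz u(1) abs_p(1,4) hjb(1) p_cont(1) U'(1,3) x] by blast
      show "\<exists>c. has_cost h2 (\<lambda>t. - p2 (x t)) x c \<and> is_min_cost h2 U2 (\<lambda>z. - p1 z) y c"
        using feedback_is_min_cost[OF h2_lipschitz u(2) abs_p(2,3) hjb(2) p_cont(2) U'(2,4) x'] by blast
    qed
  qed
  show ?thesis
  proof (intro conjI allI impI)
    show "\<exists>!u. admissible_solution h1 h2 u" using adm uniq by blast
    fix w assume "admissible_solution h1 h2 w"
    then have w: "w = v" by (rule uniq)
    show "\<exists>U1 U2. control_sets_for w U1 U2" using sets w by simp
    show "nash_feedback h1 h2 U1 U2 a1 a2"
      if "control_sets_for w U1 U2" "neg_derivative_feedback w a1 a2" for U1 U2 a1 a2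
      using nash that w by simp
  qed
qed

text \<open>The angle \<open>pi / 4\<close> lies in neither sector, and injectivity of the cosine on
  \<open>[0, pi]\<close> turns \<open>k = l\<close> into exactly this angle.\<close>

lemma sector_1_2_imp:
  assumes "(k, l) \<in> sector 1 \<union> sector 2"
  shows "0 < k" "0 < l" "k \<noteq> l"
proof -
  obtain \<rho> \<theta> where *: "k = \<rho> * cos \<theta>" "l = \<rho> * sin \<theta>" "0 < \<rho>" "0 < \<theta>" "\<theta> < pi / 2" "\<theta> \<noteq> pi / 4"
    using assms pi_gt_zero unfolding sector_def by fastforce
  then show "0 < k" "0 < l" using cos_gt_zero[of \<theta>] sin_gt_zero2[of \<theta>] by auto
  show "k \<noteq> l"
  proof
    assume "k = l"
    then have "cos \<theta> = cos (pi / 2 - \<theta>)" using * by (simp add: sin_cos_eq)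
    then have "\<theta> = pi / 2 - \<theta>" by (rule cos_inj_pi[rotated -1]) (use * in auto)
    then show False using * by simp
  qed
qed

text \<open>By the mean value theorem all nearby difference quotients to the right of
  \<open>y\<close> equal \<open>k\<close>. This supplies right derivatives at the
  breakpoints.\<close>

lemma has_real_derivative_at_right_of_interior:
  fixes h :: "real \<Rightarrow> real"
  assumes "continuous_on UNIV h" "y < e" "\<And>z. y < z \<Longrightarrow> z < e \<Longrightarrow> (h has_real_derivative k) (at z)"
  shows "(h has_real_derivative k) (at_right y)"
proof -
  have "(h z - h y) / (z - y) = k" if z: "y < z" "z < e" for z
  proof -
    have "\<exists>l \<xi>. y < \<xi> \<and> \<xi> < z \<and> DERIV h \<xi> :> l \<and> h z - h y = (z - y) * l"
    proof (rule MVT[OF z(1)])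
      show "continuous_on {y..z} h" using assms(1) continuous_on_subset by blast
      show "h differentiable (at \<xi>)" if "y < \<xi>" "\<xi> < z" for \<xi>
        using assms(3)[of \<xi>] that z real_differentiable_def by (metis order_less_trans)
    qed
    then obtain l \<xi> where "y < \<xi>" "\<xi> < z" "DERIV h \<xi> :> l" "h z - h y = (z - y) * l" by blast
    moreover have "l = k" using DERIV_unique[OF \<open>DERIV h \<xi> :> l\<close> assms(3)[of \<xi>]] calculation z by simp
    ultimately show ?thesis using z by simp
  qed
  then have "eventually (\<lambda>z. (h z - h y) / (z - y) = k) (at_right y)"
    by (intro eventually_mono[OF eventually_at_right_real[OF \<open>y < e\<close>]]) auto
  then show ?thesis unfolding has_field_derivative_iff by (rule tendsto_eventually)
qed

theorem theorem4:
  fixes N :: nat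
    and x :: "nat \<Rightarrow> ereal"
    and h1 h2 :: "real \<Rightarrow> real"
    and \<kappa>1 \<kappa>2 :: "nat \<Rightarrow> real"
  assumes "N \<ge> 1"
    and "x 0 = -\<infinity>" and "x (N + 1) = \<infinity>"
    and "\<And>j. j \<le> N \<Longrightarrow> x j < x (j + 1)"
    and "continuous_on UNIV h1" and "continuous_on UNIV h2"
    and "\<And>j y. j \<le> N \<Longrightarrow> x j < ereal y \<Longrightarrow> ereal y < x (j + 1) \<Longrightarrow>
           (h1 has_real_derivative \<kappa>1 j) (at y)"
    and "\<And>j y. j \<le> N \<Longrightarrow> x j < ereal y \<Longrightarrow> ereal y < x (j + 1) \<Longrightarrow>
           (h2 has_real_derivative \<kappa>2 j) (at y)"
    and "\<And>j. j \<le> N \<Longrightarrow> (\<kappa>1 j, \<kappa>2 j) \<in> sector 1 \<union> sector 2"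
  shows "(\<exists>!u. admissible_solution h1 h2 u) \<and>
    (\<forall>u. admissible_solution h1 h2 u \<longrightarrow>
       (\<exists>U1 U2. control_sets_for u U1 U2) \<and>
       (\<forall>U1 U2 a1 a2. control_sets_for u U1 U2 \<longrightarrow> neg_derivative_feedback u a1 a2 \<longrightarrow>
          nash_feedback h1 h2 U1 U2 a1 a2))"
proof -
  define K where "K = \<kappa>1 ` {..N} \<union> \<kappa>2 ` {..N}"
  have K: "finite K" "K \<noteq> {}" by (auto simp: K_def)
  have K_mem: "Min K \<le> \<kappa>1 j \<and> \<kappa>1 j \<le> Max K" "Min K \<le> \<kappa>2 j \<and> \<kappa>2 j \<le> Max K" if "j \<le> N" for j
    using K that by (auto simp: K_def)
  have pos: "0 < Min K"
  proof -
    have "0 < k" if "k \<in> K" for k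
      using that sector_1_2_imp(1,2)[OF assms(9)] by (auto simp: K_def)
    then show ?thesis using K by simp
  qed
  \<comment> \<open>Strictly between two extended reals, \<open>x 1\<close> is finite;
    \<open>N \<ge> 1\<close> provides the upper one.\<close>
  have x1: "x 0 < x 1" "x 1 < x 2" using assms(4)[of 0] assms(4)[of 1] assms(1) by (simp_all add: numeral_2_eq_2)
  define a where "a = real_of_ereal (x 1)"
  have a: "x 1 = ereal a" using x1 by (cases "x 1") (auto simp: a_def)
  have interval: "\<exists>j\<le>N. \<exists>e>y. \<forall>z. y < z \<longrightarrow> z < e \<longrightarrow> x j < ereal z \<and> ereal z < x (j + 1)" for y
  proof -
    \<comment> \<open>The largest index with \<open>x j \<le> ereal y\<close> belongs to the
      interval that lies immediately to the right of \<open>y\<close>, also when \<open>y\<close> is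
      a breakpoint.\<close>
    define J where "J = {j. j \<le> N \<and> x j \<le> ereal y}"
    have J: "finite J" "0 \<in> J" by (auto simp: J_def assms(2))
    define j where "j = Max J"
    have "j \<in> J" unfolding j_def using Max_in[OF J(1)] J(2) by blast
    then have j: "j \<le> N" "x j \<le> ereal y" by (auto simp: J_def)
    have "ereal y < x (j + 1)"
    proof (cases "j = N")
      case True
      then show ?thesis using assms(3) by simp
    next
      case False
      then have "j + 1 \<notin> J" using Max_ge[OF J(1), of "j + 1"] unfolding j_def by auto
      then show ?thesis using False j by (auto simp: J_def)
    qed
    then obtain e where e: "ereal y < ereal e" "ereal e < x (j + 1)" using ereal_dense2 by blast
    have "x j < ereal z \<and> ereal z < x (j + 1)" if "y < z" "z < e" for z
      using that j(2) e(2) by (metis ereal_less(2) less_ereal.simps(1) order_le_less_trans order_less_trans)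
    then show ?thesis using e j(1) by auto
  qed
  have right: "\<exists>k\<ge>Min K. k \<le> Max K \<and> (h1 has_real_derivative k) (at_right y)"
    "\<exists>k\<ge>Min K. k \<le> Max K \<and> (h2 has_real_derivative k) (at_right y)" for y
  proof -
    obtain j e where j: "j \<le> N" "y < e" "\<And>z. y < z \<Longrightarrow> z < e \<Longrightarrow> x j < ereal z \<and> ereal z < x (j + 1)"
      using interval[of y] by blast
    have "(h1 has_real_derivative \<kappa>1 j) (at_right y)" "(h2 has_real_derivative \<kappa>2 j) (at_right y)"
      using has_real_derivative_at_right_of_interior[OF assms(5) j(2)] assms(7)[OF j(1)]
        has_real_derivative_at_right_of_interior[OF assms(6) j(2)] assms(8)[OF j(1)] j(3) by blast+
    then show "\<exists>k\<ge>Min K. k \<le> Max K \<and> (h1 has_real_derivative k) (at_right y)"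
      "\<exists>k\<ge>Min K. k \<le> Max K \<and> (h2 has_real_derivative k) (at_right y)"
      using K_mem[OF j(1)] by blast+
  qed
  interpret monotone_costs h1 h2 a "\<kappa>1 0" "\<kappa>2 0" "Min K" "Max K"
  proof
    show "(h1 has_real_derivative \<kappa>1 0) (at y)" "(h2 has_real_derivative \<kappa>2 0) (at y)" if "y < a" for y
      using assms(7)[of 0 y] assms(8)[of 0 y] a that by (auto simp: assms(2))
    show "\<kappa>1 0 \<noteq> \<kappa>2 0" using sector_1_2_imp(3)[OF assms(9)] by simp
  qed (use pos right assms(5,6) K_mem[of 0] in auto)
  show ?thesis by (rule unique_admissible_Nash)
qed

end
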